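(* Let $1\le l\le m$ be an integer. Then $\mathcal{C}_{X_m,l,1}$ equals the submonoid of $\mathcal{B}_m$ generated by $\mathcal{A}_{0,l}\cup\mathcal{A}_{1,m}$. Moreover, $(n;H_1,\dots,H_m)\in\mathcal{B}_m$ lies in $\mathcal{C}_{X_m,l,1}$ if and only if there is a non-negative integer $\alpha_0\ge\max_{1\le i\le m}d_{0,i}$ with $\sum_{i=1}^md_{0,i}-(m-l)\alpha_0\ge0$.
   Context: Fix a prime $p$; $\mathbb{Z}_p$ is the $p$-adic integers; $\overline{\mathbb{Z}}_{\ge c}=\{x\in\mathbb{Z}:x\ge c\}\cup\{\infty\}$, $p^\infty=0$ (so $\mathbb{Z}_p/p^0\mathbb{Z}_p=0$, $\mathbb{Z}_p/p^\infty\mathbb{Z}_p=\mathbb{Z}_p$). $X_m=\{x_1,\dots,x_m\}$ is an ordered subset of $\mathbb{Z}_p$ of size $m$ with pairwise distinct reductions mod $p$. $\mathcal{M}_{\mathbb{Z}_p}$: isomorphism classes of finitely generated $\mathbb{Z}_p$-modules; $s(H)=\dim_{\mathbb{F}_p}(H/pH)$. $\mathcal{B}_m:=\{(n;H_1,\dots,H_m)\in\mathbb{Z}_{\ge0}\times\mathcal{M}_{\mathbb{Z}_p}^m: n\ge s(H_i)\ \forall i\}$, with $H_i\cong\prod_{r\in\overline{\mathbb{Z}}_{\ge1}}(\mathbb{Z}_p/p^r\mathbb{Z}_p)^{d_{r,i}}$, $d_{0,i}:=n-\sum_{r\ge1}d_{r,i}$, and monoid operation $(n;H_1,\dots,H_m)+(n';H'_1,\dots,H'_m)=(n+n';H_1\times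 H_1',\dots,H_m\times H_m')$ with identity $(0;0,\dots,0)$. The symmetric group $S_m$ acts on $\mathcal{B}_m$ by $\sigma\cdot(n;H_1,\dots,H_m)=(n;H_{\sigma(1)},\dots,H_{\sigma(m)})$. For $r\in\overline{\mathbb{Z}}_{\ge0}$ and $0\le d\le m$, $\mathcal{A}_{r,d}$ is the set of all $\sigma\cdot(1;\mathbb{Z}_p/p^{r_1}\mathbb{Z}_p,\dots,\mathbb{Z}_p/p^{r_d}\mathbb{Z}_p,\mathbb{Z}_p/p^r\mathbb{Z}_p,\dots,\mathbb{Z}_p/p^r\mathbb{Z}_p)$ with $\sigma\in S_m$ and $r_1,\dots,r_d\in\overline{\mathbb{Z}}_{\ge r}$. An $l$-th integral is a polynomial in $\operatorname{M}_n(\mathbb{Z}_p)[t]$ of the form $A_0+tA_1+\dots+t^lA_l+pt^{l+1}A_{l+1}+\dots+p^rt^{l+r}A_{l+r}$. $\mathcal{C}_{X_m,l,1}$ is the set of $(n;H_1,\dots,H_m)\in\mathcal{B}_m$ such that some $l$-th integral $P(t)\in\operatorname{M}_n(\mathbb{Z}_p)[t]$ satisfies $\operatorname{cok}_{\mathbb{F}_p}(\overline{P(x_i)})\cong H_i/pH_i$ for all $i$ ($\overline{\,\cdot\,}$ = reduction mod $p$). *)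

theory Defs
  imports
    "HOL-Library.Extended_Nat"
    "HOL-Combinatorics.Permutations"
    "HOL-Algebra.UnivPoly"
    "Jordan_Normal_Form.VS_Connect"
    "Berlekamp_Zassenhaus.Finite_Field"
begin

hide_const (open) Multiset.mult Polynomial.smult

section \<open>The p-adic integers\<close>

text \<open>
  The prime is the cardinality of the type parameter \<open>'p\<close>, so that \<open>'p mod_ring\<close> is the field with
  \<open>p\<close> elements. \<open>'p padic_int\<close> is the inverse limit of the rings of integers modulo \<open>p ^ k\<close>: the
  \<open>k\<close>-th component is the canonical representative modulo \<open>p ^ k\<close>.
\<close>

typedef (overloaded) 'p padic_int =
  "{f :: nat \<Rightarrow> int. (\<forall>k. f k \<in> {0..<int CARD('p::prime_card) ^ k}) \<and>
     (\<forall>k. f (Suc k) mod int CARD('p) ^ k = f k)}"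
  by (rule exI[of _ "\<lambda>_. 0"]) (auto simp: prime_gt_0_nat prime_card)

setup_lifting type_definition_padic_int

lemma padic_mod_pow_Suc:
  "a mod (int CARD('p::prime_card) ^ Suc k) mod int CARD('p) ^ k = a mod int CARD('p) ^ k"
  by (rule mod_mod_cancel) (rule le_imp_power_dvd, simp)

lemma padic_mod_in_range: "a mod int CARD('p::prime_card) ^ k \<in> {0..<int CARD('p) ^ k}"
  using prime_card[where 'a = 'p] by (simp add: prime_gt_0_nat)

lemma padic_mod_rep:
  assumes "(\<forall>k. f k \<in> {0..<int CARD('p::prime_card) ^ k}) \<and>
     (\<forall>k. f (Suc k) mod int CARD('p) ^ k = f k)"
  shows "f (Suc k) mod int CARD('p) ^ k = f k mod int CARD('p) ^ k"
    and "f k mod int CARD('p) ^ k = f k"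
  using assms by simp_all

instantiation padic_int :: (prime_card) comm_ring_1
begin

lift_definition zero_padic_int :: "'a padic_int" is "\<lambda>k. 0"
  by (simp add: zero_less_card_finite)

lift_definition one_padic_int :: "'a padic_int" is "\<lambda>k. 1 mod int CARD('a) ^ k"
  by (intro conjI allI padic_mod_in_range padic_mod_pow_Suc)

lift_definition plus_padic_int :: "'a padic_int \<Rightarrow> 'a padic_int \<Rightarrow> 'a padic_int" is
  "\<lambda>f g k. (f k + g k) mod int CARD('a) ^ k"
  by (intro conjI allI padic_mod_in_range, unfold padic_mod_pow_Suc)
    (rule mod_add_cong; erule padic_mod_rep)

lift_definition times_padic_int :: "'a padic_int \<Rightarrow> 'a padic_int \<Rightarrow> 'a padic_int" is
  "\<lambda>f g k. (f k * g k) mod int CARD('a) ^ k"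
  by (intro conjI allI padic_mod_in_range, unfold padic_mod_pow_Suc)
    (rule mod_mult_cong; erule padic_mod_rep)

lift_definition minus_padic_int :: "'a padic_int \<Rightarrow> 'a padic_int \<Rightarrow> 'a padic_int" is
  "\<lambda>f g k. (f k - g k) mod int CARD('a) ^ k"
  by (intro conjI allI padic_mod_in_range, unfold padic_mod_pow_Suc)
    (rule mod_diff_cong; erule padic_mod_rep)

lift_definition uminus_padic_int :: "'a padic_int \<Rightarrow> 'a padic_int" is
  "\<lambda>f k. (- f k) mod int CARD('a) ^ k"
  by (intro conjI allI padic_mod_in_range, unfold padic_mod_pow_Suc)
    (rule mod_minus_cong; erule padic_mod_rep)

instance
proof
  fix a b c :: "'a padic_int"
  show "a * b * c = a * (b * c)"
    by transfer (simp add: mod_mult_left_eq mod_mult_right_eq mult.assoc)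
  show "a * b = b * a"
    by transfer (simp add: mult.commute)
  show "1 * a = a"
    by transfer (rule ext, simp add: mod_mult_left_eq)
  show "a + b + c = a + (b + c)"
    by transfer (simp add: mod_add_left_eq mod_add_right_eq add.assoc)
  show "a + b = b + a"
    by transfer (simp add: add.commute)
  show "0 + a = a"
    by transfer (simp add: fun_eq_iff)
  show "- a + a = 0"
    by transfer (simp add: fun_eq_iff mod_add_left_eq)
  show "a - b = a + - b"
    by transfer (simp add: fun_eq_iff mod_add_right_eq)
  show "(a + b) * c = a * c + b * c"
    by transfer (simp add: fun_eq_iff mod_mult_left_eq mod_add_eq distrib_right)
  show "(0 :: 'a padic_int) \<noteq> 1"
  proof transfer
    have "(1 :: int) mod int CARD('a) ^ 1 \<noteq> 0"
      using prime_card_int[where 'a = 'a] by (simp add: prime_gt_1_int)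
    then show "(\<lambda>k. 0 :: int) \<noteq> (\<lambda>k. 1 mod int CARD('a) ^ k)"
      by (auto dest: fun_cong[where x = 1])
  qed
qed

end

lift_definition padic_red :: "'p::prime_card padic_int \<Rightarrow> 'p mod_ring" is "\<lambda>f. f 1"
  by (metis power_one_right)

definition padic_p :: "'p::prime_card padic_int" where
  "padic_p = of_nat CARD('p)"

text \<open>The convention is that \<open>p\<close> to the power infinity is zero.\<close>

definition padic_ppow :: "enat \<Rightarrow> 'p::prime_card padic_int" where
  "padic_ppow r = (case r of enat k \<Rightarrow> padic_p ^ k | \<infinity> \<Rightarrow> 0)"

section \<open>Modules\<close>

text \<open>
  The record \<^typ>\<open>('a, 'b) module\<close> extends rings; its fields \<open>mult\<close> and \<open>one\<close> are
  meaningless for modules and are left undefined.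
\<close>

definition quotient_module :: "('a, 'b) module \<Rightarrow> 'b set \<Rightarrow> ('a, 'b set) module" where
  "quotient_module M N =
    \<lparr>carrier = a_rcosets\<^bsub>M\<^esub> N, mult = undefined, one = undefined, zero = N, add = set_add M,
     smult = (\<lambda>a X. \<Union>x\<in>X. N +>\<^bsub>M\<^esub> (a \<odot>\<^bsub>M\<^esub> x))\<rparr>"

definition product_module :: "'i set \<Rightarrow> ('i \<Rightarrow> ('a, 'b) module) \<Rightarrow> ('a, 'i \<Rightarrow> 'b) module" where
  "product_module I F =
    \<lparr>carrier = (\<Pi>\<^sub>E i\<in>I. carrier (F i)), mult = undefined, one = undefined,
     zero = (\<lambda>i\<in>I. \<zero>\<^bsub>F i\<^esub>), add = (\<lambda>u v. \<lambda>i\<in>I. u i \<oplus>\<^bsub>F i\<^esub> v i),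
     smult = (\<lambda>a u. \<lambda>i\<in>I. a \<odot>\<^bsub>F i\<^esub> u i)\<rparr>"

definition module_isomorphic :: "'a ring \<Rightarrow> ('a, 'b) module \<Rightarrow> ('a, 'c) module \<Rightarrow> bool" where
  "module_isomorphic R M N \<longleftrightarrow>
    (\<exists>f \<in> module_hom R M N. bij_betw f (carrier M) (carrier N))"

definition finitely_generated_module :: "'a ring \<Rightarrow> ('a, 'b) module \<Rightarrow> bool" where
  "finitely_generated_module R M \<longleftrightarrow>
    Module.module R M \<and>
    (\<exists>S. finite S \<and> S \<subseteq> carrier M \<and> LinearCombinations.module.span R M S = carrier M)"

definition cokernel :: "'a::comm_ring_1 mat \<Rightarrow> ('a, 'a vec set) module" where
  "cokernel B =
    quotient_module (module_vec TYPE('a) (dim_row B)) ((\<lambda>v. B *\<^sub>v v) ` carrier_vec (dim_col B))"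

definition regular_module :: "('a::comm_ring_1, 'a) module" where
  "regular_module =
    \<lparr>carrier = UNIV, mult = undefined, one = undefined, zero = 0, add = (+), smult = (*)\<rparr>"

definition cyclic_module :: "enat \<Rightarrow> ('p::prime_card padic_int, 'p padic_int set) module" where
  "cyclic_module r = quotient_module regular_module (range (\<lambda>a. padic_ppow r * a))"

text \<open>
  The module \<open>M / pM\<close> as a vector space over the field with \<open>p\<close> elements; a scalar acts through
  any lift to the p-adic integers.
\<close>

definition mod_p ::
  "('p::prime_card padic_int, 'b) module \<Rightarrow> ('p mod_ring, 'b set) module" where
  "mod_p M =
    (let Q = quotient_module M ((\<lambda>h. padic_p \<odot>\<^bsub>M\<^esub> h) ` carrier M) in
    \<lparr>carrier = carrier Q, mult = undefined, one = undefined, zero = \<zero>\<^bsub>Q\<^esub>, add = add Q,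
     smult = (\<lambda>c X. of_int (to_int_mod_ring c) \<odot>\<^bsub>Q\<^esub> X)\<rparr>)"

section \<open>Isomorphism classes of finitely generated modules\<close>

text \<open>
  Isomorphism classes are formed inside one fixed carrier type. The type of sets of vectors
  contains the underlying sets of all quotients of finite free modules, hence, up to isomorphism,
  all finitely generated modules.
\<close>

type_synonym 'p padic_module = "('p padic_int, 'p padic_int vec set) module"

definition iso_class :: "('p::prime_card padic_int, 'b) module \<Rightarrow> 'p padic_module set" where
  "iso_class M =
    {N. finitely_generated_module class_ring N \<and> module_isomorphic class_ring M N}"

definition module_classes :: "'p::prime_card padic_module set set" where
  "module_classes = iso_class ` {M :: 'p padic_module. finitely_generated_module class_ring M}"

definition class_rep :: "'p::prime_card padic_module set \<Rightarrow> 'p padic_module" where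
  "class_rep H = (SOME M. M \<in> H)"

definition s_invariant :: "'p::prime_card padic_module set \<Rightarrow> nat" where
  "s_invariant H = vectorspace.dim class_ring (mod_p (class_rep H))"

definition class_prod ::
  "'p::prime_card padic_module set \<Rightarrow> 'p padic_module set \<Rightarrow> 'p padic_module set" where
  "class_prod H H' = iso_class (direct_sum (class_rep H) (class_rep H'))"

definition class_zero :: "'p::prime_card padic_module set" where
  "class_zero = iso_class (module_vec TYPE('p padic_int) 0)"

text \<open>
  A choice of the exponents in the decomposition of \<open>H\<close> into cyclic modules (by the structure
  theorem they exist and are unique).
\<close>

definition cyclic_exponents :: "'p::prime_card padic_module set \<Rightarrow> enat \<Rightarrow> nat" where
  "cyclic_exponents H =
    (SOME d. d 0 = 0 \<and> finite {r. d r \<noteq> 0} \<and>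
       module_isomorphic class_ring (class_rep H)
         (product_module {(r, j). 1 \<le> r \<and> j < d r} (\<lambda>(r, j). cyclic_module r)))"

definition d_zero :: "nat \<Rightarrow> 'p::prime_card padic_module set \<Rightarrow> int" where
  "d_zero n H = int n - (\<Sum>r | 1 \<le> r \<and> cyclic_exponents H r \<noteq> 0. int (cyclic_exponents H r))"

section \<open>The monoid of tuples\<close>

text \<open>Families indexed by \<open>1, ..., m\<close> are functions that are undefined outside \<open>{1..m}\<close>.\<close>

type_synonym 'p module_tuple = "nat \<times> (nat \<Rightarrow> 'p padic_module set)"

definition B_monoid :: "nat \<Rightarrow> 'p::prime_card module_tuple monoid" where
  "B_monoid m =
    \<lparr>carrier = {(n, H). H \<in> {1..m} \<rightarrow>\<^sub>E module_classes \<and> (\<forall>i\<in>{1..m}. s_invariant (H i) \<le> n)},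
     mult = (\<lambda>(n, H) (n', H'). (n + n', \<lambda>i\<in>{1..m}. class_prod (H i) (H' i))),
     one = (0, \<lambda>i\<in>{1..m}. class_zero)\<rparr>"

definition permute_tuple ::
  "nat \<Rightarrow> (nat \<Rightarrow> nat) \<Rightarrow> 'p::prime_card module_tuple \<Rightarrow> 'p module_tuple" where
  "permute_tuple m \<sigma> = (\<lambda>(n, H). (n, \<lambda>i\<in>{1..m}. H (\<sigma> i)))"

definition A_set :: "nat \<Rightarrow> enat \<Rightarrow> nat \<Rightarrow> 'p::prime_card module_tuple set" where
  "A_set m r d =
    {permute_tuple m \<sigma>
       (1, \<lambda>i\<in>{1..m}. iso_class (cyclic_module (if i \<le> d then e i else r))) | \<sigma> e.
     \<sigma> permutes {1..m} \<and> (\<forall>i\<in>{1..d}. r \<le> e i)}"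

definition generated_submonoid :: "('a, 'b) monoid_scheme \<Rightarrow> 'a set \<Rightarrow> 'a set" where
  "generated_submonoid G S = \<Inter>{N. submonoid N G \<and> S \<subseteq> N}"

section \<open>Integrals\<close>

abbreviation padic_mat_ring :: "nat \<Rightarrow> 'p::prime_card padic_int mat ring" where
  "padic_mat_ring n \<equiv> ring_mat TYPE('p padic_int) n ()"

definition is_integral :: "nat \<Rightarrow> nat \<Rightarrow> (nat \<Rightarrow> 'p::prime_card padic_int mat) \<Rightarrow> bool" where
  "is_integral n l P \<longleftrightarrow>
    P \<in> carrier (UP (padic_mat_ring n)) \<and>
    (\<exists>r A. (\<forall>k. A k \<in> carrier_mat n n) \<and>
       (\<forall>k. up_ring.coeff (UP (padic_mat_ring n)) P k =
          (if k \<le> l then A k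
           else if k \<le> l + r then padic_p ^ (k - l) \<cdot>\<^sub>m A k
           else 0\<^sub>m n n)))"

text \<open>A scalar \<open>a\<close> is substituted for the variable as the scalar matrix with diagonal \<open>a\<close>.\<close>

definition mat_poly_eval ::
  "nat \<Rightarrow> (nat \<Rightarrow> 'p::prime_card padic_int mat) \<Rightarrow> 'p padic_int \<Rightarrow> 'p padic_int mat" where
  "mat_poly_eval n P a =
    UnivPoly.eval (padic_mat_ring n) (padic_mat_ring n) (\<lambda>B. B) (a \<cdot>\<^sub>m 1\<^sub>m n) P"

text \<open>
  Only the class modulo \<open>p\<close> of the modules is prescribed; this is the set with third index 1 in the
  usual notation. The isomorphism is one of vector spaces over the field with \<open>p\<close> elements.
\<close>

definition C_set :: "nat \<Rightarrow> (nat \<Rightarrow> 'p::prime_card padic_int) \<Rightarrow> nat \<Rightarrow> 'p module_tuple set" where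
  "C_set m x l =
    {(n, H). (n, H) \<in> carrier (B_monoid m) \<and>
       (\<exists>P. is_integral n l P \<and>
          (\<forall>i\<in>{1..m}. module_isomorphic class_ring
             (cokernel (map_mat padic_red (mat_poly_eval n P (x i)))) (mod_p (class_rep (H i)))))}"

end

theory Submission
  imports Defs "HOL-Number_Theory.Cong"
begin

text \<open>
  Only the coranks of the reductions of \<open>P(x\<^sub>i)\<close> matter, and modulo \<open>p\<close> an integral is an arbitrary
  matrix polynomial \<open>Q\<close> of degree at most \<open>l\<close> over the field with \<open>p\<close> elements. If \<open>Q\<close> has
  corank \<open>s\<^sub>i\<close> at \<open>x\<^sub>i\<close>, with minimum \<open>s\<^sub>0\<close>, then \<open>Q\<close> plus \<open>\<Prod>(t - x\<^sub>i)\<close>, \<open>i \<noteq> 0\<close>, on an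
  \<open>s\<^sub>0\<close>-dimensional complement has a nonzero determinant of degree at most
  \<open>s\<^sub>0 (m - 1) + (n - s\<^sub>0) l\<close> that vanishes to order \<open>s\<^sub>i\<close> at each \<open>x\<^sub>i\<close>, \<open>i \<noteq> 0\<close>; this is the inequality
  with \<open>\<alpha>\<^sub>0 = n - s\<^sub>0\<close>. Conversely, the inequality allows one to deal the nonzero entries cyclically to
  \<open>\<alpha>\<^sub>0\<close> rows so that each row has at most \<open>l\<close> zeros. The resulting zero pattern yields both a
  diagonal integral with entries \<open>\<Prod>(t - x\<^sub>i)\<close> and, filled with the exponents of the cyclic
  factors of the \<open>H\<^sub>i\<close>, a decomposition into \<open>\<alpha>\<^sub>0\<close> elements of \<open>\<A>\<^sub>0\<^sub>,\<^sub>l\<close> and \<open>n - \<alpha>\<^sub>0\<close>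
  elements of \<open>\<A>\<^sub>1\<^sub>,\<^sub>m\<close>.
\<close>

section \<open>Modules presented by diagonal relations\<close>

text \<open>Classes, their representatives and the cyclic exponents are given by choice, so nothing
  can be computed from them directly. The remedy is one invariant that does not see the choices: a
  surjection from coordinates whose kernel is cut out by one divisibility per coordinate. Sums,
  products and reduction mod p inherit it. A tuple \<open>(n, H)\<close> becomes a table with
  \<open>n\<close> rows and \<open>m\<close> columns of exponents in which d_{0,i} counts the zeros
  of column \<open>i\<close>. Exponents may be moved freely inside a column, and a generator is a
  single row. The determinant of \<open>Q\<close> itself may vanish identically, so it cannot be
  used directly. The product of the t - x_i over the other points is nonzero at the chosen point and
  invisible at all the others; it repairs the determinant at the price of degree m - 1 in each
  repaired row. That price bounds the degree of these rows only if l < m; for l = m the inequality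
  is met by \<alpha> = n. In the converse, \<alpha> is lowered to the largest d_{0,i}. Since m - l
  is nonnegative this keeps the inequality, and it gives \<alpha> at most n, so the dealt rows fit
  into the table.\<close>

definition coordinate_map :: "('a::comm_ring_1, 'b) module \<Rightarrow> (('i \<Rightarrow> 'a) \<Rightarrow> 'b) \<Rightarrow> bool" where
  "coordinate_map M \<phi> \<longleftrightarrow>
    (\<forall>a. \<phi> a \<in> carrier M) \<and> \<phi> (\<lambda>_. 0) = \<zero>\<^bsub>M\<^esub> \<and>
    (\<forall>a b. \<phi> (\<lambda>i. a i + b i) = \<phi> a \<oplus>\<^bsub>M\<^esub> \<phi> b) \<and>
    (\<forall>c a. \<phi> (\<lambda>i. c * a i) = c \<odot>\<^bsub>M\<^esub> \<phi> a)"

text \<open>The last clause describes the fibres of \<phi>, hence its kernel: one principal ideal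
  for each coordinate in \<open>I\<close>, all other coordinates being ignored. Phrasing it with
  \<open>a i - b i\<close> keeps subtraction in the ring of scalars.\<close>

definition presentation ::
  "('a::comm_ring_1, 'b) module \<Rightarrow> 'i set \<Rightarrow> ('i \<Rightarrow> 'a) \<Rightarrow> (('i \<Rightarrow> 'a) \<Rightarrow> 'b) \<Rightarrow> bool" where
  "presentation M I c \<phi> \<longleftrightarrow> coordinate_map M \<phi> \<and> carrier M \<subseteq> range \<phi> \<and>
    (\<forall>a b. \<phi> a = \<phi> b \<longleftrightarrow> (\<forall>i\<in>I. c i dvd a i - b i))"

text \<open>The module is isomorphic to the direct sum of the cyclic modules with relations \<open>c i\<close>.\<close>

definition diagonal_module ::
  "('a::comm_ring_1, 'b) module \<Rightarrow> 'i set \<Rightarrow> ('i \<Rightarrow> 'a) \<Rightarrow> bool" where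
  "diagonal_module M I c \<longleftrightarrow> (\<exists>\<phi>. presentation M I c \<phi>)"

lemma diagonal_moduleI: "presentation M I c \<phi> \<Longrightarrow> diagonal_module M I c"
  by (auto simp: diagonal_module_def)

lemma cring_class_ring: "cring (class_ring :: 'a::comm_ring_1 ring)"
  by (fact class_cring.is_cring)

lemma coordinate_mapD:
  assumes "coordinate_map M \<phi>"
  shows "\<phi> a \<in> carrier M" "\<phi> (\<lambda>_. 0) = \<zero>\<^bsub>M\<^esub>"
    "\<phi> a \<oplus>\<^bsub>M\<^esub> \<phi> b = \<phi> (\<lambda>i. a i + b i)" "c \<odot>\<^bsub>M\<^esub> \<phi> a = \<phi> (\<lambda>i. c * a i)"
  using assms by (auto simp: coordinate_map_def)

text \<open>Each axiom is lifted along \<phi> to an identity between coordinate functions. Quotients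
  and reductions thus become modules as soon as they are presented.\<close>

lemma coordinate_map_surj_imp_module:
  fixes M :: "('a::comm_ring_1, 'b) module" and \<phi> :: "('i \<Rightarrow> 'a) \<Rightarrow> 'b"
  assumes \<phi>: "coordinate_map M \<phi>" and surj: "carrier M \<subseteq> range \<phi>"
  shows "Module.module class_ring M"
proof -
  note D = coordinate_mapD[OF \<phi>]
  have lift: "\<exists>a. x = \<phi> a" if "x \<in> carrier M" for x
    using surj that by auto
  show ?thesis
  proof (rule moduleI[OF cring_class_ring], rule abelian_groupI, goal_cases)
    case (1 x y)
    then obtain a b where "x = \<phi> a" "y = \<phi> b" using lift by metis
    then show ?case by (simp add: D)
  next
    case 2
    show ?case using D(1)[of "\<lambda>_. 0"] by (simp add: D(2))
  next
    case (3 x y z)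
    then obtain a b c where "x = \<phi> a" "y = \<phi> b" "z = \<phi> c" using lift by metis
    then show ?case by (simp add: D add.assoc)
  next
    case (4 x y)
    then obtain a b where "x = \<phi> a" "y = \<phi> b" using lift by metis
    then show ?case by (simp add: D add.commute)
  next
    case (5 x)
    then obtain a where "x = \<phi> a" using lift by metis
    then show ?case by (simp add: D(1,3,4) D(2)[symmetric])
  next
    case (6 x)
    then obtain a where "x = \<phi> a" using lift by metis
    then have "\<phi> (\<lambda>i. - a i) \<oplus>\<^bsub>M\<^esub> x = \<zero>\<^bsub>M\<^esub>"
      by (simp add: D(1,3,4) D(2)[symmetric])
    then show ?case using D(1) by blast
  next
    case (7 a x)
    then obtain b where "x = \<phi> b" using lift by metis
    then show ?case by (simp add: D)
  next
    case (8 a b x)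
    then obtain d where "x = \<phi> d" using lift by metis
    then show ?case by (simp add: D distrib_right)
  next
    case (9 a x y)
    then obtain c d where "x = \<phi> c" "y = \<phi> d" using lift by metis
    then show ?case by (simp add: D distrib_left)
  next
    case (10 a b x)
    then obtain d where "x = \<phi> d" using lift by metis
    then show ?case by (simp add: D mult.assoc)
  next
    case (11 x)
    then obtain d where "x = \<phi> d" using lift by metis
    then show ?case by (simp add: D)
  qed
qed

lemma diagonal_module_is_module:
  "diagonal_module M I c \<Longrightarrow> Module.module class_ring M"
  by (auto simp: diagonal_module_def presentation_def intro: coordinate_map_surj_imp_module)

text \<open>The two presentations have the same fibres, so sending \<phi> a to \<psi> a is well
  defined and injective; the preimage picked by \<open>SOME\<close> does not matter.\<close>

lemma diagonal_module_isomorphic: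
  fixes M :: "('a::comm_ring_1, 'b) module" and N :: "('a, 'c) module"
  assumes "diagonal_module M I c" "diagonal_module N I c"
  shows "module_isomorphic class_ring M N"
proof -
  obtain \<phi> \<psi> where \<phi>: "presentation M I c \<phi>" and \<psi>: "presentation N I c \<psi>"
    using assms by (auto simp: diagonal_module_def)
  define f where "f x = \<psi> (SOME a. \<phi> a = x)" for x
  have \<phi>c: "coordinate_map M \<phi>" and \<psi>c: "coordinate_map N \<psi>"
    using \<phi> \<psi> by (auto simp: presentation_def)
  have f: "f (\<phi> a) = \<psi> a" for a
  proof -
    have "\<phi> (SOME b. \<phi> b = \<phi> a) = \<phi> a" by (rule someI[of "\<lambda>b. \<phi> b = \<phi> a"]) simp
    then show ?thesis unfolding f_def using \<phi> \<psi> by (simp add: presentation_def)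
  qed
  have lift: "\<exists>a. x = \<phi> a" if "x \<in> carrier M" for x
    using \<phi> that by (auto simp: presentation_def)
  have "f \<in> module_hom class_ring M N"
    unfolding module_hom_def
  proof (intro CollectI conjI allI impI funcsetI)
    fix x assume "x \<in> carrier M"
    then obtain a where "x = \<phi> a" using lift by metis
    then show "f x \<in> carrier N" using f coordinate_mapD(1)[OF \<psi>c] by metis
  next
    fix x y assume "x \<in> carrier M \<and> y \<in> carrier M"
    then obtain a b where "x = \<phi> a" "y = \<phi> b" using lift by metis
    then show "f (x \<oplus>\<^bsub>M\<^esub> y) = f x \<oplus>\<^bsub>N\<^esub> f y"
      by (simp add: coordinate_mapD[OF \<phi>c] coordinate_mapD[OF \<psi>c] f)
  next
    fix r x assume "r \<in> carrier (class_ring :: 'a ring) \<and> x \<in> carrier M"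
    then obtain a where "x = \<phi> a" using lift by metis
    then show "f (r \<odot>\<^bsub>M\<^esub> x) = r \<odot>\<^bsub>N\<^esub> f x"
      by (simp add: coordinate_mapD[OF \<phi>c] coordinate_mapD[OF \<psi>c] f)
  qed
  moreover have "bij_betw f (carrier M) (carrier N)"
  proof (rule bij_betw_imageI)
    show "inj_on f (carrier M)"
    proof (rule inj_onI)
      fix x y assume "x \<in> carrier M" "y \<in> carrier M" and eq: "f x = f y"
      then obtain a b where "x = \<phi> a" "y = \<phi> b" using lift by metis
      with eq show "x = y" using \<phi> \<psi> by (simp add: f presentation_def)
    qed
    have "carrier M = range \<phi>" "carrier N = range \<psi>"
      using \<phi> \<psi> by (auto simp: presentation_def coordinate_map_def)
    then show "f ` carrier M = carrier N"
      by (simp add: image_image f)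
  qed
  ultimately show ?thesis by (auto simp: module_isomorphic_def)
qed

lemma diagonal_module_transfer:
  fixes M :: "('a::comm_ring_1, 'b) module" and N :: "('a, 'c) module"
  assumes "diagonal_module M I c" "module_isomorphic class_ring M N" "Module.module class_ring N"
  shows "diagonal_module N I c"
proof -
  obtain \<phi> where \<phi>: "presentation M I c \<phi>"
    using assms by (auto simp: diagonal_module_def)
  obtain f where f: "f \<in> module_hom class_ring M N" and bij: "bij_betw f (carrier M) (carrier N)"
    using assms(2) by (auto simp: module_isomorphic_def)
  have \<phi>c: "coordinate_map M \<phi>" using \<phi> by (simp add: presentation_def)
  interpret mod_hom class_ring M N f
    using assms(3) diagonal_module_is_module[OF assms(1)] f
    by (intro mod_hom.intro mod_hom_axioms.intro)
  have hom: "coordinate_map N (\<lambda>a. f (\<phi> a))"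
    using coordinate_mapD[OF \<phi>c] module_hom_add[OF f] module_hom_smult[OF f] f0_is_0
    unfolding coordinate_map_def by (metis UNIV_I f_im partial_object.select_convs(1))
  have "carrier N \<subseteq> range (\<lambda>a. f (\<phi> a))"
  proof -
    have "carrier M = range \<phi>"
      using \<phi> coordinate_mapD(1)[OF \<phi>c] by (auto simp: presentation_def)
    then have "carrier N = f ` range \<phi>"
      using bij by (simp add: bij_betw_def)
    then show ?thesis by (simp add: image_image)
  qed
  moreover have "f (\<phi> a) = f (\<phi> b) \<longleftrightarrow> (\<forall>i\<in>I. c i dvd a i - b i)" for a b
  proof -
    have "f (\<phi> a) = f (\<phi> b) \<longleftrightarrow> \<phi> a = \<phi> b"
      using bij coordinate_mapD(1)[OF \<phi>c] by (auto simp: bij_betw_def inj_on_def)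
    then show ?thesis using \<phi> by (simp add: presentation_def)
  qed
  ultimately show ?thesis
    using hom by (intro diagonal_moduleI) (auto simp: presentation_def)
qed

lemma diagonal_module_reindex:
  assumes "diagonal_module M I c" "bij_betw f J I"
  shows "diagonal_module M J (\<lambda>j. c (f j))"
proof -
  obtain \<phi> where \<phi>: "presentation M I c \<phi>"
    using assms by (auto simp: diagonal_module_def)
  define g where "g = inv_into J f"
  have g: "g (f j) = j" if "j \<in> J" for j
    using that assms(2) by (auto simp: g_def bij_betw_def)
  have I: "I = f ` J" using assms(2) by (auto simp: bij_betw_def)
  have "presentation M J (\<lambda>j. c (f j)) (\<lambda>a. \<phi> (\<lambda>i. a (g i)))"
    unfolding presentation_def
  proof (intro conjI allI subsetI)
    show "coordinate_map M (\<lambda>a. \<phi> (\<lambda>i. a (g i)))"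
      using \<phi> by (auto simp: presentation_def coordinate_map_def)
    fix x assume "x \<in> carrier M"
    then obtain a where "x = \<phi> a" using \<phi> by (auto simp: presentation_def)
    also have "\<dots> = \<phi> (\<lambda>i. a (f (g i)))"
      using \<phi> g unfolding presentation_def I by auto
    finally show "x \<in> range (\<lambda>a. \<phi> (\<lambda>i. a (g i)))"
      by (intro image_eqI[of _ _ "\<lambda>j. a (f j)"]) auto
  qed (use \<phi> g in \<open>auto simp: presentation_def I\<close>)
  then show ?thesis by (rule diagonal_moduleI)
qed

lemma diagonal_module_cong:
  assumes "diagonal_module M I c"
    and "\<And>a. (\<forall>i\<in>I. c i dvd a i) \<longleftrightarrow> (\<forall>i\<in>J. d i dvd a i)"
  shows "diagonal_module M J d"
  using assms(1) unfolding diagonal_module_def presentation_def assms(2)[of "\<lambda>i. _ i - _ i"] .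

text \<open>The common source of the presentations of cyclic modules, cokernels and M / pM: that
  \<open>N\<close> is a subgroup, and when two cosets agree, is read off from
  \<open>ker\<close>.\<close>

lemma quotient_presentation:
  fixes M :: "('a::comm_ring_1, 'b) module"
  assumes \<phi>: "coordinate_map M \<phi>" and surj: "carrier M \<subseteq> range \<phi>" and N: "N \<subseteq> carrier M"
    and ker: "\<And>a. \<phi> a \<in> N \<longleftrightarrow> (\<forall>i\<in>I. c i dvd a i)"
  shows "presentation (quotient_module M N) I c (\<lambda>a. N +>\<^bsub>M\<^esub> \<phi> a)"
proof -
  note D = coordinate_mapD[OF \<phi>]
  interpret Module.module class_ring M
    by (rule coordinate_map_surj_imp_module[OF \<phi> surj])
  have lift: "\<exists>a. x = \<phi> a" if "x \<in> carrier M" for x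
    using surj that by auto
  have neg: "\<ominus>\<^bsub>M\<^esub> \<phi> a = \<phi> (\<lambda>i. - a i)" for a
    by (rule M.minus_equality) (simp_all add: D(1,3,4) D(2)[symmetric])
  have sub: "additive_subgroup N M"
  proof (rule additive_subgroup.intro, rule M.add.subgroupI)
    show "N \<subseteq> carrier M" by (rule N)
    have "\<phi> (\<lambda>_. 0) \<in> N" by (subst ker) simp
    then show "N \<noteq> {}" by blast
  next
    fix x assume x: "x \<in> N"
    then obtain a where a: "x = \<phi> a" using N lift by blast
    show "\<ominus>\<^bsub>M\<^esub> x \<in> N"
      using x unfolding a neg ker by simp
  next
    fix x y assume xy: "x \<in> N" "y \<in> N"
    then obtain a b where a: "x = \<phi> a" "y = \<phi> b" using N lift by blast
    show "x \<oplus>\<^bsub>M\<^esub> y \<in> N"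
      using xy by (simp add: a D ker)
  qed
  interpret abelian_subgroup N M
    by (rule abelian_subgroupI3[OF sub]) (rule M.abelian_group_axioms)
  have coset: "N +>\<^bsub>M\<^esub> \<phi> a = N +>\<^bsub>M\<^esub> \<phi> b \<longleftrightarrow> (\<forall>i\<in>I. c i dvd a i - b i)" for a b
  proof -
    have "N +>\<^bsub>M\<^esub> \<phi> a = N +>\<^bsub>M\<^esub> \<phi> b \<longleftrightarrow> \<phi> a \<in> N +>\<^bsub>M\<^esub> \<phi> b"
      using a_rcos_self[OF D(1)] a_repr_independence[OF _ D(1) a_subgroup] by (auto 0 3)
    also have "\<dots> \<longleftrightarrow> \<phi> a \<oplus>\<^bsub>M\<^esub> \<ominus>\<^bsub>M\<^esub> \<phi> b \<in> N"
      by (rule a_rcos_module[OF D(1) D(1)])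
    finally show ?thesis by (simp add: neg D ker)
  qed
  \<comment> \<open>The scalar action on a quotient is a union over all representatives of a coset;
    by linearity of the relations every member of the union is the same coset.\<close>
  have sm: "(\<Union>x\<in>N +>\<^bsub>M\<^esub> \<phi> a. N +>\<^bsub>M\<^esub> (r \<odot>\<^bsub>M\<^esub> x)) = N +>\<^bsub>M\<^esub> (r \<odot>\<^bsub>M\<^esub> \<phi> a)" for a r
  proof -
    have "N +>\<^bsub>M\<^esub> (r \<odot>\<^bsub>M\<^esub> x) = N +>\<^bsub>M\<^esub> (r \<odot>\<^bsub>M\<^esub> \<phi> a)" if x: "x \<in> N +>\<^bsub>M\<^esub> \<phi> a" for x
    proof -
      have "x \<in> carrier M" by (rule a_elemrcos_carrier[OF D(1) x])
      then obtain b where b: "x = \<phi> b" using lift by blast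
      have "N +>\<^bsub>M\<^esub> \<phi> b = N +>\<^bsub>M\<^esub> \<phi> a"
        using a_repr_independence[OF x[unfolded b] D(1) a_subgroup] by simp
      then have "\<forall>i\<in>I. c i dvd b i - a i" by (simp add: coset)
      then have "\<forall>i\<in>I. c i dvd r * b i - r * a i"
        by (auto simp: right_diff_distrib[symmetric])
      then show ?thesis by (simp add: b D coset)
    qed
    moreover have "\<phi> a \<in> N +>\<^bsub>M\<^esub> \<phi> a" by (rule a_rcos_self[OF D(1)])
    ultimately show ?thesis by blast
  qed
  show ?thesis
    unfolding presentation_def
  proof (intro conjI allI)
    show "coordinate_map (quotient_module M N) (\<lambda>a. N +>\<^bsub>M\<^esub> \<phi> a)"
      unfolding coordinate_map_def quotient_module_def
    proof (simp, intro conjI allI)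
      fix a show "N +>\<^bsub>M\<^esub> \<phi> a \<in> a_rcosets\<^bsub>M\<^esub> N"
        by (rule M.a_rcosetsI[OF N D(1)])
      show "N +>\<^bsub>M\<^esub> \<phi> (\<lambda>_. 0) = N"
        using M.a_coset_add_zero[OF N] by (simp add: D(2))
      fix b
      show "N +>\<^bsub>M\<^esub> \<phi> (\<lambda>i. a i + b i) = (N +>\<^bsub>M\<^esub> \<phi> a) <+>\<^bsub>M\<^esub> (N +>\<^bsub>M\<^esub> \<phi> b)"
        using a_rcos_sum[OF D(1) D(1)] by (simp add: D(3))
      fix r show "N +>\<^bsub>M\<^esub> \<phi> (\<lambda>i. r * a i) = (\<Union>x\<in>N +>\<^bsub>M\<^esub> \<phi> a. N +>\<^bsub>M\<^esub> (r \<odot>\<^bsub>M\<^esub> x))"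
        by (simp add: sm D)
    qed
    show "carrier (quotient_module M N) \<subseteq> range (\<lambda>a. N +>\<^bsub>M\<^esub> \<phi> a)"
      using surj by (auto simp: quotient_module_def A_RCOSETS_def' )
  qed (rule coset)
qed

section \<open>Arithmetic of p-adic integers\<close>

lemma padic_rep_range: "Rep_padic_int (a :: 'p::prime_card padic_int) k \<in> {0..<int CARD('p) ^ k}"
  using Rep_padic_int[of a] by blast

lemma padic_rep_mod:
  "Rep_padic_int (a :: 'p::prime_card padic_int) (k + j) mod int CARD('p) ^ k = Rep_padic_int a k"
proof (induction j)
  case 0
  show ?case using padic_rep_range[of a k] by simp
next
  case (Suc j)
  have "Rep_padic_int a (Suc (k + j)) mod int CARD('p) ^ (k + j) = Rep_padic_int a (k + j)"
    using Rep_padic_int[of a] by blast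
  then have "Rep_padic_int a (k + j) mod int CARD('p) ^ k
      = Rep_padic_int a (Suc (k + j)) mod int CARD('p) ^ (k + j) mod int CARD('p) ^ k"
    by simp
  also have "\<dots> = Rep_padic_int a (Suc (k + j)) mod int CARD('p) ^ k"
    by (rule mod_mod_cancel) (simp add: le_imp_power_dvd)
  finally show ?case using Suc.IH by simp
qed

lemma padic_rep_of_nat:
  "Rep_padic_int (of_nat n :: 'p::prime_card padic_int) k = int n mod int CARD('p) ^ k"
  by (induction n) (simp_all add: zero_padic_int.rep_eq one_padic_int.rep_eq plus_padic_int.rep_eq
      mod_add_eq add.commute)

lemma padic_rep_p_power:
  "Rep_padic_int (padic_p ^ k :: 'p::prime_card padic_int) j = int CARD('p) ^ k mod int CARD('p) ^ j"
  unfolding padic_p_def of_nat_power[symmetric] padic_rep_of_nat by simp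

text \<open>If component \<open>k\<close> is 0, all later components are divisible by p^k. Dividing
  them and shifting the index by \<open>k\<close> gives a compatible sequence \<open>u\<close>,
  which is the quotient.\<close>

lemma padic_rep_eq_0_iff:
  fixes a :: "'p::prime_card padic_int"
  shows "Rep_padic_int a k = 0 \<longleftrightarrow> padic_p ^ k dvd a"
proof
  let ?q = "int CARD('p)"
  assume 0: "Rep_padic_int a k = 0"
  have q: "?q > 0" using prime_card_int[where 'a = 'p] by (simp add: prime_gt_0_int)
  have dvd: "?q ^ k dvd Rep_padic_int a (k + j)" for j
    using padic_rep_mod[of a k j] 0 by (simp add: mod_0_imp_dvd)
  define u where "u j = Rep_padic_int a (k + j) div ?q ^ k" for j
  have u: "Rep_padic_int a (k + j) = ?q ^ k * u j" for j
    using dvd[of j] by (simp add: u_def)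
  have range: "u j \<in> {0..<?q ^ j}" for j
  proof -
    have qk: "?q ^ k > 0" using q by (rule zero_less_power)
    have "0 \<le> ?q ^ k * u j" "?q ^ k * u j < ?q ^ k * ?q ^ j"
      using padic_rep_range[of a "k + j"] unfolding u power_add by auto
    then show ?thesis
      unfolding mult_less_cancel_left_pos[OF qk] zero_le_mult_iff using qk by auto
  qed
  have compat: "u (Suc j) mod ?q ^ j = u j" for j
  proof -
    have "(?q ^ k * u (Suc j)) mod (?q ^ k * ?q ^ j) = ?q ^ k * u j"
      using padic_rep_mod[of a "k + j" 1] unfolding u[symmetric] power_add[symmetric]
      by (simp add: add.assoc)
    then have "?q ^ k * (u (Suc j) mod ?q ^ j) = ?q ^ k * u j"
      by (simp only: mult_mod_right)
    moreover have "?q ^ k \<noteq> 0" using q by simp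
    ultimately show ?thesis by (simp only: mult_left_cancel simp_thms)
  qed
  have rep: "Rep_padic_int (Abs_padic_int u :: 'p padic_int) = u"
    using range compat by (intro Abs_padic_int_inverse) blast
  have "a = padic_p ^ k * (Abs_padic_int u :: 'p padic_int)"
  proof (rule Rep_padic_int_inject[THEN iffD1], rule ext)
    fix j
    have "Rep_padic_int a j = (?q ^ k * u j) mod ?q ^ j"
      using padic_rep_mod[of a j k] by (simp add: u[symmetric] add.commute)
    then show "Rep_padic_int a j = Rep_padic_int (padic_p ^ k * Abs_padic_int u :: 'p padic_int) j"
      by (simp add: times_padic_int.rep_eq rep padic_rep_p_power mod_mult_left_eq)
  qed
  then show "padic_p ^ k dvd a" by simp
next
  assume "padic_p ^ k dvd a"
  then show "Rep_padic_int a k = 0"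
    by (auto simp: dvd_def times_padic_int.rep_eq padic_rep_p_power)
qed

lemma padic_red_add: "padic_red (a + b) = padic_red a + padic_red b"
  and padic_red_mult: "padic_red (a * b) = padic_red a * padic_red b"
  and padic_red_minus: "padic_red (a - b) = padic_red a - padic_red b"
  and padic_red_0: "padic_red (0 :: 'p padic_int) = 0"
  and padic_red_1: "padic_red (1 :: 'p padic_int) = 1"
  for a b :: "'p::prime_card padic_int"
proof -
  note reps = padic_red.rep_eq plus_mod_ring.rep_eq times_mod_ring.rep_eq minus_mod_ring.rep_eq
    zero_mod_ring.rep_eq one_mod_ring.rep_eq plus_padic_int.rep_eq times_padic_int.rep_eq
    minus_padic_int.rep_eq zero_padic_int.rep_eq one_padic_int.rep_eq
  show "padic_red (a + b) = padic_red a + padic_red b"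
    "padic_red (a * b) = padic_red a * padic_red b"
    "padic_red (a - b) = padic_red a - padic_red b"
    "padic_red 0 = (0 :: 'p mod_ring)" "padic_red 1 = (1 :: 'p mod_ring)"
    using prime_card_int[where 'a = 'p]
    by (simp_all add: Rep_mod_ring_inject[symmetric] reps prime_gt_1_int)
qed

interpretation padic_red: comm_ring_hom padic_red
  by unfold_locales (simp_all add: padic_red_add padic_red_mult padic_red_0 padic_red_1)

lemma padic_red_eq_0_iff: "padic_red a = 0 \<longleftrightarrow> padic_p dvd a"
  using padic_rep_eq_0_iff[of a 1]
  by (simp add: Rep_mod_ring_inject[symmetric] padic_red.rep_eq zero_mod_ring.rep_eq)

lemma padic_red_p: "padic_red padic_p = 0"
  by (simp add: padic_red_eq_0_iff)

lemma padic_red_lift: "padic_red (of_int (to_int_mod_ring c)) = (c :: 'p::prime_card mod_ring)"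
  by (simp add: padic_red.hom_of_int of_int_of_int_mod_ring)

text \<open>The inverse is assembled from inverses modulo each p^k. Such inverses are unique modulo
  p^k, and this makes the chosen ones compatible.\<close>

lemma padic_unit:
  fixes a :: "'p::prime_card padic_int"
  assumes "padic_red a \<noteq> 0"
  obtains b where "a * b = 1"
proof -
  let ?q = "int CARD('p)"
  have pr: "prime ?q" by (rule prime_card_int)
  have "\<not> ?q dvd Rep_padic_int a (Suc k)" for k
  proof -
    have "Rep_padic_int a 1 \<noteq> 0"
      using assms padic_rep_eq_0_iff[of a 1] by (simp add: padic_red_eq_0_iff)
    then show ?thesis using padic_rep_mod[of a 1 k] by (auto simp: dvd_eq_mod_eq_0)
  qed
  then have "coprime (Rep_padic_int a (Suc k)) ?q" for k
    using pr by (metis coprime_commute prime_imp_coprime)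
  then have cop: "coprime (Rep_padic_int a k) (?q ^ k)" for k
    by (cases k) simp_all
  have "\<exists>y. y \<in> {0..<?q ^ k} \<and> [Rep_padic_int a k * y = 1] (mod ?q ^ k)" for k
  proof -
    obtain y where "[Rep_padic_int a k * y = 1] (mod ?q ^ k)"
      using cong_solve_coprime_int[OF cop] by blast
    then have "[Rep_padic_int a k * (y mod ?q ^ k) = 1] (mod ?q ^ k)"
      by (simp add: cong_def mod_mult_right_eq)
    then show ?thesis using padic_mod_in_range by blast
  qed
  then obtain g where range: "\<And>k. g k \<in> {0..<?q ^ k}"
    and g: "\<And>k. [Rep_padic_int a k * g k = 1] (mod ?q ^ k)" by metis
  have compat: "g (Suc k) mod ?q ^ k = g k" for k
  proof -
    have "[Rep_padic_int a (Suc k) * g (Suc k) = 1] (mod ?q ^ k)"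
      using g[of "Suc k"] by (rule cong_dvd_modulus) simp
    moreover have "[Rep_padic_int a (Suc k) = Rep_padic_int a k] (mod ?q ^ k)"
      using padic_rep_mod[of a k 1] padic_rep_mod[of a k 0] by (simp add: cong_def)
    ultimately have "[Rep_padic_int a k * g (Suc k) = 1] (mod ?q ^ k)"
      by (metis cong_scalar_right cong_sym cong_trans)
    then have "[Rep_padic_int a k * g (Suc k) = Rep_padic_int a k * g k] (mod ?q ^ k)"
      using g[of k] by (metis cong_sym cong_trans)
    then have "[g (Suc k) = g k] (mod ?q ^ k)"
      using cop cong_mult_lcancel by blast
    then show ?thesis using range[of k] by (simp add: cong_def)
  qed
  have rep: "Rep_padic_int (Abs_padic_int g :: 'p padic_int) = g"
    using range compat by (intro Abs_padic_int_inverse) blast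
  have "a * Abs_padic_int g = 1"
    using g by (intro Rep_padic_int_inject[THEN iffD1] ext)
      (simp add: times_padic_int.rep_eq one_padic_int.rep_eq rep cong_def)
  then show ?thesis by (rule that)
qed

text \<open>A nonzero element is p^k times a unit. The two conclusions express this without naming
  the unit: a multiple of \<open>a\<close> equals p^k, and p^k divides \<open>a\<close>.\<close>

lemma padic_factorization:
  fixes a :: "'p::prime_card padic_int"
  assumes "a \<noteq> 0"
  obtains k b where "a * b = padic_p ^ k" "padic_p ^ k dvd a"
proof -
  have "\<exists>k. Rep_padic_int a k \<noteq> 0"
  proof (rule ccontr)
    assume "\<not> ?thesis"
    then have "Rep_padic_int a = Rep_padic_int (0 :: 'p padic_int)"
      by (auto simp: zero_padic_int.rep_eq)
    then show False using assms unfolding Rep_padic_int_inject by simp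
  qed
  then obtain k where k: "Rep_padic_int a k \<noteq> 0" "\<And>j. j < k \<Longrightarrow> Rep_padic_int a j = 0"
    using exists_least_iff[of "\<lambda>k. Rep_padic_int a k \<noteq> 0"] by blast
  \<comment> \<open>Component 0 is always 0, so the first nonzero component has index
    \<open>Suc j\<close>, and the valuation is \<open>j\<close>.\<close>
  have "k \<noteq> 0" using k(1) padic_rep_eq_0_iff[of a 0] by (cases k) auto
  then obtain j where j: "k = Suc j" by (cases k) auto
  have dvd: "padic_p ^ j dvd a" using k(2)[of j] j by (simp add: padic_rep_eq_0_iff)
  then obtain u where u: "a = padic_p ^ j * u" by (auto simp: dvd_def)
  have "padic_red u \<noteq> 0"
  proof
    assume "padic_red u = 0"
    then have "padic_p ^ k dvd a"
      by (simp add: padic_red_eq_0_iff u j mult.commute[of padic_p] mult_dvd_mono)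
    then show False using k(1) by (simp add: padic_rep_eq_0_iff)
  qed
  then obtain v where "u * v = 1" by (rule padic_unit)
  then have "a * v = padic_p ^ j" by (simp add: u mult.assoc)
  with dvd show ?thesis using that by blast
qed

lemma padic_red_ppow:
  "padic_red (padic_ppow r :: 'p::prime_card padic_int) = (if r = 0 then 1 else 0)"
proof (cases r)
  case (enat k)
  then show ?thesis
    by (cases k) (auto simp: padic_ppow_def padic_red.hom_mult padic_red_p zero_enat_def)
qed (simp add: padic_ppow_def)

section \<open>The structure of finitely generated modules\<close>

text \<open>
  Induction on the number of generators. A relation with a coordinate of minimal valuation \<open>k\<close> is
  \<open>p ^ k\<close> times a vector \<open>w\<close> with one coordinate equal to 1; the image of \<open>w\<close> can replace the
  corresponding generator, and minimality makes it split off.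
\<close>

lemma padic_diagonalization:
  fixes M :: "('p::prime_card padic_int, 'b) module" and \<psi> :: "('i \<Rightarrow> 'p padic_int) \<Rightarrow> 'b"
  assumes "Module.module class_ring M" "finite I" "coordinate_map M \<psi>"
    and "\<And>a. \<forall>i\<in>I. a i = 0 \<Longrightarrow> \<psi> a = \<zero>\<^bsub>M\<^esub>"
  shows "\<exists>e \<psi>'. coordinate_map M \<psi>' \<and> range \<psi>' = range \<psi> \<and>
    (\<forall>a. \<psi>' a = \<zero>\<^bsub>M\<^esub> \<longleftrightarrow> (\<forall>i\<in>I. padic_ppow (e i) dvd a i))"
  using assms(2-)
proof (induction "card I" arbitrary: I \<psi> rule: less_induct)
  case less
  interpret Module.module class_ring M by (rule assms(1))
  note D = coordinate_mapD[OF less.prems(2)]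
  note depends = less.prems(3)
  show ?case
  proof (cases "\<forall>a. \<psi> a = \<zero>\<^bsub>M\<^esub> \<longrightarrow> (\<forall>i\<in>I. a i = 0)")
    case True
    \<comment> \<open>Without nontrivial relations the module is free: exponent \<infinity> stands
      for the relation 0.\<close>
    then have "\<psi> a = \<zero>\<^bsub>M\<^esub> \<longleftrightarrow> (\<forall>i\<in>I. padic_ppow \<infinity> dvd a i)" for a
      using depends by (auto simp: padic_ppow_def)
    then show ?thesis using less.prems(2) by (intro exI[of _ "\<lambda>_. \<infinity>"] exI[of _ \<psi>]) blast
  next
    case False
    \<comment> \<open>Any nonzero coordinate of a relation can be scaled to a pure power of p, so
      the least attained \<open>k\<close> is the minimal valuation over all coordinates of all
      relations.\<close>
    define attained where "attained k \<longleftrightarrow>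
      (\<exists>a. \<psi> a = \<zero>\<^bsub>M\<^esub> \<and> (\<exists>i\<in>I. a i = padic_p ^ k))" for k
    have attains: "\<exists>k. attained k \<and> padic_p ^ k dvd a i"
      if a: "\<psi> a = \<zero>\<^bsub>M\<^esub>" and i: "i \<in> I" and nz: "a i \<noteq> 0" for a i
    proof -
      obtain k b where k: "a i * b = padic_p ^ k" "padic_p ^ k dvd a i"
        using padic_factorization[OF nz] by metis
      have "\<psi> (\<lambda>i. b * a i) = \<zero>\<^bsub>M\<^esub>"
        by (simp add: D(4)[symmetric] a)
      then have "attained k"
        unfolding attained_def using i k(1) by (metis mult.commute)
      then show ?thesis using k(2) by blast
    qed
    then have "\<exists>k. attained k" using False by blast
    then obtain k where "attained k" and least: "\<And>j. attained j \<Longrightarrow> k \<le> j"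
      by (metis LeastI Least_le)
    then obtain v j where v: "\<psi> v = \<zero>\<^bsub>M\<^esub>" and j: "j \<in> I" and vj: "v j = padic_p ^ k"
      unfolding attained_def by blast
    have dvd: "padic_p ^ k dvd a i" if a: "\<psi> a = \<zero>\<^bsub>M\<^esub>" "i \<in> I" for a i
    proof (cases "a i = 0")
      case False
      then obtain j where "attained j" "padic_p ^ j dvd a i"
        using attains[OF a] by blast
      then show ?thesis using least le_imp_power_dvd dvd_trans by metis
    qed simp
    \<comment> \<open>\<open>w\<close> is the minimal relation \<open>v\<close> divided by p^k, with
      coordinate \<open>j\<close> equal to 1.\<close>
    define w where "w i = (if i = j then 1 else SOME u. v i = padic_p ^ k * u)" for i
    have vw: "v i = padic_p ^ k * w i" if "i \<in> I" for i
    proof (cases "i = j")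
      case False
      have "\<exists>u. v i = padic_p ^ k * u" using dvd[OF v that] by (simp add: dvd_def)
      from someI_ex[OF this] show ?thesis using False by (simp add: w_def)
    qed (simp add: w_def vj)
    have wj: "w j = 1" by (simp add: w_def)
    have agree: "\<psi> a = \<psi> b" if "\<forall>i\<in>I. a i = b i" for a b
    proof -
      have "\<psi> b \<oplus>\<^bsub>M\<^esub> \<psi> (\<lambda>i. a i - b i) = \<psi> a" by (simp add: D(3))
      then show ?thesis using depends[of "\<lambda>i. a i - b i"] that by (simp add: D(1))
    qed
    have kill: "padic_p ^ k \<odot>\<^bsub>M\<^esub> \<psi> w = \<zero>\<^bsub>M\<^esub>"
      using agree[of v "\<lambda>i. padic_p ^ k * w i"] vw v by (simp add: D(4))
    define \<psi>1 where "\<psi>1 a = \<psi> (\<lambda>i. if i = j then 0 else a i)" for a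
    have \<psi>1: "coordinate_map M \<psi>1"
      unfolding coordinate_map_def \<psi>1_def D(2)[symmetric]
      by (auto simp: D(1,3,4) intro!: arg_cong[of _ _ \<psi>])
    have "card (I - {j}) < card I"
      using j less.prems(1) by (intro psubset_card_mono) auto
    moreover have "\<psi>1 a = \<zero>\<^bsub>M\<^esub>" if "\<forall>i\<in>I - {j}. a i = 0" for a
      unfolding \<psi>1_def using that by (intro depends) auto
    moreover have "finite (I - {j})" using less.prems(1) by simp
    ultimately obtain e \<psi>' where \<psi>': "coordinate_map M \<psi>'" "range \<psi>' = range \<psi>1"
      and e: "\<And>a. \<psi>' a = \<zero>\<^bsub>M\<^esub> \<longleftrightarrow> (\<forall>i\<in>I - {j}. padic_ppow (e i) dvd a i)"
      using less.hyps[of "I - {j}" \<psi>1] \<psi>1 by blast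
    note D' = coordinate_mapD[OF \<psi>'(1)]
    \<comment> \<open>Generator \<open>j\<close> is replaced by the image of \<open>w\<close>; the
      other generators are those produced by induction on \<open>I - {j}\<close>.\<close>
    define \<chi> where "\<chi> a = a j \<odot>\<^bsub>M\<^esub> \<psi> w \<oplus>\<^bsub>M\<^esub> \<psi>' a" for a
    have "coordinate_map M \<chi>"
      unfolding coordinate_map_def
    proof (intro conjI allI)
      fix a b :: "'i \<Rightarrow> 'p padic_int" and c :: "'p padic_int"
      show "\<chi> a \<in> carrier M" by (simp add: \<chi>_def D(1) D'(1))
      show "\<chi> (\<lambda>_. 0) = \<zero>\<^bsub>M\<^esub>"
        using lmult_0[OF D(1), of w] by (simp add: \<chi>_def D'(2))
      show "\<chi> (\<lambda>i. a i + b i) = \<chi> a \<oplus>\<^bsub>M\<^esub> \<chi> b"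
        using smult_l_distr[of "a j" "b j" "\<psi> w"] D(1) D'(1)
        by (simp add: \<chi>_def D'(3)[symmetric] M.a_ac)
      show "\<chi> (\<lambda>i. c * a i) = c \<odot>\<^bsub>M\<^esub> \<chi> a"
        using smult_r_distr[of c "a j \<odot>\<^bsub>M\<^esub> \<psi> w" "\<psi>' a"] smult_assoc1[of c "a j" "\<psi> w"] D(1) D'(1)
        by (simp add: \<chi>_def D'(4)[symmetric])
    qed
    moreover have "range \<chi> = range \<psi>"
    proof (intro equalityI subsetI)
      fix x assume "x \<in> range \<chi>"
      then obtain a where x: "x = \<chi> a" by blast
      obtain b where "\<psi>' a = \<psi>1 b" using \<psi>'(2) by blast
      then show "x \<in> range \<psi>" by (simp add: x \<chi>_def \<psi>1_def D)
    next
      fix x assume "x \<in> range \<psi>"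
      then obtain a where x: "x = \<psi> a" by blast
      define b where "b i = a i - a j * w i" for i
      obtain d where d: "\<psi>' d = \<psi>1 b" using \<psi>'(2) by (metis rangeE rangeI)
      have "\<psi> a = \<psi> (\<lambda>i. a j * w i + (if i = j then 0 else b i))"
        by (rule agree) (simp add: b_def wj)
      also have "\<dots> = a j \<odot>\<^bsub>M\<^esub> \<psi> w \<oplus>\<^bsub>M\<^esub> \<psi>' d"
        by (simp add: d \<psi>1_def D)
      \<comment> \<open>The kernel of \<psi>' imposes nothing on coordinate \<open>j\<close>, so
        that coordinate of \<open>d\<close> can be set to \<open>a j\<close>, as \<chi>
        demands.\<close>
      also have "\<psi>' d = \<psi>' (\<lambda>i. d i + (if i = j then a j - d j else 0))"
      proof -
        have "\<psi>' (\<lambda>i. if i = j then a j - d j else 0) = \<zero>\<^bsub>M\<^esub>" by (simp add: e)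
        then show ?thesis by (simp add: D'(3)[symmetric] D'(1))
      qed
      also have "a j \<odot>\<^bsub>M\<^esub> \<psi> w \<oplus>\<^bsub>M\<^esub> \<dots> = \<chi> (\<lambda>i. d i + (if i = j then a j - d j else 0))"
        by (simp add: \<chi>_def)
      finally show "x \<in> range \<chi>" unfolding x by blast
    qed
    moreover have "\<chi> a = \<zero>\<^bsub>M\<^esub> \<longleftrightarrow> (\<forall>i\<in>I. padic_ppow ((e(j := enat k)) i) dvd a i)" for a
    proof -
      have *: "a j \<odot>\<^bsub>M\<^esub> \<psi> w = \<zero>\<^bsub>M\<^esub>" if dvd_j: "padic_p ^ k dvd a j"
      proof -
        obtain q where "a j = q * padic_p ^ k" using dvd_j by (auto simp: dvd_def mult.commute)
        then show ?thesis
          using smult_assoc1[of q "padic_p ^ k" "\<psi> w"] D(1) by (simp add: kill)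
      qed
      \<comment> \<open>Here minimality makes the summand split off: rewritten as a relation for
        \<psi>, the relation has \<open>j\<close>-th coordinate exactly \<open>a j\<close>.\<close>
      have **: "padic_p ^ k dvd a j" if "\<chi> a = \<zero>\<^bsub>M\<^esub>"
      proof -
        obtain b where "\<psi>' a = \<psi>1 b" using \<psi>'(2) by blast
        then have "\<psi> (\<lambda>i. a j * w i + (if i = j then 0 else b i)) = \<zero>\<^bsub>M\<^esub>"
          using that by (simp add: \<chi>_def \<psi>1_def D)
        from dvd[OF this j] show ?thesis by (simp add: wj)
      qed
      have "\<chi> a = \<zero>\<^bsub>M\<^esub> \<longleftrightarrow> padic_p ^ k dvd a j \<and> \<psi>' a = \<zero>\<^bsub>M\<^esub>"
        using * ** D'(1) by (auto simp: \<chi>_def)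
      also have "\<dots> \<longleftrightarrow> (\<forall>i\<in>I. padic_ppow ((e(j := enat k)) i) dvd a i)"
        using j by (auto simp: e padic_ppow_def)
      finally show ?thesis .
    qed
    ultimately show ?thesis by blast
  qed
qed

text \<open>A finite generating set serves as its own index set, with the coefficients of linear
  combinations as coordinates; diagonalization is followed by renumbering.\<close>

lemma finitely_generated_imp_diagonal:
  fixes M :: "('p::prime_card padic_int, 'b) module"
  assumes "finitely_generated_module class_ring M"
  obtains k e where "diagonal_module M {..<k::nat} (\<lambda>i. padic_ppow (e i))"
proof -
  obtain S where S: "finite S" "S \<subseteq> carrier M" "LinearCombinations.module.span class_ring M S = carrier M"
    and M: "Module.module class_ring M"
    using assms by (auto simp: finitely_generated_module_def)
  interpret Module.module class_ring M by (rule M)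
  have hom: "coordinate_map M (\<lambda>a. lincomb a S)"
    unfolding coordinate_map_def
  proof (intro conjI allI)
    fix a b :: "'b \<Rightarrow> 'p padic_int" and c
    show "lincomb a S \<in> carrier M" by (rule lincomb_closed[OF S(2)]) simp
    show "lincomb (\<lambda>_. 0) S = \<zero>\<^bsub>M\<^esub>"
      unfolding lincomb_def by (rule M.finsum_all0) (use S(2) lmult_0 in auto)
    show "lincomb (\<lambda>i. a i + b i) S = lincomb a S \<oplus>\<^bsub>M\<^esub> lincomb b S"
      using lincomb_sum[OF S(1,2), of a b] by simp
    show "lincomb (\<lambda>i. c * a i) S = c \<odot>\<^bsub>M\<^esub> lincomb a S"
      using lincomb_smult[OF S(2), of a c] by simp
  qed
  have range: "range (\<lambda>a. lincomb a S) = carrier M"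
    using S(3) finite_span[OF S(1,2)] by (simp add: full_SetCompr_eq)
  have "lincomb a S = \<zero>\<^bsub>M\<^esub>" if "\<forall>i\<in>S. a i = 0" for a
    unfolding lincomb_def by (rule M.finsum_all0) (use S(2) lmult_0 that in auto)
  from padic_diagonalization[OF M S(1) hom this] range obtain e \<psi> where
    \<psi>: "coordinate_map M \<psi>" "range \<psi> = carrier M"
    and e: "\<And>a. \<psi> a = \<zero>\<^bsub>M\<^esub> \<longleftrightarrow> (\<forall>i\<in>S. padic_ppow (e i) dvd a i)" by auto
  note D = coordinate_mapD[OF \<psi>(1)]
  have "\<psi> a = \<psi> b \<longleftrightarrow> \<psi> (\<lambda>i. a i - b i) = \<zero>\<^bsub>M\<^esub>" for a b
  proof -
    have "\<psi> a = \<psi> (\<lambda>i. a i - b i) \<oplus>\<^bsub>M\<^esub> \<psi> b" by (simp add: D(3))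
    then show ?thesis
      using D(1) M.add.r_cancel_one by metis
  qed
  then have "diagonal_module M S (\<lambda>i. padic_ppow (e i))"
    using \<psi> e by (intro diagonal_moduleI[of _ _ _ \<psi>]) (simp add: presentation_def)
  moreover obtain f where "bij_betw f {..<card S} S"
    using ex_bij_betw_nat_finite[OF S(1)] by (auto simp: atLeast0LessThan)
  ultimately show ?thesis
    using that[OF diagonal_module_reindex[of M S _ f]] by blast
qed

lemma coordinate_map_finite_support:
  assumes \<phi>: "coordinate_map M \<phi>" and V: "submodule class_ring V M" and "finite I"
    and gen: "\<And>i. i \<in> I \<Longrightarrow> \<phi> (\<lambda>j. if j = i then 1 else 0) \<in> V"
  shows "\<phi> (\<lambda>j. if j \<in> I then a j else 0) \<in> V"
  using \<open>finite I\<close> gen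
proof (induction I rule: finite_induct)
  case empty
  then show ?case using submodule.zero_closed[OF V] coordinate_mapD(2)[OF \<phi>] by simp
next
  case (insert i I)
  note D = coordinate_mapD[OF \<phi>]
  have "\<phi> (\<lambda>j. if j \<in> insert i I then a j else 0)
      = \<phi> (\<lambda>j. (a i * (if j = i then 1 else 0)) + (if j \<in> I then a j else 0))"
    using insert.hyps by (intro arg_cong[of _ _ \<phi>]) auto
  also have "\<dots> = a i \<odot>\<^bsub>M\<^esub> \<phi> (\<lambda>j. if j = i then 1 else 0) \<oplus>\<^bsub>M\<^esub> \<phi> (\<lambda>j. if j \<in> I then a j else 0)"
    by (simp only: D)
  also have "\<dots> \<in> V"
    using insert V by (simp add: submodule.m_closed submodule.smult_closed)
  finally show ?case .
qed

lemma diagonal_imp_finitely_generated: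
  fixes M :: "('a::comm_ring_1, 'b) module"
  assumes "diagonal_module M I c" "finite I"
  shows "finitely_generated_module class_ring M"
proof -
  obtain \<phi> where \<phi>: "presentation M I c \<phi>"
    using assms by (auto simp: diagonal_module_def)
  then have hom: "coordinate_map M \<phi>" by (simp add: presentation_def)
  interpret Module.module class_ring M by (rule diagonal_module_is_module[OF assms(1)])
  define S where "S = (\<lambda>i. \<phi> (\<lambda>j. if j = i then 1 else 0)) ` I"
  have S: "finite S" "S \<subseteq> carrier M"
    using assms(2) coordinate_mapD(1)[OF hom] by (auto simp: S_def)
  have "carrier M \<subseteq> span S"
  proof
    fix x assume "x \<in> carrier M"
    then obtain a where x: "x = \<phi> a" using \<phi> by (auto simp: presentation_def)
    \<comment> \<open>Coordinates outside \<open>I\<close> do not affect \<phi>, so finitely many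
      images of unit vectors suffice to generate.\<close>
    have "\<phi> a = \<phi> (\<lambda>j. if j \<in> I then a j else 0)"
      using \<phi> by (simp add: presentation_def)
    also have "\<dots> \<in> span S"
      using in_own_span[OF S(2)]
      by (intro coordinate_map_finite_support[OF hom span_is_submodule[OF S(2)] assms(2)]) 
        (auto simp: S_def)
    finally show "x \<in> span S" by (simp add: x)
  qed
  then have "span S = carrier M"
    using span_is_submodule[OF S(2)] by (auto simp: submodule_def)
  with S diagonal_module_is_module[OF assms(1)] show ?thesis
    unfolding finitely_generated_module_def by blast
qed

section \<open>Standard constructions and reduction modulo p\<close>

lemma diagonal_direct_sum:
  fixes M :: "('a::comm_ring_1, 'b) module" and N :: "('a, 'c) module"
  assumes "diagonal_module M {..<k} c" "diagonal_module N {..<k'} c'"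
  shows "diagonal_module (direct_sum M N) {..<k + k'} (\<lambda>i::nat. if i < k then c i else c' (i - k))"
proof -
  obtain \<phi> \<psi> where \<phi>: "presentation M {..<k} c \<phi>" and \<psi>: "presentation N {..<k'} c' \<psi>"
    using assms by (auto simp: diagonal_module_def)
  let ?\<chi> = "\<lambda>a. (\<phi> a, \<psi> (\<lambda>i. a (k + i)))"
  have split: "(\<forall>i<k + k'. P i) \<longleftrightarrow> (\<forall>i<k. P i) \<and> (\<forall>i<k'. P (k + i))" for P
  proof (intro iffI conjI allI impI)
    fix i assume *: "(\<forall>i<k. P i) \<and> (\<forall>i<k'. P (k + i))" and "i < k + k'"
    then show "P i" by (cases "i < k") (auto dest: spec[of _ "i - k"])
  qed auto
  have "presentation (direct_sum M N) {..<k + k'} (\<lambda>i. if i < k then c i else c' (i - k)) ?\<chi>"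
    unfolding presentation_def
  proof (intro conjI allI subsetI)
    show "coordinate_map (direct_sum M N) ?\<chi>"
      using \<phi> \<psi> by (auto simp: presentation_def coordinate_map_def direct_sum_def)
    fix x assume "x \<in> carrier (direct_sum M N)"
    then have "fst x \<in> range \<phi>" "snd x \<in> range \<psi>"
      using \<phi> \<psi> by (auto simp: presentation_def direct_sum_def)
    then obtain a b where x: "fst x = \<phi> a" "snd x = \<psi> b" by blast
    let ?d = "\<lambda>i. if i < k then a i else b (i - k)"
    have "\<phi> a = \<phi> ?d" using \<phi> by (simp add: presentation_def)
    then have "x = ?\<chi> ?d" using x by (intro prod_eqI) simp_all
    then show "x \<in> range ?\<chi>" by blast
  next
    fix a b
    show "?\<chi> a = ?\<chi> b \<longleftrightarrow>
      (\<forall>i\<in>{..<k + k'}. (if i < k then c i else c' (i - k)) dvd a i - b i)"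
      using \<phi> \<psi> by (simp add: presentation_def Ball_def split)
  qed
  then show ?thesis by (rule diagonal_moduleI)
qed

lemma diagonal_product:
  fixes F :: "'i \<Rightarrow> ('a::comm_ring_1, 'b) module"
  assumes "\<And>i. i \<in> I \<Longrightarrow> diagonal_module (F i) {()} (\<lambda>_. c i)"
  shows "diagonal_module (product_module I F) I c"
proof -
  have "\<exists>\<phi>. \<forall>i\<in>I. presentation (F i) {()} (\<lambda>_. c i) (\<phi> i)"
    using assms by (intro bchoice) (simp add: diagonal_module_def)
  then obtain \<phi> where \<phi>: "\<And>i. i \<in> I \<Longrightarrow> presentation (F i) {()} (\<lambda>_. c i) (\<phi> i)" by blast
  let ?\<psi> = "\<lambda>a. \<lambda>i\<in>I. \<phi> i (\<lambda>_. a i)"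
  have "presentation (product_module I F) I c ?\<psi>"
    unfolding presentation_def
  proof (intro conjI allI subsetI)
    have hom: "coordinate_map (F i) (\<phi> i)" if "i \<in> I" for i
      using \<phi>[OF that] by (simp add: presentation_def)
    show "coordinate_map (product_module I F) ?\<psi>"
      unfolding coordinate_map_def product_module_def
      by (auto simp: coordinate_mapD[OF hom] intro!: restrict_ext)
    fix x assume x: "x \<in> carrier (product_module I F)"
    have "\<forall>i\<in>I. \<exists>a. x i = \<phi> i (\<lambda>_. a)"
    proof
      fix i assume i: "i \<in> I"
      have "x i \<in> range (\<phi> i)"
        using x \<phi>[OF i] i by (auto simp: product_module_def presentation_def)
      then obtain b where b: "x i = \<phi> i b" by blast
      have "(\<lambda>_. b ()) = b" by (rule ext) simp
      with b show "\<exists>a. x i = \<phi> i (\<lambda>_. a)" by (intro exI[of _ "b ()"]) simp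
    qed
    from bchoice[OF this] obtain a where a: "\<forall>i\<in>I. x i = \<phi> i (\<lambda>_. a i)" by (rule exE)
    have "x = ?\<psi> a"
    proof (rule extensionalityI[of _ I])
      show "x \<in> extensional I" using x by (simp add: product_module_def PiE_def)
    qed (use a in auto)
    then show "x \<in> range ?\<psi>" by blast
  next
    fix a b
    have "?\<psi> a = ?\<psi> b \<longleftrightarrow> (\<forall>i\<in>I. \<phi> i (\<lambda>_. a i) = \<phi> i (\<lambda>_. b i))"
      by (auto simp: fun_eq_iff restrict_def)
    also have "\<dots> \<longleftrightarrow> (\<forall>i\<in>I. c i dvd a i - b i)"
      using \<phi> by (simp add: presentation_def)
    finally show "?\<psi> a = ?\<psi> b \<longleftrightarrow> (\<forall>i\<in>I. c i dvd a i - b i)" .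
  qed
  then show ?thesis by (rule diagonal_moduleI)
qed

lemma diagonal_cyclic: "diagonal_module (cyclic_module r) {()} (\<lambda>_. padic_ppow r)"
  unfolding cyclic_module_def
proof (rule diagonal_moduleI, rule quotient_presentation)
  show "coordinate_map regular_module (\<lambda>a. a () :: 'a padic_int)"
    by (auto simp: coordinate_map_def regular_module_def)
  show "carrier (regular_module :: ('a padic_int, 'a padic_int) module) \<subseteq> range (\<lambda>a. a ())"
    by (auto intro: image_eqI[of _ _ "\<lambda>_. _"])
qed (auto simp: regular_module_def dvd_def)

text \<open>\<open>U\<close> carries the image of \<open>B\<close> onto the image of the diagonal
  matrix, so the presentation sends a coordinate vector to the class of its image under the inverse
  \<open>U'\<close>.\<close>

lemma diagonal_cokernel:
  fixes B :: "'a::comm_ring_1 mat"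
  assumes B: "B \<in> carrier_mat n n"
    and U: "U \<in> carrier_mat n n" "U' \<in> carrier_mat n n" "U * U' = 1\<^sub>m n" "U' * U = 1\<^sub>m n"
    and V: "V \<in> carrier_mat n n" "V' \<in> carrier_mat n n" "V * V' = 1\<^sub>m n"
    and D: "U * B * V = mat n n (\<lambda>(i, j). if i = j then c i else 0)"
  shows "diagonal_module (cokernel B) {..<n} c"
proof -
  let ?D = "mat n n (\<lambda>(i, j). if i = j then c i else 0)"
  let ?\<phi> = "\<lambda>a. U' *\<^sub>v vec n a"
  have Dv: "?D *\<^sub>v v = vec n (\<lambda>i. c i * v $ i)" if "v \<in> carrier_vec n" for v
  proof -
    have "(if i = j then c i else 0) * v $ j = (if i = j then c i * v $ j else 0)" for i j
      by simp
    then show ?thesis using that by (intro eq_vecI) (auto simp: scalar_prod_def)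
  qed
  have ker: "?\<phi> a \<in> (\<lambda>v. B *\<^sub>v v) ` carrier_vec n \<longleftrightarrow> (\<forall>i\<in>{..<n}. c i dvd a i)" for a
  proof
    assume "?\<phi> a \<in> (\<lambda>v. B *\<^sub>v v) ` carrier_vec n"
    then obtain v where v: "v \<in> carrier_vec n" "U' *\<^sub>v vec n a = B *\<^sub>v v" by blast
    have "vec n a = (U * U') *\<^sub>v vec n a" using U(3) by simp
    also have "\<dots> = U *\<^sub>v (U' *\<^sub>v vec n a)" using U(1,2) by (intro assoc_mult_mat_vec) auto
    also have "\<dots> = U *\<^sub>v (B *\<^sub>v v)" by (simp only: v(2))
    also have "v = V *\<^sub>v (V' *\<^sub>v v)"
      using assoc_mult_mat_vec[OF V(1,2) v(1)] V(3) v(1) by simp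
    also have "U *\<^sub>v (B *\<^sub>v (V *\<^sub>v (V' *\<^sub>v v))) = (U * B * V) *\<^sub>v (V' *\<^sub>v v)"
      using U(1) V B v by (simp add: assoc_mult_mat_vec[of _ n n _ n])
    also have "\<dots> = vec n (\<lambda>i. c i * (V' *\<^sub>v v) $ i)"
      unfolding D using V v by (intro Dv) simp
    finally have "\<forall>i<n. vec n a $ i = c i * (V' *\<^sub>v v) $ i" by simp
    then show "\<forall>i\<in>{..<n}. c i dvd a i" by simp
  next
    assume "\<forall>i\<in>{..<n}. c i dvd a i"
    then have "\<forall>i\<in>{..<n}. \<exists>q. a i = c i * q" by (simp add: dvd_def)
    from bchoice[OF this] obtain q where q: "\<forall>i\<in>{..<n}. a i = c i * q i" by (rule exE)
    have "vec n a = ?D *\<^sub>v vec n q" using q by (subst Dv) auto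
    then have "?\<phi> a = U' *\<^sub>v ((U * B * V) *\<^sub>v vec n q)" by (simp add: D)
    also have "\<dots> = U' *\<^sub>v (U *\<^sub>v (B *\<^sub>v (V *\<^sub>v vec n q)))"
      using U(1) V B by (simp add: assoc_mult_mat_vec[of _ n n _ n])
    also have "\<dots> = B *\<^sub>v (V *\<^sub>v vec n q)"
      using assoc_mult_mat_vec[OF U(2,1), of "B *\<^sub>v (V *\<^sub>v vec n q)"] U(4) V B by simp
    finally show "?\<phi> a \<in> (\<lambda>v. B *\<^sub>v v) ` carrier_vec n" using V by auto
  qed
  have "presentation (quotient_module (module_vec TYPE('a) n) ((\<lambda>v. B *\<^sub>v v) ` carrier_vec n)) {..<n} c
    (\<lambda>a. (\<lambda>v. B *\<^sub>v v) ` carrier_vec n +>\<^bsub>module_vec TYPE('a) n\<^esub> ?\<phi> a)"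
  proof (rule quotient_presentation)
    have "?\<phi> (\<lambda>i. a i + b i) = ?\<phi> a + ?\<phi> b" for a b
    proof -
      have "vec n (\<lambda>i. a i + b i) = vec n a + vec n b" by auto
      then show ?thesis using U(2) by (simp add: mult_add_distrib_mat_vec)
    qed
    moreover have "?\<phi> (\<lambda>i. r * a i) = r \<cdot>\<^sub>v ?\<phi> a" for r a
    proof -
      have "vec n (\<lambda>i. r * a i) = r \<cdot>\<^sub>v vec n a" by auto
      then show ?thesis
        using U(2) by (intro eq_vecI) (auto simp: scalar_prod_def sum_distrib_left ac_simps)
    qed
    moreover have "?\<phi> (\<lambda>_. 0) = 0\<^sub>v n"
      using U(2) by (intro eq_vecI) (auto simp: scalar_prod_def)
    ultimately show "coordinate_map (module_vec TYPE('a) n) ?\<phi>"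
      using U(2) by (auto simp: coordinate_map_def module_vec_simps)
    have "v \<in> range ?\<phi>" if v: "v \<in> carrier_vec n" for v
    proof
      have "vec n (\<lambda>i. (U *\<^sub>v v) $ i) = U *\<^sub>v v" using U(1) by auto
      then show "v = ?\<phi> (\<lambda>i. (U *\<^sub>v v) $ i)"
        using assoc_mult_mat_vec[OF U(2,1) v] U(4) v by simp
    qed simp
    then show "carrier (module_vec TYPE('a) n) \<subseteq> range ?\<phi>" by (auto simp: module_vec_simps)
    show "(\<lambda>v. B *\<^sub>v v) ` carrier_vec n \<subseteq> carrier (module_vec TYPE('a) n)"
      using B by (auto simp: module_vec_simps)
  qed (rule ker)
  then show ?thesis
    using B unfolding cokernel_def by (intro diagonal_moduleI) auto
qed

lemma diagonal_cokernel_diag: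
  "diagonal_module (cokernel (mat n n (\<lambda>(i, j). if i = j then c i else 0))) {..<n} c"
  by (rule diagonal_cokernel[of _ _ "1\<^sub>m n" "1\<^sub>m n" "1\<^sub>m n" "1\<^sub>m n"]) auto

lemma diagonal_zero_module: "diagonal_module (module_vec TYPE('a::comm_ring_1) 0) {} c"
proof (rule diagonal_moduleI)
  show "presentation (module_vec TYPE('a) 0) {} c (\<lambda>_. 0\<^sub>v 0)"
    by (auto simp: presentation_def coordinate_map_def module_vec_simps)
qed

lemma bex_choice_iff: "(\<exists>f. \<forall>i\<in>I. P i (f i)) \<longleftrightarrow> (\<forall>i\<in>I. \<exists>x. P i x)"
  by (auto intro!: bchoice)

text \<open>M / pM is first presented over the p-adic integers, by adding p to every relation, and
  then over the residue field, by lifting coordinates.\<close>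

lemma diagonal_mod_p:
  fixes M :: "('p::prime_card padic_int, 'b) module" and c :: "'i \<Rightarrow> 'p padic_int"
  assumes "diagonal_module M I c"
  shows "diagonal_module (mod_p M) I (\<lambda>i. padic_red (c i))"
proof -
  obtain \<phi> where \<phi>: "presentation M I c \<phi>"
    using assms by (auto simp: diagonal_module_def)
  then have hom: "coordinate_map M \<phi>" and surj: "carrier M \<subseteq> range \<phi>"
    and eq: "\<And>a b. \<phi> a = \<phi> b \<longleftrightarrow> (\<forall>i\<in>I. c i dvd a i - b i)"
    by (auto simp: presentation_def)
  note D = coordinate_mapD[OF hom]
  define N where "N = (\<lambda>h. padic_p \<odot>\<^bsub>M\<^esub> h) ` carrier M"
  \<comment> \<open>\<open>d i\<close> generates the ideal spanned by \<open>c i\<close> and p,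
    which is the whole ring when \<open>c i\<close> is a unit.\<close>
  define d :: "'i \<Rightarrow> 'p padic_int" where "d i = (if padic_red (c i) = 0 then padic_p else 1)" for i
  have ker: "\<phi> a \<in> N \<longleftrightarrow> (\<forall>i\<in>I. d i dvd a i)" for a
  proof -
    have "carrier M = range \<phi>" using surj D(1) by blast
    then have "\<phi> a \<in> N \<longleftrightarrow> (\<exists>b. \<phi> a = \<phi> (\<lambda>i. padic_p * b i))"
      by (auto simp: N_def D image_iff)
    also have "\<dots> \<longleftrightarrow> (\<forall>i\<in>I. \<exists>b. c i dvd a i - padic_p * b)"
      unfolding eq by (rule bex_choice_iff)
    also have "\<dots> \<longleftrightarrow> (\<forall>i\<in>I. d i dvd a i)"
    proof (rule ball_cong[OF refl])
      fix i
      show "(\<exists>b. c i dvd a i - padic_p * b) \<longleftrightarrow> d i dvd a i"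
      proof (cases "padic_red (c i) = 0")
        case True
        then have "padic_p dvd c i" by (simp add: padic_red_eq_0_iff)
        then have "padic_p dvd a i" if "c i dvd a i - padic_p * b" for b
          using dvd_add[OF dvd_trans[OF _ that, of padic_p], of "padic_p * b"] by simp
        moreover have "\<exists>b. c i dvd a i - padic_p * b" if "padic_p dvd a i"
          using that by (auto simp: dvd_def) (metis diff_self mult_zero_right)
        ultimately show ?thesis using True by (auto simp: d_def)
      next
        case False
        then obtain b where "c i * b = 1" by (rule padic_unit)
        then have "c i dvd x" for x by (metis dvd_triv_left dvd_trans one_dvd)
        then show ?thesis using False by (simp add: d_def)
      qed
    qed
    finally show ?thesis .
  qed
  define Q where "Q = quotient_module M N"
  define \<psi> where "\<psi> a = N +>\<^bsub>M\<^esub> \<phi> a" for a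
  have "presentation Q I d \<psi>"
    unfolding Q_def \<psi>_def
    by (rule quotient_presentation[OF hom surj _ ker])
      (use D surj in \<open>auto simp: N_def\<close>)
  then have homQ: "coordinate_map Q \<psi>" and surjQ: "carrier Q \<subseteq> range \<psi>"
    and eqQ: "\<And>a b. \<psi> a = \<psi> b \<longleftrightarrow> (\<forall>i\<in>I. d i dvd a i - b i)"
    by (auto simp: presentation_def)
  note DQ = coordinate_mapD[OF homQ]
  have P: "mod_p M = \<lparr>carrier = carrier Q, mult = undefined, one = undefined, zero = \<zero>\<^bsub>Q\<^esub>, add = add Q,
     smult = (\<lambda>c X. of_int (to_int_mod_ring c) \<odot>\<^bsub>Q\<^esub> X)\<rparr>"
    by (simp add: mod_p_def Let_def Q_def N_def)
  define lift :: "'p mod_ring \<Rightarrow> 'p padic_int" where "lift c = of_int (to_int_mod_ring c)" for c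
  have red_lift: "padic_red (lift c) = c" for c by (simp add: lift_def padic_red_lift)
  \<comment> \<open>\<open>lift\<close> is not additive. Linearity of \<open>?\<chi>\<close> holds
    because \<psi> sees only the reductions of its coordinates.\<close>
  have eqR: "\<psi> a = \<psi> b" if "\<And>i. i \<in> I \<Longrightarrow> padic_red (a i) = padic_red (b i)" for a b
    using that by (auto simp: eqQ d_def padic_red_eq_0_iff[symmetric] padic_red_minus)
  let ?\<chi> = "\<lambda>a. \<psi> (\<lambda>i. lift (a i))"
  have "presentation (mod_p M) I (\<lambda>i. padic_red (c i)) ?\<chi>"
    unfolding presentation_def
  proof (intro conjI allI)
    have "?\<chi> (\<lambda>_. 0) = \<zero>\<^bsub>Q\<^esub>"
      unfolding DQ(2)[symmetric] by (rule eqR) (simp add: red_lift padic_red_0)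
    moreover have "?\<chi> (\<lambda>i. a i + b i) = ?\<chi> a \<oplus>\<^bsub>Q\<^esub> ?\<chi> b" for a b
      unfolding DQ(3) by (rule eqR) (simp add: red_lift padic_red_add)
    moreover have "?\<chi> (\<lambda>i. r * a i) = lift r \<odot>\<^bsub>Q\<^esub> ?\<chi> a" for r a
      unfolding DQ(4) by (rule eqR) (simp add: red_lift padic_red_mult)
    ultimately show "coordinate_map (mod_p M) ?\<chi>"
      unfolding coordinate_map_def P using DQ(1) by (simp add: lift_def)
    show "carrier (mod_p M) \<subseteq> range ?\<chi>"
    proof
      fix x assume "x \<in> carrier (mod_p M)"
      then obtain a where x: "x = \<psi> a" using surjQ by (auto simp: P)
      have "\<psi> a = ?\<chi> (\<lambda>i. padic_red (a i))" by (rule eqR) (simp add: red_lift)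
      then show "x \<in> range ?\<chi>" by (simp add: x)
    qed
    fix a b
    have "d i dvd lift (a i) - lift (b i) \<longleftrightarrow> padic_red (c i) dvd a i - b i" for i
    proof (cases "padic_red (c i) = 0")
      case True
      then show ?thesis
        by (simp add: d_def padic_red_eq_0_iff[symmetric] padic_red_minus red_lift)
    qed (simp add: d_def dvd_field_iff)
    then show "?\<chi> a = ?\<chi> b \<longleftrightarrow> (\<forall>i\<in>I. padic_red (c i) dvd a i - b i)"
      by (simp add: eqQ)
  qed
  then show ?thesis by (rule diagonal_moduleI)
qed

text \<open>Over a field a nonzero relation kills its coordinate and a zero relation leaves it free,
  so the space is isomorphic to the vectors of length \<open>k\<close>.\<close>

lemma diagonal_vectorspace_dim:
  fixes V :: "('a::field, 'b) module"
  assumes "diagonal_module V I c" "finite I"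
  shows "vectorspace.dim class_ring V = card {i\<in>I. c i = 0}"
proof -
  define k where "k = card {i\<in>I. c i = 0}"
  have "diagonal_module V {i\<in>I. c i = 0} (\<lambda>_. 0)"
    by (rule diagonal_module_cong[OF assms(1)]) (auto simp: dvd_field_iff)
  moreover obtain f where "bij_betw f {..<k} {i\<in>I. c i = 0}"
    using ex_bij_betw_nat_finite[of "{i\<in>I. c i = 0}"] assms(2)
    by (auto simp: k_def atLeast0LessThan)
  ultimately have V: "diagonal_module V {..<k} (\<lambda>_. 0)"
    using diagonal_module_reindex by fastforce
  then obtain \<phi> where \<phi>: "presentation V {..<k} (\<lambda>_. 0) \<phi>" by (auto simp: diagonal_module_def)
  then have hom: "coordinate_map V \<phi>" by (simp add: presentation_def)
  note D = coordinate_mapD[OF hom]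
  let ?f = "\<lambda>v. \<phi> (\<lambda>i. if i < k then v $ i else 0)"
  have agree: "\<phi> a = \<phi> b" if "\<And>i. i < k \<Longrightarrow> a i = b i" for a b
    using that \<phi> by (auto simp: presentation_def)
  interpret VS: vectorspace class_ring V
    by (intro vectorspace.intro diagonal_module_is_module[OF V] class_field)
  interpret W: vec_space "TYPE('a)" k .
  have lin: "linear_map class_ring (module_vec TYPE('a) k) V ?f"
  proof (intro linear_map.intro mod_hom.intro mod_hom_axioms.intro)
    show "?f \<in> module_hom class_ring (module_vec TYPE('a) k) V"
      unfolding module_hom_def
      by (auto simp: module_vec_simps D intro!: agree)
  qed (unfold_locales)
  interpret linear_map class_ring "module_vec TYPE('a) k" V ?f by (rule lin)
  have "W.dim = VS.dim"
  proof (rule dim_eq)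
    show "W.fin_dim" by (rule W.fin_dim)
    show "inj_on ?f (carrier (module_vec TYPE('a) k))"
      using \<phi> by (intro inj_onI) (auto simp: presentation_def module_vec_simps)
    show "?f ` carrier (module_vec TYPE('a) k) = carrier V"
    proof (intro equalityI subsetI)
      fix x assume "x \<in> carrier V"
      then obtain a where "x = \<phi> a" using \<phi> by (auto simp: presentation_def)
      also have "\<dots> = ?f (vec k a)" by (rule agree) simp
      finally show "x \<in> ?f ` carrier (module_vec TYPE('a) k)" by (auto simp: module_vec_simps)
    qed (auto simp: D(1))
  qed
  then show ?thesis using W.dim_is_n by (simp add: k_def)
qed

section \<open>Isomorphism classes given by exponents\<close>

lemma diagonal_isomorphic_field_iff:
  fixes V :: "('a::field, 'b) module" and W :: "('a, 'c) module"
  assumes V: "diagonal_module V I c" "finite I" and W: "diagonal_module W J d" "finite J"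
  shows "module_isomorphic class_ring V W \<longleftrightarrow> card {i\<in>I. c i = 0} = card {j\<in>J. d j = 0}"
proof
  assume "module_isomorphic class_ring V W"
  then have "diagonal_module W I c"
    by (rule diagonal_module_transfer[OF V(1) _ diagonal_module_is_module[OF W(1)]])
  then show "card {i\<in>I. c i = 0} = card {j\<in>J. d j = 0}"
    using diagonal_vectorspace_dim[OF _ V(2)] diagonal_vectorspace_dim[OF W] by metis
next
  assume "card {i\<in>I. c i = 0} = card {j\<in>J. d j = 0}"
  then obtain f where f: "bij_betw f {i\<in>I. c i = 0} {j\<in>J. d j = 0}"
    using finite_same_card_bij[of "{i\<in>I. c i = 0}" "{j\<in>J. d j = 0}"] V(2) W(2) by auto
  have V': "diagonal_module V {i\<in>I. c i = 0} (\<lambda>_. 0)"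
    by (rule diagonal_module_cong[OF V(1)]) (auto simp: dvd_field_iff)
  have W': "diagonal_module W {j\<in>J. d j = 0} (\<lambda>_. 0)"
    by (rule diagonal_module_cong[OF W(1)]) (auto simp: dvd_field_iff)
  show "module_isomorphic class_ring V W"
    by (rule diagonal_module_isomorphic[OF V' diagonal_module_reindex[OF W' f]])
qed

text \<open>The class of the product of the Z_p / p^(e k) for k < n. Exponent 0 is allowed and
  contributes nothing; padding to the common length \<open>n\<close> of a tuple turns d_{0,i} into a
  number of zeros.\<close>

definition exponent_class :: "nat \<Rightarrow> (nat \<Rightarrow> enat) \<Rightarrow> 'p::prime_card padic_module set" where
  "exponent_class n e =
    {N. finitely_generated_module class_ring N \<and> diagonal_module N {..<n} (\<lambda>k. padic_ppow (e k))}"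

lemma iso_class_eq_exponent_class:
  assumes "diagonal_module M {..<n} (\<lambda>k. padic_ppow (e k))"
  shows "iso_class M = exponent_class n e"
  unfolding iso_class_def exponent_class_def
  using diagonal_module_transfer[OF assms] diagonal_module_isomorphic[OF assms]
  by (auto simp: finitely_generated_module_def)

text \<open>The cokernel of a diagonal matrix lives in the fixed carrier type of isomorphism
  classes, so every exponent list is realized there.\<close>

lemma exponent_class_nonempty:
  "cokernel (mat n n (\<lambda>(i, j). if i = j then padic_ppow (e i) else 0)) \<in> exponent_class n e"
  by (simp add: exponent_class_def diagonal_cokernel_diag
      diagonal_imp_finitely_generated[OF diagonal_cokernel_diag])

lemma exponent_class_in_module_classes: "exponent_class n e \<in> module_classes"
proof -
  let ?M = "cokernel (mat n n (\<lambda>(i, j). if i = j then padic_ppow (e i) else 0)) :: 'a padic_module"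
  have "iso_class ?M = exponent_class n e"
    by (rule iso_class_eq_exponent_class[OF diagonal_cokernel_diag])
  moreover have "finitely_generated_module class_ring ?M"
    by (rule diagonal_imp_finitely_generated[OF diagonal_cokernel_diag]) simp
  ultimately show ?thesis unfolding module_classes_def by blast
qed

lemma module_classes_imp_exponent_class:
  assumes "H \<in> module_classes"
  obtains n e where "H = exponent_class n e"
proof -
  obtain M :: "'a padic_module" where M: "finitely_generated_module class_ring M" "H = iso_class M"
    using assms by (auto simp: module_classes_def)
  obtain n e where "diagonal_module M {..<n::nat} (\<lambda>k. padic_ppow (e k))"
    using M(1) by (rule finitely_generated_imp_diagonal)
  from iso_class_eq_exponent_class[OF this] show ?thesis using that M(2) by blast
qed

lemma diagonal_class_rep:
  "diagonal_module (class_rep (exponent_class n e :: 'p::prime_card padic_module set)) {..<n}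
    (\<lambda>k. padic_ppow (e k))"
proof -
  have "class_rep (exponent_class n e :: 'p padic_module set) \<in> exponent_class n e"
    unfolding class_rep_def by (rule someI) (rule exponent_class_nonempty)
  then show ?thesis by (simp add: exponent_class_def)
qed

lemma one_le_enat_iff: "1 \<le> (r :: enat) \<longleftrightarrow> r \<noteq> 0"
  by (cases r) (auto simp: one_enat_def zero_enat_def)

lemma diagonal_drop_units:
  fixes M :: "('p::prime_card padic_int, 'b) module" and e :: "'i \<Rightarrow> enat"
  shows "diagonal_module M I (\<lambda>i. padic_ppow (e i)) \<longleftrightarrow>
    diagonal_module M {i\<in>I. e i \<noteq> 0} (\<lambda>i. padic_ppow (e i))"
proof -
  have "padic_ppow 0 = (1 :: 'p padic_int)" by (simp add: padic_ppow_def zero_enat_def)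
  then have *: "(\<forall>i\<in>I. padic_ppow (e i) dvd a i) \<longleftrightarrow> (\<forall>i\<in>{i\<in>I. e i \<noteq> 0}. padic_ppow (e i) dvd a i)"
    for a :: "'i \<Rightarrow> 'p padic_int" by auto
  show ?thesis
    by (rule iffI; erule diagonal_module_cong; rule * *[symmetric])
qed

lemma exponent_class_eqI:
  fixes n e n' e'
  defines "H \<equiv> exponent_class n e :: 'p::prime_card padic_module set"
  assumes f: "bij_betw f {k. k < n \<and> e k \<noteq> 0} {k. k < n' \<and> e' k \<noteq> 0}"
    and e: "\<And>k. k < n \<Longrightarrow> e k \<noteq> 0 \<Longrightarrow> e' (f k) = e k"
  shows "H = exponent_class n' e'"
proof -
  let ?M = "cokernel (mat n' n' (\<lambda>(i, j). if i = j then padic_ppow (e' i) else 0)) :: 'p padic_module"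
  have "diagonal_module ?M {k\<in>{..<n'}. e' k \<noteq> 0} (\<lambda>k. padic_ppow (e' k))"
    by (rule diagonal_drop_units[THEN iffD1, OF diagonal_cokernel_diag])
  moreover have "bij_betw f {k\<in>{..<n}. e k \<noteq> 0} {k\<in>{..<n'}. e' k \<noteq> 0}"
    using f by simp
  ultimately have "diagonal_module ?M {k\<in>{..<n}. e k \<noteq> 0} (\<lambda>k. padic_ppow (e' (f k)))"
    by (rule diagonal_module_reindex)
  then have "diagonal_module ?M {k\<in>{..<n}. e k \<noteq> 0} (\<lambda>k. padic_ppow (e k))"
    by (rule diagonal_module_cong) (simp add: e)
  then have "diagonal_module ?M {..<n} (\<lambda>k. padic_ppow (e k))"
    by (rule diagonal_drop_units[THEN iffD2])
  then have "iso_class ?M = H"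
    unfolding H_def by (rule iso_class_eq_exponent_class)
  moreover have "iso_class ?M = exponent_class n' e'"
    by (rule iso_class_eq_exponent_class[OF diagonal_cokernel_diag])
  ultimately show ?thesis by (rule subst)
qed

lemma exponent_class_cong:
  "(\<And>k. k < n \<Longrightarrow> e k = e' k) \<Longrightarrow> exponent_class n e = exponent_class n e'"
  by (rule exponent_class_eqI[of id]) (auto simp: bij_betw_def)

lemma s_invariant_exponent_class: "s_invariant (exponent_class n e) = card {k. k < n \<and> e k \<noteq> 0}"
  unfolding s_invariant_def
  by (subst diagonal_vectorspace_dim[OF diagonal_mod_p[OF diagonal_class_rep]])
    (auto simp: padic_red_ppow intro!: arg_cong[of _ _ card])

lemma class_prod_exponent_class:
  "class_prod (exponent_class n e) (exponent_class n' e') =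
    exponent_class (n + n') (\<lambda>k. if k < n then e k else e' (k - n))"
  unfolding class_prod_def
proof (rule iso_class_eq_exponent_class)
  show "diagonal_module (direct_sum (class_rep (exponent_class n e)) (class_rep (exponent_class n' e')))
    {..<n + n'} (\<lambda>k. padic_ppow (if k < n then e k else e' (k - n)))"
    using diagonal_direct_sum[OF diagonal_class_rep diagonal_class_rep, of n e n' e']
    by (simp only: if_distrib[of padic_ppow])
qed

lemma class_zero_exponent_class: "class_zero = exponent_class 0 e"
  unfolding class_zero_def
  by (rule iso_class_eq_exponent_class) (simp add: diagonal_zero_module)

lemma iso_class_cyclic_module:
  "iso_class (cyclic_module r :: ('p::prime_card padic_int, 'p padic_int set) module)
    = exponent_class 1 (\<lambda>_. r)"
proof (rule iso_class_eq_exponent_class)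
  have "bij_betw (\<lambda>_. ()) {..<1::nat} {()}" by (auto simp: bij_betw_def inj_on_def)
  from diagonal_module_reindex[OF diagonal_cyclic[of r] this]
  show "diagonal_module (cyclic_module r :: ('p padic_int, 'p padic_int set) module) {..<1::nat}
    (\<lambda>_. padic_ppow r)" by simp
qed

text \<open>The invariant s(H) counts the nonzero exponents, so at most \<open>n\<close> of them
  occur; the remaining places are filled with 0.\<close>

lemma exponent_class_of_length:
  assumes "H \<in> module_classes" "s_invariant H \<le> n"
  obtains e where "H = exponent_class n e"
proof -
  obtain k e where H: "H = exponent_class k e"
    using assms(1) by (rule module_classes_imp_exponent_class)
  define J where "J = {i. i < k \<and> e i \<noteq> 0}"
  have J: "finite J" "card J \<le> n"
    using assms(2) by (simp_all add: J_def H s_invariant_exponent_class)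
  obtain f where f: "bij_betw f {..<card J} J"
    using ex_bij_betw_nat_finite[OF J(1)] by (auto simp: atLeast0LessThan)
  let ?e = "\<lambda>i. if i < card J then e (f i) else 0"
  have "f i \<in> J" if "i < card J" for i using f that by (auto simp: bij_betw_def)
  then have "{i. i < n \<and> ?e i \<noteq> 0} = {..<card J}" using J(2) by (auto simp: J_def)
  then have "exponent_class n ?e = H"
    unfolding H using f by (intro exponent_class_eqI[of f]) (auto simp: J_def split: if_splits)
  then show ?thesis using that by metis
qed

text \<open>The number of nontrivial cyclic factors is the dimension of the reduction mod p, hence
  the same for every decomposition. A decomposition must be exhibited first, so that the choice in
  \<open>cyclic_exponents\<close> meets its specification.\<close>

lemma sum_cyclic_exponents:
  fixes n e
  defines "H \<equiv> exponent_class n e :: 'p::prime_card padic_module set"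
  shows "(\<Sum>r | 1 \<le> r \<and> cyclic_exponents H r \<noteq> 0. cyclic_exponents H r)
    = card {k. k < n \<and> e k \<noteq> 0}"
proof -
  let ?K = "\<lambda>d. {(r, j). 1 \<le> r \<and> j < d r} :: (enat \<times> nat) set"
  let ?P = "\<lambda>d. product_module (?K d) (\<lambda>(r, j). cyclic_module r)
    :: ('p padic_int, enat \<times> nat \<Rightarrow> 'p padic_int set) module"
  let ?spec = "\<lambda>d. d 0 = 0 \<and> finite {r. d r \<noteq> 0} \<and> module_isomorphic class_ring (class_rep H) (?P d)"
  define M where "M = class_rep H"
  define J where "J = {k \<in> {..<n}. e k \<noteq> 0}"
  have M: "diagonal_module M {..<n} (\<lambda>k. padic_ppow (e k))"
    unfolding M_def H_def by (rule diagonal_class_rep)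
  then have MJ: "diagonal_module M J (\<lambda>k. padic_ppow (e k))"
    unfolding J_def by (rule diagonal_drop_units[THEN iffD1])
  have P: "diagonal_module (?P d) (?K d) (\<lambda>rj. padic_ppow (fst rj))" for d
    by (rule diagonal_product) (auto simp: diagonal_cyclic split: prod.split)
  have "\<exists>d. ?spec d"
  proof -
    \<comment> \<open>Witness: the multiplicity of each nonzero exponent, with the indices of equal
      exponent enumerated by \<open>g r\<close>.\<close>
    define d where "d r = card {k\<in>J. e k = r}" for r
    have "\<exists>g. bij_betw g {..<d r} {k\<in>J. e k = r}" for r
      using ex_bij_betw_nat_finite[of "{k\<in>J. e k = r}"] by (auto simp: d_def J_def atLeast0LessThan)
    then obtain g where g: "\<And>r. bij_betw (g r) {..<d r} {k\<in>J. e k = r}" by metis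
    have d0: "d 0 = 0" by (auto simp: d_def J_def)
    have "{r. d r \<noteq> 0} \<subseteq> e ` J" by (auto simp: d_def card_eq_0_iff)
    then have fin: "finite {r. d r \<noteq> 0}"
      by (rule finite_subset) (simp add: J_def)
    have gJ: "g r j \<in> J \<and> e (g r j) = r" if "j < d r" for r j
      using g[of r] that by (auto simp: bij_betw_def)
    have "bij_betw (\<lambda>(r, j). g r j) (?K d) J"
    proof (rule bij_betw_imageI)
      show "inj_on (\<lambda>(r, j). g r j) (?K d)"
      proof (rule inj_onI, clarsimp)
        fix r j r' j' assume *: "j < d r" "j' < d r'" "g r j = g r' j'"
        then have "r = r'" using gJ by metis
        with * show "r = r' \<and> j = j'"
          using g[of r] by (auto simp: bij_betw_def dest: inj_onD)
      qed
      show "(\<lambda>(r, j). g r j) ` ?K d = J"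
      proof (intro equalityI subsetI)
        fix k assume k: "k \<in> J"
        then have "k \<in> g (e k) ` {..<d (e k)}"
          using g[of "e k"] by (auto simp: bij_betw_def)
        then obtain j where "k = g (e k) j" "j < d (e k)" by blast
        then show "k \<in> (\<lambda>(r, j). g r j) ` ?K d"
          using k by (intro image_eqI[of _ _ "(e k, j)"]) (auto simp: J_def one_le_enat_iff)
      qed (use gJ in auto)
    qed
    then have "diagonal_module M (?K d) (\<lambda>rj. padic_ppow (e (case rj of (r, j) \<Rightarrow> g r j)))"
      by (rule diagonal_module_reindex[OF MJ])
    then have "diagonal_module M (?K d) (\<lambda>rj. padic_ppow (fst rj))"
      by (rule diagonal_module_cong) (auto simp: gJ)
    then have "module_isomorphic class_ring M (?P d)"
      by (rule diagonal_module_isomorphic[OF _ P])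
    with d0 fin show ?thesis unfolding M_def by blast
  qed
  then have "?spec (cyclic_exponents H)"
    unfolding cyclic_exponents_def by (rule someI_ex)
  then have d: "finite {r. cyclic_exponents H r \<noteq> 0}"
    and iso: "module_isomorphic class_ring M (?P (cyclic_exponents H))"
    by (simp_all add: M_def)
  let ?d = "cyclic_exponents H"
  have K: "?K ?d = Sigma {r. 1 \<le> r \<and> ?d r \<noteq> 0} (\<lambda>r. {..<?d r})" by auto
  have finR: "finite {r. 1 \<le> r \<and> ?d r \<noteq> 0}" using d by (rule rev_finite_subset) auto
  then have fin: "finite (?K ?d)" unfolding K by blast
  have PJ: "diagonal_module (?P ?d) {..<n} (\<lambda>k. padic_ppow (e k))"
    by (rule diagonal_module_transfer[OF M iso diagonal_module_is_module[OF P]])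
  \<comment> \<open>Both presentations of the same product module yield its dimension mod p.\<close>
  have "card {k \<in> {..<n}. padic_red (padic_ppow (e k) :: 'p padic_int) = 0}
      = vectorspace.dim class_ring (mod_p (?P ?d))"
    using diagonal_vectorspace_dim[OF diagonal_mod_p[OF PJ]] by simp
  also have "\<dots> = card {rj \<in> ?K ?d. padic_red (padic_ppow (fst rj) :: 'p padic_int) = 0}"
    by (rule diagonal_vectorspace_dim[OF diagonal_mod_p[OF P] fin])
  also have "{rj \<in> ?K ?d. padic_red (padic_ppow (fst rj) :: 'p padic_int) = 0} = ?K ?d"
    by (auto simp: padic_red_ppow one_le_enat_iff)
  also have "card (?K ?d) = (\<Sum>r | 1 \<le> r \<and> ?d r \<noteq> 0. ?d r)"
    unfolding K using finR by simp
  also have "{k \<in> {..<n}. padic_red (padic_ppow (e k) :: 'p padic_int) = 0} = {k. k < n \<and> e k \<noteq> 0}"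
    by (auto simp: padic_red_ppow)
  finally show ?thesis by simp
qed

lemma card_zero_add_card_nonzero:
  "card {k. k < n \<and> e k = 0} + card {k. k < n \<and> e k \<noteq> (0 :: enat)} = n"
proof -
  have "{k. k < n \<and> e k = 0} \<union> {k. k < n \<and> e k \<noteq> 0} = {..<n}" by auto
  then show ?thesis by (subst card_Un_disjoint[symmetric]) auto
qed

lemma d_zero_exponent_class: "d_zero n (exponent_class n e) = int (card {k. k < n \<and> e k = 0})"
  using card_zero_add_card_nonzero[of n e]
  unfolding d_zero_def of_nat_sum[symmetric] sum_cyclic_exponents by simp

text \<open>Two finite-dimensional spaces over the residue field are compared by dimension: zero
  diagonal entries on one side, nontrivial cyclic factors on the other.\<close>

lemma cokernel_isomorphic_mod_p_iff:
  fixes B :: "'p::prime_card mod_ring mat"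
  assumes "diagonal_module (cokernel B) {..<n} c"
  shows "module_isomorphic class_ring (cokernel B) (mod_p (class_rep (exponent_class n e)))
    \<longleftrightarrow> card {k. k < n \<and> c k = 0} = card {k. k < n \<and> e k \<noteq> 0}"
proof -
  have "{k \<in> {..<n}. padic_red (padic_ppow (e k) :: 'p padic_int) = 0} = {k. k < n \<and> e k \<noteq> 0}"
    by (auto simp: padic_red_ppow)
  then show ?thesis
    using diagonal_isomorphic_field_iff[OF assms _ diagonal_mod_p[OF diagonal_class_rep], of n e]
    by simp
qed

section \<open>Coranks of matrix polynomials\<close>

lemma mat_inverse:
  fixes A :: "'a::field mat"
  assumes "A \<in> carrier_mat n n" "det A \<noteq> 0"
  obtains A' where "A' \<in> carrier_mat n n" "A * A' = 1\<^sub>m n" "A' * A = 1\<^sub>m n"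
  using det_non_zero_imp_unit[OF assms, where b = "()"] by (auto simp: Units_def ring_mat_simps)

lemma mat_mult_entry:
  fixes A B :: "'a::semiring_0 mat"
  assumes "A \<in> carrier_mat nr n" "B \<in> carrier_mat n nc" "i < nr" "j < nc"
  shows "(A * B) $$ (i, j) = (\<Sum>k<n. A $$ (i, k) * B $$ (k, j))"
  using assms by (simp add: scalar_prod_def atLeast0LessThan)

lemma det_upper_triangular_nonzero:
  fixes A :: "'a::field mat"
  assumes "A \<in> carrier_mat n n" "\<And>i j. j < i \<Longrightarrow> i < n \<Longrightarrow> A $$ (i, j) = 0"
    and "\<And>i. i < n \<Longrightarrow> A $$ (i, i) \<noteq> 0"
  shows "det A \<noteq> 0"
proof -
  have "upper_triangular A" using assms(1,2) by (auto simp: upper_triangular_def)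
  then show ?thesis
    using upper_triangular_imp_det_eq_0_iff[OF assms(1)] assms(1,3) by (auto simp: diag_mat_def)
qed

text \<open>The rank normal form with its \<open>s\<close> zeros placed first: \<open>s\<close> is
  the corank, and the vanishing rows of an evaluated polynomial matrix become the first
  \<open>s\<close> rows.\<close>

definition corank_form :: "nat \<Rightarrow> 'a::field mat \<Rightarrow> nat \<Rightarrow> bool" where
  "corank_form n B s \<longleftrightarrow> s \<le> n \<and> (\<exists>U V. U \<in> carrier_mat n n \<and> V \<in> carrier_mat n n \<and>
     det U \<noteq> 0 \<and> det V \<noteq> 0 \<and> U * B * V = mat n n (\<lambda>(i, j). if i = j \<and> s \<le> i then 1 else 0))"

lemma swap_mat_properties:
  fixes C :: "'a::field mat"
  assumes "C \<in> carrier_mat n n" "a < n" "t < n"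
  shows "det (swaprows_mat n a t :: 'a mat) \<noteq> 0"
    and "swaprows_mat n a t * C = swaprows a t C" "C * swaprows_mat n a t = swapcols a t C"
proof -
  have "swaprows_mat n a t * swaprows_mat n a t = (1\<^sub>m n :: 'a mat)"
    by (rule swaprows_mat_inv[OF assms(2,3)])
  then have "det (swaprows_mat n a t :: 'a mat) * det (swaprows_mat n a t :: 'a mat) = 1"
    by (metis det_mult det_one swaprows_mat_carrier)
  then show "det (swaprows_mat n a t :: 'a mat) \<noteq> 0" by auto
  show "swaprows_mat n a t * C = swaprows a t C" "C * swaprows_mat n a t = swapcols a t C"
    using swaprows_mat[OF assms] swapcols_mat[OF assms] by simp_all
qed

text \<open>One elimination step, growing the identity block from the lower right: \<open>E\<close>
  clears the column above the pivot and normalizes it, \<open>F\<close> clears the row to its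
  left.\<close>

lemma pivot_step:
  fixes C :: "'a::field mat"
  assumes C: "C \<in> carrier_mat n n" and t: "t < n" and pivot: "C $$ (t, t) \<noteq> 0"
    and reduced: "\<And>i j. i < n \<Longrightarrow> j < n \<Longrightarrow> t < i \<or> t < j \<Longrightarrow> C $$ (i, j) = (if i = j then 1 else 0)"
  obtains E F where "E \<in> carrier_mat n n" "F \<in> carrier_mat n n" "det E \<noteq> 0" "det F \<noteq> 0"
    "\<And>i j. i < n \<Longrightarrow> j < n \<Longrightarrow> t \<le> i \<or> t \<le> j \<Longrightarrow> (E * C * F) $$ (i, j) = (if i = j then 1 else 0)"
proof -
  define c where "c = C $$ (t, t)"
  \<comment> \<open>\<open>E\<close> is the identity plus column \<open>t\<close> filled with
    \<open>g\<close>; the value \<open>1 / c - 1\<close> therefore makes its diagonal entry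
    \<open>1 / c\<close>.\<close>
  define g where "g i = (if i < t then - C $$ (i, t) / c else if i = t then 1 / c - 1 else 0)" for i
  define h where "h j = (if j < t then - C $$ (t, j) / c else 0)" for j
  define E where "E = mat n n (\<lambda>(i, k). (if k = i then 1 else 0) + (if k = t then g i else 0))"
  define F where "F = mat n n (\<lambda>(k, j). (if k = j then 1 else 0) + (if k = t then h j else 0))"
  have c: "c \<noteq> 0" using pivot by (simp add: c_def)
  have carr: "E \<in> carrier_mat n n" "F \<in> carrier_mat n n" by (simp_all add: E_def F_def)
  have "det E \<noteq> 0"
    by (rule det_upper_triangular_nonzero[OF carr(1)]) (auto simp: E_def g_def c)
  moreover have "det F \<noteq> 0"
  proof -
    have "det (transpose_mat F) \<noteq> 0"
      by (rule det_upper_triangular_nonzero[of _ n]) (auto simp: F_def h_def)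
    then show ?thesis using det_transpose[OF carr(2)] by simp
  qed
  moreover have "(E * C * F) $$ (i, j) = (if i = j then 1 else 0)"
    if i: "i < n" and j: "j < n" and ij: "t \<le> i \<or> t \<le> j" for i j
  proof -
    have EC: "(E * C) $$ (i, j) = C $$ (i, j) + g i * C $$ (t, j)" if "i < n" "j < n" for i j
      using that C t by (simp add: E_def scalar_prod_def distrib_right sum.distrib
          if_distrib[of "\<lambda>z. z * _"] cong: if_cong)
    have "(E * C * F) $$ (i, j) = (\<Sum>k<n. (E * C) $$ (i, k) * F $$ (k, j))"
      using i j C carr by (intro mat_mult_entry) simp_all
    also have "\<dots> = (\<Sum>k<n. (if k = j then (E * C) $$ (i, k) else 0)
        + (if k = t then (E * C) $$ (i, k) * h j else 0))"
      using j by (intro sum.cong) (auto simp: F_def distrib_left)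
    also have "\<dots> = (E * C) $$ (i, j) + (E * C) $$ (i, t) * h j"
      using j t by (simp add: sum.distrib)
    finally have ECF: "(E * C * F) $$ (i, j) =
        C $$ (i, j) + g i * C $$ (t, j) + (C $$ (i, t) + g i * c) * h j"
      using EC i j t by (simp add: c_def)
    have tt: "C $$ (t, k) = 0" "C $$ (k, t) = 0" if "t < k" "k < n" for k
      using reduced[of t k] reduced[of k t] that t by auto
    consider "i < t" "t < j" | "i < t" "j = t" | "i = t" "j < t" | "i = t" "j = t"
      | "i = t" "t < j" | "t < i"
      using ij by linarith
    then show ?thesis
    proof cases
      case 1
      then show ?thesis using ECF reduced[OF i j] tt[of j] j by (simp add: h_def)
    next
      case 2
      then show ?thesis using ECF c by (simp add: h_def g_def c_def)
    next
      case 3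
      then show ?thesis using ECF c by (simp add: h_def g_def c_def field_simps)
    next
      case 4
      then show ?thesis using ECF c by (simp add: h_def g_def c_def field_simps)
    next
      case 5
      then show ?thesis using ECF tt[of j] j by (simp add: h_def)
    next
      case 6
      then show ?thesis using ECF reduced[OF i j] tt[of i] i by (simp add: g_def)
    qed
  qed
  ultimately show ?thesis using carr that by blast
qed

lemma mat_regroup:
  fixes E :: "'a::comm_ring_1 mat"
  assumes "E \<in> carrier_mat n n" "S \<in> carrier_mat n n" "U \<in> carrier_mat n n" "B \<in> carrier_mat n n"
    "V \<in> carrier_mat n n" "T \<in> carrier_mat n n" "F \<in> carrier_mat n n"
  shows "E * (S * (U * B * V) * T) * F = (E * S * U) * B * (V * T * F)"
  using assms by (simp add: assoc_mult_mat[of _ n n _ n _ n])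

lemma det_mult3:
  fixes A :: "'a::comm_ring_1 mat"
  assumes "A \<in> carrier_mat n n" "B \<in> carrier_mat n n" "C \<in> carrier_mat n n"
  shows "det (A * B * C) = det A * det B * det C"
  using assms by (simp add: det_mult[of _ n])

text \<open>Take the least \<open>s\<close> for which all rows and columns from \<open>s\<close> on
  can be made those of the identity. A nonzero entry left in the upper block could be swapped to
  position \<open>s - 1\<close> and eliminated, contradicting minimality.\<close>

lemma ex_corank_form:
  fixes B :: "'a::field mat"
  assumes B: "B \<in> carrier_mat n n"
  shows "\<exists>s. corank_form n B s"
proof -
  define P where "P s \<longleftrightarrow> s \<le> n \<and> (\<exists>U V. U \<in> carrier_mat n n \<and> V \<in> carrier_mat n n \<and>
     det U \<noteq> 0 \<and> det V \<noteq> 0 \<and> (\<forall>i<n. \<forall>j<n. s \<le> i \<or> s \<le> j \<longrightarrow>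
       (U * B * V) $$ (i, j) = (if i = j then 1 else 0)))" for s
  have "P n"
    unfolding P_def using B by (auto intro!: exI[of _ "1\<^sub>m n"])
  then have "P (LEAST s. P s)" by (rule LeastI)
  moreover define s where "s = (LEAST s. P s)"
  ultimately obtain U V where s: "s \<le> n" and UV: "U \<in> carrier_mat n n" "V \<in> carrier_mat n n"
    "det U \<noteq> 0" "det V \<noteq> 0"
    and reduced: "\<And>i j. i < n \<Longrightarrow> j < n \<Longrightarrow> s \<le> i \<or> s \<le> j \<Longrightarrow>
       (U * B * V) $$ (i, j) = (if i = j then 1 else 0)"
    unfolding P_def by blast
  have zero: "(U * B * V) $$ (a, b) = 0" if a: "a < s" and b: "b < s" for a b
  proof (rule ccontr)
    assume nz: "(U * B * V) $$ (a, b) \<noteq> 0"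
    define t where "t = s - 1"
    have t: "t < s" "t < n" "s = Suc t" and ab: "a \<le> t" "b \<le> t" "a < n" "b < n"
      using a b s by (auto simp: t_def)
    let ?S = "swaprows_mat n a t :: 'a mat" and ?T = "swaprows_mat n b t :: 'a mat"
    define C where "C = ?S * (U * B * V) * ?T"
    have D: "U * B * V \<in> carrier_mat n n" using UV B by simp
    have C: "C \<in> carrier_mat n n" unfolding C_def
      by (rule mult_carrier_mat[OF mult_carrier_mat[OF swaprows_mat_carrier D] swaprows_mat_carrier])
    have C_swap: "C = swapcols b t (swaprows a t (U * B * V))"
      unfolding C_def using D ab t by (simp add: swap_mat_properties)
    \<comment> \<open>The transposition of \<open>k\<close> and \<open>t\<close>. Both indices are
      at most \<open>t\<close>, so the swaps leave the finished identity block alone.\<close>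
    define \<sigma> where "\<sigma> k i = (if i = k then t else if i = t then k else i)" for k i
    have \<sigma>_le: "\<sigma> k i \<le> t" if "k \<le> t" "i \<le> t" for k i using that by (simp add: \<sigma>_def)
    have \<sigma>_gt: "\<sigma> k i = i" if "k \<le> t" "t < i" for k i using that by (simp add: \<sigma>_def)
    have C_ij: "C $$ (i, j) = (U * B * V) $$ (\<sigma> a i, \<sigma> b j)" if "i < n" "j < n" for i j
      unfolding C_swap \<sigma>_def using that carrier_matD[OF D] ab t by simp
    have C_pivot: "C $$ (t, t) \<noteq> 0" using C_ij[of t t] t nz by (simp add: \<sigma>_def split: if_splits)
    have C_reduced: "C $$ (i, j) = (if i = j then 1 else 0)"
      if i: "i < n" and j: "j < n" and ij: "t < i \<or> t < j" for i j
    proof -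
      have "\<sigma> a i < n" "\<sigma> b j < n"
        using i j \<sigma>_le[OF ab(1)] \<sigma>_le[OF ab(2)] \<sigma>_gt[OF ab(1)] \<sigma>_gt[OF ab(2)] t
        by (metis le_less_trans not_le)+
      moreover have "s \<le> \<sigma> a i \<or> s \<le> \<sigma> b j"
        using ij \<sigma>_gt[OF ab(1)] \<sigma>_gt[OF ab(2)] t(3) by auto
      moreover have "\<sigma> a i = \<sigma> b j \<longleftrightarrow> i = j"
      proof (cases "t < i"; cases "t < j")
        assume "t < i" "\<not> t < j"
        then show ?thesis using \<sigma>_gt[OF ab(1), of i] \<sigma>_le[OF ab(2), of j] by auto
      next
        assume "\<not> t < i" "t < j"
        then show ?thesis using \<sigma>_gt[OF ab(2), of j] \<sigma>_le[OF ab(1), of i] by auto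
      qed (use ij \<sigma>_gt[OF ab(1), of i] \<sigma>_gt[OF ab(2), of j] in auto)
      ultimately show ?thesis using C_ij[OF i j] reduced[of "\<sigma> a i" "\<sigma> b j"] by simp
    qed
    obtain E F where EF: "E \<in> carrier_mat n n" "F \<in> carrier_mat n n" "det E \<noteq> 0" "det F \<noteq> 0"
      and new: "\<And>i j. i < n \<Longrightarrow> j < n \<Longrightarrow> t \<le> i \<or> t \<le> j \<Longrightarrow>
        (E * C * F) $$ (i, j) = (if i = j then 1 else 0)"
      using pivot_step[OF C t(2) C_pivot C_reduced] by blast
    have W: "E * ?S * U \<in> carrier_mat n n" "V * ?T * F \<in> carrier_mat n n"
      using EF UV swaprows_mat_carrier by (intro mult_carrier_mat[of _ n n _ n]; blast)+
    have "E * C * F = (E * ?S * U) * B * (V * ?T * F)"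
      unfolding C_def using EF UV B swaprows_mat_carrier by (intro mat_regroup[of _ n]) blast+
    then have "\<forall>i<n. \<forall>j<n. t \<le> i \<or> t \<le> j \<longrightarrow>
        ((E * ?S * U) * B * (V * ?T * F)) $$ (i, j) = (if i = j then 1 else 0)"
      using new by (simp only:) blast
    moreover have "det (E * ?S * U) \<noteq> 0" "det (V * ?T * F) \<noteq> 0"
    proof -
      have "det (E * ?S * U) = det E * det ?S * det U" "det (V * ?T * F) = det V * det ?T * det F"
        using EF UV swaprows_mat_carrier by (intro det_mult3[of _ n]; blast)+
      then show "det (E * ?S * U) \<noteq> 0" "det (V * ?T * F) \<noteq> 0"
        using EF UV swap_mat_properties(1)[OF B ab(3) t(2)] swap_mat_properties(1)[OF B ab(4) t(2)]
        by simp_all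
    qed
    moreover have "t \<le> n" using t by simp
    ultimately have "P t" unfolding P_def using W by blast
    then have "s \<le> t" unfolding s_def by (rule Least_le)
    then show False using t by simp
  qed
  have "U * B * V = mat n n (\<lambda>(i, j). if i = j \<and> s \<le> i then 1 else 0)"
  proof (rule eq_matI)
    fix i j assume ij: "i < dim_row (mat n n (\<lambda>(i, j). if i = j \<and> s \<le> i then 1 else (0 :: 'a)))"
      "j < dim_col (mat n n (\<lambda>(i, j). if i = j \<and> s \<le> i then 1 else (0 :: 'a)))"
    then show "(U * B * V) $$ (i, j) = mat n n (\<lambda>(i, j). if i = j \<and> s \<le> i then 1 else 0) $$ (i, j)"
      using zero[of i j] reduced[of i j] by (cases "s \<le> i \<or> s \<le> j") auto
  qed (use UV B in auto)
  then show ?thesis unfolding corank_form_def using s UV by blast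
qed

lemma diagonal_cokernel_corank_form:
  assumes B: "B \<in> carrier_mat n n" and "corank_form n B s"
  shows "diagonal_module (cokernel B) {..<n} (\<lambda>i. if i < s then 0 else 1)"
proof -
  obtain U V where UV: "U \<in> carrier_mat n n" "V \<in> carrier_mat n n" "det U \<noteq> 0" "det V \<noteq> 0"
    and eq: "U * B * V = mat n n (\<lambda>(i, j). if i = j \<and> s \<le> i then 1 else 0)"
    using assms(2) by (auto simp: corank_form_def)
  obtain U' where U': "U' \<in> carrier_mat n n" "U * U' = 1\<^sub>m n" "U' * U = 1\<^sub>m n"
    using mat_inverse[OF UV(1,3)] .
  obtain V' where V': "V' \<in> carrier_mat n n" "V * V' = 1\<^sub>m n" "V' * V = 1\<^sub>m n"
    using mat_inverse[OF UV(2,4)] .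
  show ?thesis
  proof (rule diagonal_cokernel[OF B UV(1) U' UV(2) V'(1,2)])
    show "U * B * V = mat n n (\<lambda>(i, j). if i = j then if i < s then 0 else 1 else 0)"
      unfolding eq by (rule eq_matI) auto
  qed
qed

section \<open>Degree and vanishing order of determinants\<close>

lemma degree_det_le_sum:
  fixes A :: "'a::field poly mat"
  assumes A: "A \<in> carrier_mat n n"
    and deg: "\<And>i j. i < n \<Longrightarrow> j < n \<Longrightarrow> degree (A $$ (i, j)) \<le> d i"
  shows "degree (det A) \<le> (\<Sum>i<n. d i)"
  unfolding det_def'[OF A]
proof (rule degree_sum_le)
  show "finite {p. p permutes {0..<n}}" by (simp add: finite_permutations)
  fix p assume "p \<in> {p. p permutes {0..<n}}"
  then have p: "p i < n" if "i < n" for i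
    using that by (auto dest: permutes_in_image[of _ _ i])
  have "degree (signof p * (\<Prod>i = 0..<n. A $$ (i, p i))) \<le> degree (\<Prod>i = 0..<n. A $$ (i, p i))"
    by (rule order.trans[OF degree_mult_le]) simp
  also have "\<dots> \<le> (\<Sum>i = 0..<n. degree (A $$ (i, p i)))"
    using degree_prod_sum_le[of "{0..<n}" "\<lambda>i. A $$ (i, p i)"] by (simp add: o_def)
  also have "\<dots> \<le> (\<Sum>i = 0..<n. d i)"
    by (intro sum_mono deg) (use p in auto)
  finally show "degree (signof p * (\<Prod>i = 0..<n. A $$ (i, p i))) \<le> (\<Sum>i<n. d i)"
    by (simp add: atLeast0LessThan)
qed

text \<open>Each term of the Leibniz formula takes one factor from each of the first
  \<open>s\<close> rows.\<close>

lemma power_dvd_det: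
  fixes A :: "'a::comm_ring_1 mat"
  assumes A: "A \<in> carrier_mat n n" and s: "s \<le> n"
    and dvd: "\<And>i j. i < s \<Longrightarrow> j < n \<Longrightarrow> q dvd A $$ (i, j)"
  shows "q ^ s dvd det A"
  unfolding det_def'[OF A]
proof (rule dvd_sum, rule dvd_mult)
  fix p assume "p \<in> {p. p permutes {0..<n}}"
  then have p: "p i < n" if "i < n" for i
    using that by (auto dest: permutes_in_image[of _ _ i])
  have "(\<Prod>i\<in>{0..<s}. q) dvd (\<Prod>i\<in>{0..<s}. A $$ (i, p i))"
    using p s by (intro prod_dvd_prod dvd) auto
  also have "\<dots> dvd (\<Prod>i\<in>{0..<n}. A $$ (i, p i))"
    using s by (intro prod_dvd_prod_subset) auto
  finally show "q ^ s dvd (\<Prod>i = 0..<n. A $$ (i, p i))" by simp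
qed

lemma sum_order_le_degree:
  fixes p :: "'a::idom poly"
  assumes "p \<noteq> 0" "finite A"
  shows "(\<Sum>a\<in>A. order a p) \<le> degree p"
proof -
  have "(\<Sum>a\<in>A. order a p) = (\<Sum>a\<in>A. count (proots p) a)"
    using assms(1) by simp
  also have "\<dots> = size (filter_mset (\<lambda>a. a \<in> A) (proots p))"
    unfolding size_multiset_overloaded_eq using assms
    by (intro sum.mono_neutral_cong_right) (auto simp: order_root)
  also have "\<dots> \<le> degree p"
    using size_filter_mset_lesseq size_proots_le by (rule order.trans)
  finally show ?thesis .
qed

lemma det_map_const_poly:
  "det (map_mat (\<lambda>c. [:c:]) A) = [:det A:]" for A :: "'a::comm_ring_1 mat"
proof -
  have "comm_ring_hom (\<lambda>a :: 'a. [:a:])"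
    by unfold_locales (simp_all add: one_pCons)
  then show ?thesis by (rule comm_ring_hom.hom_det)
qed

lemma
  fixes A B :: "'a::comm_ring_1 poly mat"
  shows det_map_poly_eval: "det (map_mat (\<lambda>q. poly q a) A) = poly (det A) a"
    and map_poly_eval_mult: "A \<in> carrier_mat nr n \<Longrightarrow> B \<in> carrier_mat n nc \<Longrightarrow>
      map_mat (\<lambda>q. poly q a) (A * B) = map_mat (\<lambda>q. poly q a) A * map_mat (\<lambda>q. poly q a) B"
proof -
  have hom: "comm_ring_hom (\<lambda>q :: 'a poly. poly q a)" "semiring_hom (\<lambda>q :: 'a poly. poly q a)"
    by unfold_locales simp_all
  show "det (map_mat (\<lambda>q. poly q a) A) = poly (det A) a"
    using hom(1) by (rule comm_ring_hom.hom_det)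
  show "map_mat (\<lambda>q. poly q a) (A * B) = map_mat (\<lambda>q. poly q a) A * map_mat (\<lambda>q. poly q a) B"
    if "A \<in> carrier_mat nr n" "B \<in> carrier_mat n nc"
    using hom(2) that by (rule semiring_hom.mat_hom_mult)
qed

lemma eval_const_mat: "map_mat (\<lambda>q. poly q a) (map_mat (\<lambda>c. [:c:]) A) = A"
  by (rule eq_matI) auto

text \<open>Constant invertible matrices bring the value at \<open>a\<close> to normal form and
  change the determinant only by a nonzero constant. The first \<open>s\<close> rows then vanish at
  \<open>a\<close>, so each contributes a factor t - a.\<close>

lemma corank_le_order_det:
  fixes N :: "'a::field poly mat"
  assumes N: "N \<in> carrier_mat n n" and "det N \<noteq> 0"
    and cork: "corank_form n (map_mat (\<lambda>q. poly q a) N) s"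
  shows "s \<le> order a (det N)"
proof -
  let ?ev = "map_mat (\<lambda>q. poly q a)"
  obtain U V where s: "s \<le> n" and UV: "U \<in> carrier_mat n n" "V \<in> carrier_mat n n" "det U \<noteq> 0" "det V \<noteq> 0"
    and eq: "U * ?ev N * V = mat n n (\<lambda>(i, j). if i = j \<and> s \<le> i then 1 else 0)"
    using cork by (auto simp: corank_form_def)
  define G where "G = map_mat (\<lambda>c. [:c:]) U * N * map_mat (\<lambda>c. [:c:]) V"
  have G: "G \<in> carrier_mat n n" unfolding G_def using UV N by simp
  have "?ev G = U * ?ev N * V"
    unfolding G_def using UV N
    by (simp add: map_poly_eval_mult[of _ n n _ n] eval_const_mat)
  then have ev_G: "?ev G = mat n n (\<lambda>(i, j). if i = j \<and> s \<le> i then 1 else 0)"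
    by (simp only: eq)
  have "poly (G $$ (i, j)) a = 0" if "i < s" "j < n" for i j
  proof -
    have "poly (G $$ (i, j)) a = ?ev G $$ (i, j)" using that s G by simp
    then show ?thesis using that s by (simp add: ev_G)
  qed
  then have "[:- a, 1:] ^ s dvd det G"
    using G s by (intro power_dvd_det[of _ n]) (auto simp: poly_eq_0_iff_dvd)
  moreover have "det G = [:det U:] * det N * [:det V:]"
    unfolding G_def using UV N by (simp add: det_mult[of _ n] det_map_const_poly)
  ultimately have "[:- a, 1:] ^ s dvd Polynomial.smult (det U * det V) (det N)"
    by (simp add: ac_simps)
  then have "[:- a, 1:] ^ s dvd det N"
    using UV by (simp add: dvd_smult_iff)
  then show ?thesis using order_max assms(2) by blast
qed

text \<open>Valid for every index \<open>i0\<close>; the minimal one is chosen only when the lemma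
  is applied. The determinant bounds the coranks at the other points by its degree, and adding
  \<open>s i0\<close> itself turns card I - 1 into card I.\<close>

lemma corank_sum_bound:
  fixes Q :: "'a::field poly mat"
  assumes Q: "Q \<in> carrier_mat n n" and deg: "\<And>i j. i < n \<Longrightarrow> j < n \<Longrightarrow> degree (Q $$ (i, j)) \<le> l"
    and I: "finite I" "i0 \<in> I" and x: "inj_on x I" and l: "l < card I"
    and cork: "\<And>i. i \<in> I \<Longrightarrow> corank_form n (map_mat (\<lambda>q. poly q (x i)) Q) (s i)"
  shows "(\<Sum>i\<in>I. s i) \<le> s i0 * card I + (n - s i0) * l"
proof -
  let ?ev = "\<lambda>a. map_mat (\<lambda>q. poly q a)"
  let ?C = "map_mat (\<lambda>c. [:c:])"
  obtain U V where s: "s i0 \<le> n" and UV: "U \<in> carrier_mat n n" "V \<in> carrier_mat n n" "det U \<noteq> 0" "det V \<noteq> 0"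
    and eq: "U * ?ev (x i0) Q * V = mat n n (\<lambda>(i, j). if i = j \<and> s i0 \<le> i then 1 else 0)"
    using cork[OF I(2)] by (auto simp: corank_form_def)
  \<comment> \<open>The least product of linear factors that vanishes at all the other points;
    distinctness of the points keeps it nonzero at \<open>x i0\<close>.\<close>
  define Z where "Z = (\<Prod>i\<in>I - {i0}. [:- x i, 1:])"
  define D where "D = mat n n (\<lambda>(i, j). if i = j \<and> i < s i0 then Z else 0)"
  define N where "N = ?C U * Q * ?C V + D"
  have carr: "D \<in> carrier_mat n n" "N \<in> carrier_mat n n"
    unfolding N_def using UV Q by (simp_all add: D_def)
  have ev_N: "?ev a N = U * ?ev a Q * V + ?ev a D" for a
  proof -
    have "?ev a N = ?ev a (?C U * Q * ?C V) + ?ev a D"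
      unfolding N_def by (rule eq_matI) (use UV Q carr in auto)
    then show ?thesis using UV Q
      by (simp add: map_poly_eval_mult[of _ n n _ n] eval_const_mat)
  qed
  have Z0: "poly Z (x i0) \<noteq> 0"
    using I x by (auto simp: Z_def poly_prod inj_on_def)
  \<comment> \<open>The vanishing diagonal entries are now filled with the nonzero value of
    \<open>Z\<close>, so \<open>det N\<close> is nonzero at this point and hence as a
    polynomial.\<close>
  have "?ev (x i0) N = mat n n (\<lambda>(i, j). if i = j then if i < s i0 then poly Z (x i0) else 1 else 0)"
    unfolding ev_N eq by (rule eq_matI) (auto simp: D_def)
  then have "det (?ev (x i0) N) \<noteq> 0"
    using Z0 by (intro det_upper_triangular_nonzero[of _ n]) auto
  then have det_N: "det N \<noteq> 0" by (auto simp: det_map_poly_eval)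
  have order_N: "s i \<le> order (x i) (det N)" if i: "i \<in> I - {i0}" for i
  proof (rule corank_le_order_det[OF carr(2) det_N])
    have "poly Z (x i) = 0"
      unfolding Z_def poly_prod using i I(1) by (intro prod_zero) (auto intro!: bexI[of _ i])
    then have "?ev (x i) D = 0\<^sub>m n n" by (intro eq_matI) (auto simp: D_def)
    then have evi: "?ev (x i) N = U * ?ev (x i) Q * V"
      unfolding ev_N using UV Q by simp
    obtain U1 V1 where UV1: "U1 \<in> carrier_mat n n" "V1 \<in> carrier_mat n n" "det U1 \<noteq> 0" "det V1 \<noteq> 0"
      and s1: "s i \<le> n"
      and eq1: "U1 * ?ev (x i) Q * V1 = mat n n (\<lambda>(i', j). if i' = j \<and> s i \<le> i' then 1 else 0)"
      using cork[of i] i by (auto simp: corank_form_def)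
    obtain U' where U': "U' \<in> carrier_mat n n" "U * U' = 1\<^sub>m n" "U' * U = 1\<^sub>m n"
      using mat_inverse[OF UV(1,3)] .
    obtain V' where V': "V' \<in> carrier_mat n n" "V * V' = 1\<^sub>m n" "V' * V = 1\<^sub>m n"
      using mat_inverse[OF UV(2,4)] .
    \<comment> \<open>\<open>U\<close> and \<open>V\<close> were adapted to \<open>x i0\<close>;
      undoing them shows that the value of \<open>N\<close> at \<open>x i\<close> has the same
      corank as that of \<open>Q\<close>.\<close>
    have "(U1 * U') * (U * ?ev (x i) Q * V) * (V' * V1)
      = U1 * ((U' * U) * (?ev (x i) Q * ((V * V') * V1)))"
      using UV1 UV U'(1) V'(1) Q by (simp add: assoc_mult_mat[of _ n n _ n _ n])
    also have "\<dots> = U1 * ?ev (x i) Q * V1"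
      using U' V' UV1 Q by (simp add: assoc_mult_mat[of _ n n _ n _ n])
    finally have "(U1 * U') * ?ev (x i) N * (V' * V1)
      = mat n n (\<lambda>(i', j). if i' = j \<and> s i \<le> i' then 1 else 0)"
      unfolding evi eq1 .
    moreover have "det U' \<noteq> 0" "det V' \<noteq> 0"
      using det_mult[OF UV(1) U'(1)] det_mult[OF UV(2) V'(1)] U'(2) V'(2) by auto
    then have "det (U1 * U') \<noteq> 0" "det (V' * V1) \<noteq> 0"
      using UV1 U'(1) V'(1) by (simp_all add: det_mult[of _ n])
    ultimately show "corank_form n (?ev (x i) N) (s i)"
      unfolding corank_form_def using s1 UV1 U'(1) V'(1)
      by (intro conjI exI[of _ "U1 * U'"] exI[of _ "V' * V1"]) auto
  qed
  have deg_Z: "degree Z = card I - 1"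
    unfolding Z_def using I by (subst degree_prod_eq_sum_degree) auto
  have deg_UQV: "degree ((?C U * Q * ?C V) $$ (i, j)) \<le> l" if "i < n" "j < n" for i j
  proof -
    have 1: "degree ((?C U * Q) $$ (i, k)) \<le> l" if k: "k < n" for k
    proof -
      have "(?C U * Q) $$ (i, k) = (\<Sum>k'<n. ?C U $$ (i, k') * Q $$ (k', k))"
        using \<open>i < n\<close> k UV Q by (intro mat_mult_entry) simp_all
      also have "\<dots> = (\<Sum>k'<n. Polynomial.smult (U $$ (i, k')) (Q $$ (k', k)))"
        using \<open>i < n\<close> UV by (intro sum.cong) auto
      also have "degree \<dots> \<le> l"
        by (rule degree_sum_le) (auto intro: order.trans[OF degree_smult_le] deg k)
      finally show ?thesis .
    qed
    have "(?C U * Q * ?C V) $$ (i, j) = (\<Sum>k<n. (?C U * Q) $$ (i, k) * ?C V $$ (k, j))"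
      using that UV Q by (intro mat_mult_entry mult_carrier_mat) simp_all
    also have "\<dots> = (\<Sum>k<n. Polynomial.smult (V $$ (k, j)) ((?C U * Q) $$ (i, k)))"
      using that UV by (intro sum.cong) (auto simp del: index_mult_mat(1))
    also have "degree \<dots> \<le> l"
      by (rule degree_sum_le) (auto intro: order.trans[OF degree_smult_le] 1)
    finally show ?thesis .
  qed
  have "(\<Sum>i\<in>I. s i) = s i0 + (\<Sum>i\<in>I - {i0}. s i)"
    using I by (simp add: sum.remove)
  also have "(\<Sum>i\<in>I - {i0}. s i) \<le> (\<Sum>i\<in>I - {i0}. order (x i) (det N))"
    by (rule sum_mono) (rule order_N)
  also have "\<dots> = (\<Sum>a\<in>x ` (I - {i0}). order a (det N))"
    using x by (subst sum.reindex) (auto intro: inj_on_subset)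
  also have "\<dots> \<le> degree (det N)"
    by (rule sum_order_le_degree[OF det_N]) (use I in auto)
  also have "\<dots> \<le> (\<Sum>i<n. if i < s i0 then card I - 1 else l)"
  proof (rule degree_det_le_sum[OF carr(2)])
    fix i j assume ij: "i < n" "j < n"
    have "N $$ (i, j) = (?C U * Q * ?C V) $$ (i, j) + D $$ (i, j)"
      unfolding N_def using ij carr UV Q by simp
    moreover have "degree (D $$ (i, j)) \<le> (if i < s i0 then card I - 1 else l)"
      using ij by (auto simp: D_def deg_Z)
    \<comment> \<open>This is where l < card I enters: in the first \<open>s i0\<close> rows the
      degree of \<open>Z\<close> must also bound that of the entries coming from
      \<open>Q\<close>.\<close>
    moreover have "l \<le> card I - 1" using l by simp
    ultimately show "degree (N $$ (i, j)) \<le> (if i < s i0 then card I - 1 else l)"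
      using deg_UQV[OF ij] by (auto intro!: degree_add_le split: if_splits)
  qed
  also have "\<dots> = s i0 * (card I - 1) + (n - s i0) * l"
  proof -
    have "{..<n} = {..<s i0} \<union> {s i0..<n}" using s by auto
    then have "(\<Sum>i<n. if i < s i0 then card I - 1 else l)
        = (\<Sum>i<s i0. card I - 1) + (\<Sum>i\<in>{s i0..<n}. l)"
      by (simp add: sum.union_disjoint ivl_disj_int)
    then show ?thesis by simp
  qed
  finally have "(\<Sum>i\<in>I. s i) \<le> s i0 + (s i0 * (card I - 1) + (n - s i0) * l)" by simp
  also have "s i0 + (s i0 * (card I - 1) + (n - s i0) * l) = s i0 * card I + (n - s i0) * l"
    using l by (cases "card I") auto
  finally show ?thesis .
qed

section \<open>Evaluation of integrals\<close>

lemma finsum_mat_entry: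
  fixes f :: "'k \<Rightarrow> 'a::comm_ring_1 mat"
  assumes "finite A" "\<And>k. k \<in> A \<Longrightarrow> f k \<in> carrier_mat n n"
  shows "finsum (ring_mat TYPE('a) n b) f A \<in> carrier_mat n n \<and>
    (\<forall>i<n. \<forall>j<n. finsum (ring_mat TYPE('a) n b) f A $$ (i, j) = (\<Sum>k\<in>A. f k $$ (i, j)))"
  using assms
proof (induction A rule: finite_induct)
  case empty
  interpret ring "ring_mat TYPE('a) n b" by (rule ring_mat)
  show ?case by (simp add: ring_mat_simps)
next
  case (insert a A)
  interpret ring "ring_mat TYPE('a) n b" by (rule ring_mat)
  have "finsum (ring_mat TYPE('a) n b) f (insert a A) = f a + finsum (ring_mat TYPE('a) n b) f A"
    using insert by (subst finsum_insert) (auto simp: ring_mat_simps)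
  moreover have "dim_row (finsum (ring_mat TYPE('a) n b) f A) = n"
    "dim_col (finsum (ring_mat TYPE('a) n b) f A) = n"
    using insert by auto
  ultimately show ?case using insert by simp
qed

lemma scalar_mat_pow:
  "((a :: 'a::comm_ring_1) \<cdot>\<^sub>m 1\<^sub>m n) [^]\<^bsub>ring_mat TYPE('a) n b\<^esub> (k::nat) = a ^ k \<cdot>\<^sub>m 1\<^sub>m n"
proof -
  interpret ring "ring_mat TYPE('a) n b" by (rule ring_mat)
  show ?thesis
  proof (induction k)
    case 0
    show ?case by (auto simp: ring_mat_simps intro!: eq_matI)
  next
    case (Suc k)
    have "(a ^ k \<cdot>\<^sub>m 1\<^sub>m n) * (a \<cdot>\<^sub>m 1\<^sub>m n) = a ^ k \<cdot>\<^sub>m (1\<^sub>m n * (a \<cdot>\<^sub>m 1\<^sub>m n))"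
      by (rule mult_smult_assoc_mat[of _ n n _ n]) auto
    also have "1\<^sub>m n * (a \<cdot>\<^sub>m 1\<^sub>m n) = a \<cdot>\<^sub>m 1\<^sub>m n" by (rule left_mult_one_mat[of _ n n]) auto
    also have "a ^ k \<cdot>\<^sub>m (a \<cdot>\<^sub>m 1\<^sub>m n) = a ^ Suc k \<cdot>\<^sub>m 1\<^sub>m n"
      by (rule eq_matI) auto
    finally show ?case using Suc by (simp add: ring_mat_simps)
  qed
qed

text \<open>\<open>UnivPoly.eval\<close> sums up to the formal degree of \<open>P\<close>. All
  coefficients beyond it, and all beyond \<open>N\<close>, vanish, so both sums agree with the one
  up to the larger bound.\<close>

lemma
  fixes P :: "nat \<Rightarrow> 'p::prime_card padic_int mat"
  assumes P: "P \<in> carrier (UP (padic_mat_ring n))" and N: "\<And>k. N < k \<Longrightarrow> P k = 0\<^sub>m n n"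
  shows mat_poly_eval_carrier: "mat_poly_eval n P a \<in> carrier_mat n n"
    and mat_poly_eval_entry: "i < n \<Longrightarrow> j < n \<Longrightarrow>
      mat_poly_eval n P a $$ (i, j) = (\<Sum>k\<le>N. P k $$ (i, j) * a ^ k)"
proof -
  let ?R = "padic_mat_ring n :: 'p padic_int mat ring"
  let ?t = "\<lambda>k. P k * (a ^ k \<cdot>\<^sub>m 1\<^sub>m n)"
  have up: "P \<in> up ?R" using P by (simp add: UP_def)
  then have carr: "P k \<in> carrier_mat n n" for k by (auto simp: up_def ring_mat_simps)
  have coeff: "up_ring.coeff (UP ?R) P = P" using up by (simp add: UP_def)
  have t: "?t k \<in> carrier_mat n n" for k
    using carr by (intro mult_carrier_mat[of _ n n _ n]) auto
  have eval: "mat_poly_eval n P a = finsum ?R ?t {..deg ?R P}"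
    unfolding mat_poly_eval_def UnivPoly.eval_def using P
    by (simp add: coeff scalar_mat_pow ring_mat_simps)
  have "\<exists>d. bound \<zero>\<^bsub>?R\<^esub> d (up_ring.coeff (UP ?R) P)"
    using up by (auto simp: coeff up_def)
  then have "bound \<zero>\<^bsub>?R\<^esub> (deg ?R P) (up_ring.coeff (UP ?R) P)"
    unfolding deg_def by (rule LeastI_ex)
  then have deg: "P k = 0\<^sub>m n n" if "deg ?R P < k" for k
    using that by (auto simp: coeff ring_mat_simps bound_def)
  have entry: "?t k $$ (i, j) = P k $$ (i, j) * a ^ k" if "i < n" "j < n" for i j k
  proof -
    have "?t k = a ^ k \<cdot>\<^sub>m (P k * 1\<^sub>m n)"
      using carr by (intro mult_smult_distrib[of _ n n _ n]) auto
    also have "P k * 1\<^sub>m n = P k" using carr by (rule right_mult_one_mat)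
    finally show ?thesis using that carr[of k] by (simp add: mult.commute)
  qed
  note sum = finsum_mat_entry[of "{..deg ?R P}" ?t n "()", OF _ t]
  show "mat_poly_eval n P a \<in> carrier_mat n n" using sum by (simp add: eval)
  show "mat_poly_eval n P a $$ (i, j) = (\<Sum>k\<le>N. P k $$ (i, j) * a ^ k)" if ij: "i < n" "j < n"
  proof -
    have "mat_poly_eval n P a $$ (i, j) = (\<Sum>k\<le>deg ?R P. P k $$ (i, j) * a ^ k)"
      using sum ij by (simp add: eval entry)
    also have "\<dots> = (\<Sum>k\<le>max N (deg ?R P). P k $$ (i, j) * a ^ k)"
      using deg ij by (intro sum.mono_neutral_left) auto
    also have "\<dots> = (\<Sum>k\<le>N. P k $$ (i, j) * a ^ k)"
      using N ij by (intro sum.mono_neutral_right) auto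
    finally show ?thesis .
  qed
qed

text \<open>Every coefficient beyond degree \<open>l\<close> carries p to the power
  \<open>k - l\<close>, which is positive, so it disappears in the residue field.\<close>

lemma integral_reduction:
  fixes P :: "nat \<Rightarrow> 'p::prime_card padic_int mat"
  assumes "is_integral n l P"
  obtains Q where "Q \<in> carrier_mat n n" "\<And>i j. i < n \<Longrightarrow> j < n \<Longrightarrow> degree (Q $$ (i, j)) \<le> l"
    "\<And>a. map_mat padic_red (mat_poly_eval n P a) = map_mat (\<lambda>q. poly q (padic_red a)) Q"
proof -
  let ?R = "padic_mat_ring n :: 'p padic_int mat ring"
  obtain r A where P: "P \<in> carrier (UP ?R)" and A: "\<And>k. A k \<in> carrier_mat n n"
    and coeff: "\<And>k. up_ring.coeff (UP ?R) P k =
          (if k \<le> l then A k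
           else if k \<le> l + r then padic_p ^ (k - l) \<cdot>\<^sub>m A k
           else 0\<^sub>m n n)"
    using assms by (auto simp: is_integral_def)
  have "up_ring.coeff (UP ?R) P = P" using P by (simp add: UP_def)
  note coeff = coeff[unfolded this]
  define Q where "Q = mat n n (\<lambda>(i, j). \<Sum>k\<le>l. Polynomial.monom (padic_red (A k $$ (i, j))) k)"
  show ?thesis
  proof (rule that[of Q])
    show "Q \<in> carrier_mat n n" by (simp add: Q_def)
    show "degree (Q $$ (i, j)) \<le> l" if "i < n" "j < n" for i j
      using that by (auto simp: Q_def intro!: degree_sum_le order.trans[OF degree_monom_le])
    show "map_mat padic_red (mat_poly_eval n P a) = map_mat (\<lambda>q. poly q (padic_red a)) Q" for a
    proof (rule eq_matI)
      have 0: "P k = 0\<^sub>m n n" if "l + r < k" for k using that by (simp add: coeff)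
      have carr: "mat_poly_eval n P a \<in> carrier_mat n n" by (rule mat_poly_eval_carrier[OF P 0])
      show "dim_row (map_mat padic_red (mat_poly_eval n P a)) = dim_row (map_mat (\<lambda>q. poly q (padic_red a)) Q)"
        "dim_col (map_mat padic_red (mat_poly_eval n P a)) = dim_col (map_mat (\<lambda>q. poly q (padic_red a)) Q)"
        using carr by (auto simp: Q_def)
      fix i j assume "i < dim_row (map_mat (\<lambda>q. poly q (padic_red a)) Q)"
        "j < dim_col (map_mat (\<lambda>q. poly q (padic_red a)) Q)"
      then have ij: "i < n" "j < n" by (auto simp: Q_def)
      have "padic_red (mat_poly_eval n P a $$ (i, j))
          = (\<Sum>k\<le>l + r. padic_red (P k $$ (i, j)) * padic_red a ^ k)"
        by (simp add: mat_poly_eval_entry[OF P 0 ij] padic_red.hom_sum padic_red.hom_mult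
            padic_red.hom_power)
      also have "\<dots> = (\<Sum>k\<le>l. padic_red (P k $$ (i, j)) * padic_red a ^ k)"
      proof (rule sum.mono_neutral_right)
        show "\<forall>k\<in>{..l + r} - {..l}. padic_red (P k $$ (i, j)) * padic_red a ^ k = 0"
          using ij A by (auto simp: coeff padic_red.hom_mult padic_red.hom_power padic_red_p
              carrier_matD[OF A])
      qed auto
      also have "\<dots> = poly (Q $$ (i, j)) (padic_red a)"
        using ij by (simp add: Q_def coeff poly_sum poly_monom)
      finally show "map_mat padic_red (mat_poly_eval n P a) $$ (i, j)
        = map_mat (\<lambda>q. poly q (padic_red a)) Q $$ (i, j)"
        using ij carr by (simp add: Q_def)
    qed
  qed
qed

lemma diagonal_integral:
  fixes q :: "nat \<Rightarrow> 'p::prime_card padic_int poly"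
  assumes "\<And>i. i < n \<Longrightarrow> degree (q i) \<le> l"
  obtains P where "is_integral n l P"
    "\<And>a. mat_poly_eval n P a = mat n n (\<lambda>(i, j). if i = j then poly (q i) a else 0)"
proof -
  let ?R = "padic_mat_ring n :: 'p padic_int mat ring"
  define P where "P k = mat n n (\<lambda>(i, j). if i = j then Polynomial.coeff (q i) k else 0)" for k
  have zero: "P k = 0\<^sub>m n n" if "l < k" for k
    unfolding P_def by (rule eq_matI) (use le_less_trans[OF assms that] in \<open>auto intro!: coeff_eq_0\<close>)
  have carr: "P k \<in> carrier_mat n n" for k by (simp add: P_def)
  have up: "P \<in> up ?R"
    using carr zero by (auto simp: up_def ring_mat_simps bound_def)
  then have P: "P \<in> carrier (UP ?R)" and coeff: "up_ring.coeff (UP ?R) P = P"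
    by (simp_all add: UP_def)
  show ?thesis
  proof (rule that)
    show "is_integral n l P"
      unfolding is_integral_def coeff
      \<comment> \<open>With \<open>r = 0\<close> the integral has no terms beyond degree
        \<open>l\<close>.\<close>
      using P carr zero by (auto intro!: exI[of _ "0::nat"] exI[of _ P])
    show "mat_poly_eval n P a = mat n n (\<lambda>(i, j). if i = j then poly (q i) a else 0)" for a
    proof (rule eq_matI)
      fix i j assume "i < dim_row (mat n n (\<lambda>(i, j). if i = j then poly (q i) a else 0))"
        "j < dim_col (mat n n (\<lambda>(i, j). if i = j then poly (q i) a else 0))"
      then have ij: "i < n" "j < n" by auto
      have "poly (q i) a = (\<Sum>k\<le>l. Polynomial.coeff (q i) k * a ^ k)"
      proof -
        have "poly (q i) a = (\<Sum>k\<le>degree (q i). Polynomial.coeff (q i) k * a ^ k)"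
          by (rule poly_altdef)
        also have "\<dots> = (\<Sum>k\<le>l. Polynomial.coeff (q i) k * a ^ k)"
          using assms[OF ij(1)] by (intro sum.mono_neutral_left) (auto simp: coeff_eq_0)
        finally show ?thesis .
      qed
      moreover have "mat_poly_eval n P a $$ (i, j)
          = (if i = j then \<Sum>k\<le>l. Polynomial.coeff (q i) k * a ^ k else 0)"
      proof -
        have "mat_poly_eval n P a $$ (i, j) = (\<Sum>k\<le>l. P k $$ (i, j) * a ^ k)"
          by (rule mat_poly_eval_entry[OF P zero ij])
        also have "\<dots> = (\<Sum>k\<le>l. (if i = j then Polynomial.coeff (q i) k else 0) * a ^ k)"
          using ij by (simp add: P_def)
        finally show ?thesis by simp
      qed
      ultimately show "mat_poly_eval n P a $$ (i, j)
          = mat n n (\<lambda>(i, j). if i = j then poly (q i) a else 0) $$ (i, j)"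
        using ij by (cases "i = j") simp_all
    qed (use mat_poly_eval_carrier[OF P zero] in auto)
  qed
qed

section \<open>The rank condition\<close>

text \<open>Two distinct numbers in the interval differ by less than \<alpha>, so \<alpha> cannot
  divide their difference.\<close>

lemma inj_on_mod_interval: "d \<le> (\<alpha>::nat) \<Longrightarrow> inj_on (\<lambda>t. t mod \<alpha>) {D..<D + d}"
proof (rule inj_onI)
  fix t t' assume d: "d \<le> \<alpha>" and t: "t \<in> {D..<D + d}" "t' \<in> {D..<D + d}" and eq: "t mod \<alpha> = t' mod \<alpha>"
  show "t = t'"
  proof (rule ccontr)
    assume ne: "t \<noteq> t'"
    have *: False if "u < v" "v < u + \<alpha>" "u mod \<alpha> = v mod \<alpha>" for u v
    proof -
      have "\<alpha> dvd v - u" using that by (metis less_imp_le mod_eq_dvd_iff_nat)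
      then show False using that by (auto dest: dvd_imp_le)
    qed
    show False
      using *[of t t'] *[of t' t] ne t d eq by (cases "t < t'") auto
  qed
qed

lemma ex_block_containing:
  fixes m :: nat
  shows "t < (\<Sum>i=1..m. d i) \<Longrightarrow> \<exists>i\<in>{1..m}. t \<in> {(\<Sum>j=1..<i. d j)..<(\<Sum>j=1..<i. d j) + (d i :: nat)}"
proof (induction m)
  case (Suc m)
  show ?case
  proof (cases "t < (\<Sum>i=1..m. d i)")
    case True
    then show ?thesis using Suc.IH by fastforce
  next
    case False
    then show ?thesis using Suc.prems
      by (intro bexI[of _ "Suc m"]) (auto simp: atLeastLessThanSuc_atLeastAtMost)
  qed
qed simp

text \<open>The sets are dealt cyclically: the consecutive blocks of length \<open>d i\<close> are reduced modulo \<open>\<alpha>\<close>.\<close>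

lemma cyclic_dealing:
  fixes d :: "nat \<Rightarrow> nat"
  assumes "\<forall>i\<in>{1..m}. d i \<le> \<alpha>" and c: "c * \<alpha> \<le> (\<Sum>i=1..m. d i)"
  shows "\<exists>S. (\<forall>i\<in>{1..m}. S i \<subseteq> {..<\<alpha>} \<and> card (S i) = d i) \<and>
    (\<forall>k<\<alpha>. c \<le> card {i\<in>{1..m}. k \<in> S i})"
proof -
  define D where "D i = (\<Sum>j=1..<i. d j)" for i
  define S where "S i = (\<lambda>t. t mod \<alpha>) ` {D i..<D i + d i}" for i
  have d: "d i \<le> \<alpha>" if "i \<in> {1..m}" for i using assms(1) that by blast
  show ?thesis
  proof (intro exI[of _ S] conjI ballI allI impI)
    fix i assume i: "i \<in> {1..m}"
    show "S i \<subseteq> {..<\<alpha>}"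
      using d[OF i] by (cases "\<alpha> = 0") (auto simp: S_def)
    show "card (S i) = d i"
      unfolding S_def by (simp add: card_image inj_on_mod_interval[OF d[OF i]])
  next
    fix k assume k: "k < \<alpha>"
    \<comment> \<open>The \<open>c\<close> numbers congruent to \<open>k\<close> below
      \<open>c * \<alpha>\<close> all lie below the total length of the blocks, so each falls into
      some block.\<close>
    have "\<exists>i\<in>{1..m}. k + j * \<alpha> \<in> {D i..<D i + d i}" if "j < c" for j
    proof -
      have "k + j * \<alpha> < Suc j * \<alpha>" using k by simp
      also have "\<dots> \<le> c * \<alpha>" using that by (intro mult_le_mono1) simp
      finally show ?thesis unfolding D_def using c by (intro ex_block_containing) simp
    qed
    then obtain f where f: "\<And>j. j < c \<Longrightarrow> f j \<in> {1..m}"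
      "\<And>j. j < c \<Longrightarrow> k + j * \<alpha> \<in> {D (f j)..<D (f j) + d (f j)}" by metis
    have "card {..<c} \<le> card {i\<in>{1..m}. k \<in> S i}"
    proof (rule card_inj_on_le)
      show "inj_on f {..<c}"
      proof (rule inj_onI)
        fix j j' assume j: "j \<in> {..<c}" "j' \<in> {..<c}" and eq: "f j = f j'"
        \<comment> \<open>A block has length at most \<alpha> and so contains at most one number
          congruent to \<open>k\<close>; distinct \<open>j\<close> need distinct blocks.\<close>
        have "k + j * \<alpha> = k + j' * \<alpha>"
          using inj_onD[OF inj_on_mod_interval[OF d[OF f(1)]], of j "k + j * \<alpha>" "k + j' * \<alpha>"] j eq
            f(2)[of j] f(2)[of j'] by simp
        then show "j = j'" using k by simp
      qed
      show "f ` {..<c} \<subseteq> {i\<in>{1..m}. k \<in> S i}"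
      proof clarify
        fix j assume j: "j < c"
        have "k = (k + j * \<alpha>) mod \<alpha>" using k by simp
        then have "k \<in> S (f j)" unfolding S_def using f(2)[OF j] by (rule image_eqI)
        then show "f j \<in> {1..m} \<and> k \<in> S (f j)" using f(1)[OF j] by simp
      qed
    qed simp
    then show "c \<le> card {i\<in>{1..m}. k \<in> S i}" by simp
  qed
qed

text \<open>The inequality of the theorem over the naturals, with \<open>d i\<close> as the number
  of zero exponents of the i-th module. The difference \<open>m - l\<close> is exact under l \<le>
  m.\<close>

definition rank_condition :: "nat \<Rightarrow> nat \<Rightarrow> (nat \<Rightarrow> nat) \<Rightarrow> bool" where
  "rank_condition m l d \<longleftrightarrow> (\<exists>\<alpha>. (\<forall>i\<in>{1..m}. d i \<le> \<alpha>) \<and> (m - l) * \<alpha> \<le> (\<Sum>i=1..m. d i))"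

text \<open>The given witness is replaced by the maximum of the \<open>d i\<close>, which is at most
  \<open>n\<close>. A row missing from at most \<open>l\<close> of the sets is a row lying in at
  least \<open>m - l\<close> of them.\<close>

lemma rank_condition_dealing:
  assumes "rank_condition m l d" "\<And>i. d i \<le> n" and l: "1 \<le> l" "l \<le> m"
  shows "\<exists>\<alpha> S. \<alpha> \<le> n \<and> (\<forall>i\<in>{1..m}. S i \<subseteq> {..<\<alpha>} \<and> card (S i) = d i) \<and>
    (\<forall>k<\<alpha>. card {i\<in>{1..m}. k \<notin> S i} \<le> l)"
proof -
  obtain \<beta> where \<beta>: "\<And>i. i \<in> {1..m} \<Longrightarrow> d i \<le> \<beta>" "(m - l) * \<beta> \<le> (\<Sum>i=1..m. d i)"
    using assms(1) unfolding rank_condition_def by blast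
  define \<alpha> where "\<alpha> = Max (d ` {1..m})"
  have ne: "d ` {1..m} \<noteq> {}" using l by auto
  have max: "\<forall>i\<in>{1..m}. d i \<le> \<alpha>" by (simp add: \<alpha>_def)
  have "\<alpha> \<le> n" "\<alpha> \<le> \<beta>" unfolding \<alpha>_def using ne assms(2) \<beta>(1) by (subst Max_le_iff; auto)+
  then have "(m - l) * \<alpha> \<le> (\<Sum>i=1..m. d i)" using \<beta>(2) by (meson mult_le_mono2 order.trans)
  from cyclic_dealing[OF max this] obtain S where S: "\<And>i. i \<in> {1..m} \<Longrightarrow> S i \<subseteq> {..<\<alpha>}" "\<And>i. i \<in> {1..m} \<Longrightarrow> card (S i) = d i"
    "\<And>k. k < \<alpha> \<Longrightarrow> m - l \<le> card {i\<in>{1..m}. k \<in> S i}"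
    by blast
  have "card {i\<in>{1..m}. k \<notin> S i} \<le> l" if "k < \<alpha>" for k
  proof -
    have "card {i\<in>{1..m}. k \<in> S i} + card {i\<in>{1..m}. k \<notin> S i}
        = card ({i\<in>{1..m}. k \<in> S i} \<union> {i\<in>{1..m}. k \<notin> S i})"
      by (subst card_Un_disjoint) auto
    also have "{i\<in>{1..m}. k \<in> S i} \<union> {i\<in>{1..m}. k \<notin> S i} = {1..m}" by auto
    finally show ?thesis using S(3)[OF that] l by simp
  qed
  with S(1,2) \<open>\<alpha> \<le> n\<close> show ?thesis by blast
qed

section \<open>The monoid of tuples and the characterization\<close>

lemma B_monoid_imp_exponent_class:
  assumes "(n, H) \<in> carrier (B_monoid m)"
  obtains e where "H = (\<lambda>i\<in>{1..m}. exponent_class n (e i))"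
proof -
  have H: "H \<in> {1..m} \<rightarrow>\<^sub>E module_classes" "\<And>i. i \<in> {1..m} \<Longrightarrow> s_invariant (H i) \<le> n"
    using assms by (auto simp: B_monoid_def)
  have "\<forall>i\<in>{1..m}. \<exists>e. H i = exponent_class n e"
  proof
    fix i assume i: "i \<in> {1..m}"
    then have "H i \<in> module_classes" using H(1) by blast
    then show "\<exists>e. H i = exponent_class n e"
      using exponent_class_of_length[OF _ H(2)[OF i]] by blast
  qed
  from bchoice[OF this] obtain e where "\<forall>i\<in>{1..m}. H i = exponent_class n (e i)" by (rule exE)
  then have "H = (\<lambda>i\<in>{1..m}. exponent_class n (e i))"
    using H(1) by (intro extensionalityI[of H "{1..m}"]) (auto simp: PiE_def)
  then show ?thesis by (rule that)
qed

lemma exponent_class_in_B_monoid: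
  "(n, \<lambda>i\<in>{1..m}. exponent_class n (e i)) \<in> carrier (B_monoid m)"
proof -
  have "s_invariant (exponent_class n (e i)) \<le> n" for i
    using card_zero_add_card_nonzero[of n "e i"] by (simp add: s_invariant_exponent_class)
  then show ?thesis
    by (auto simp: B_monoid_def exponent_class_in_module_classes)
qed

section \<open>Membership in C and the rank condition\<close>

lemma C_set_imp_rank_condition:
  fixes x :: "nat \<Rightarrow> 'p::prime_card padic_int" and H :: "nat \<Rightarrow> 'p padic_module set"
  assumes x: "inj_on (\<lambda>i. padic_red (x i)) {1..m}" and l: "1 \<le> l" "l \<le> m"
    and C: "(n, \<lambda>i\<in>{1..m}. exponent_class n (e i)) \<in> C_set m x l"
  shows "rank_condition m l (\<lambda>i. card {k. k < n \<and> e i k = 0})"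
proof (cases "l = m")
  case True
  \<comment> \<open>For l = m the inequality reads 0 \<le> sum, so \<alpha> = n is a witness; the
    determinant bound requires l < m.\<close>
  have "card {k. k < n \<and> e i k = 0} \<le> n" for i
    using card_zero_add_card_nonzero[of n "e i"] by simp
  then show ?thesis using True by (auto simp: rank_condition_def)
next
  case False
  define d where "d i = card {k. k < n \<and> e i k = 0}" for i
  obtain P where P: "is_integral n l P"
    and iso: "\<And>i. i \<in> {1..m} \<Longrightarrow> module_isomorphic class_ring
      (cokernel (map_mat padic_red (mat_poly_eval n P (x i))))
      (mod_p (class_rep (exponent_class n (e i) :: 'p padic_module set)))"
    using C by (auto simp: C_set_def)
  obtain Q where Q: "Q \<in> carrier_mat n n" "\<And>i j. i < n \<Longrightarrow> j < n \<Longrightarrow> degree (Q $$ (i, j)) \<le> l"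
    and ev: "\<And>a. map_mat padic_red (mat_poly_eval n P a) = map_mat (\<lambda>q. poly q (padic_red a)) Q"
    using integral_reduction[OF P] by blast
  define B where "B i = map_mat (\<lambda>q. poly q (padic_red (x i))) Q" for i
  have B: "B i \<in> carrier_mat n n" for i using Q(1) by (simp add: B_def)
  obtain s where s: "\<And>i. corank_form n (B i) (s i)"
    using ex_corank_form[OF B] by metis
  have d: "d i + s i = n" if i: "i \<in> {1..m}" for i
  proof -
    have "s i \<le> n" using s by (simp add: corank_form_def)
    then have "{k. k < n \<and> (if k < s i then 0 else 1) = (0 :: 'p mod_ring)} = {..<s i}"
      by (auto split: if_splits)
    then have "s i = card {k. k < n \<and> e i k \<noteq> 0}"
      using iso[OF i] cokernel_isomorphic_mod_p_iff[OF diagonal_cokernel_corank_form[OF B s], of i "e i"]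
      by (simp add: ev B_def)
    then show ?thesis using card_zero_add_card_nonzero[of n "e i"] by (simp add: d_def)
  qed
  \<comment> \<open>Minimal corank means maximal d, so \<open>d i0\<close> dominates every
    \<open>d i\<close> and serves as the witness \<alpha>.\<close>
  define i0 where "i0 = (ARG_MIN s i. i \<in> {1..m})"
  have i0: "i0 \<in> {1..m}" and min: "\<And>i. i \<in> {1..m} \<Longrightarrow> s i0 \<le> s i"
    using arg_min_nat_lemma[of "\<lambda>i. i \<in> {1..m}" 1 s] l by (auto simp: i0_def)
  have bound: "(\<Sum>i\<in>{1..m}. s i) \<le> s i0 * card {1..m} + (n - s i0) * l"
    by (rule corank_sum_bound[OF Q _ i0 x]) (use False l s in \<open>auto simp: B_def\<close>)
  have "(\<Sum>i=1..m. d i) + (\<Sum>i=1..m. s i) = m * n"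
    using d by (simp add: sum.distrib[symmetric])
  \<comment> \<open>Substituting \<open>n = d i0 + s i0\<close> on the left and cancelling
    \<open>s i0 * m\<close> leaves \<open>(m - l) * d i0\<close> below the sum of the
    \<open>d i\<close>.\<close>
  then have "m * n \<le> (\<Sum>i=1..m. d i) + (s i0 * m + d i0 * l)"
    using bound d[OF i0] by auto
  moreover have "m * n = d i0 * m + s i0 * m" using d[OF i0] by (metis add_mult_distrib mult.commute)
  moreover have "d i0 * m = (m - l) * d i0 + d i0 * l"
  proof -
    have "d i0 * m = d i0 * ((m - l) + l)" using l by simp
    then show ?thesis by (simp only: add_mult_distrib2 mult.commute)
  qed
  ultimately have "(m - l) * d i0 \<le> (\<Sum>i=1..m. d i)" by linarith
  moreover have "d i \<le> d i0" if "i \<in> {1..m}" for i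
    using d[OF that] d[OF i0] min[OF that] by linarith
  ultimately show ?thesis unfolding rank_condition_def d_def[symmetric] by blast
qed

text \<open>The dealt sets prescribe where a diagonal polynomial matrix is nonzero: at x_i exactly
  the entries in \<open>S i\<close> survive, which gives corank n - d_i there.\<close>

lemma rank_condition_imp_C_set:
  fixes x :: "nat \<Rightarrow> 'p::prime_card padic_int"
  assumes x: "inj_on (\<lambda>i. padic_red (x i)) {1..m}" and l: "1 \<le> l" "l \<le> m"
    and cond: "rank_condition m l (\<lambda>i. card {k. k < n \<and> e i k = 0})"
  shows "(n, \<lambda>i\<in>{1..m}. exponent_class n (e i)) \<in> C_set m x l"
proof -
  have le: "card {k. k < n \<and> e i k = 0} \<le> n" for i
    using card_zero_add_card_nonzero[of n "e i"] by simp
  obtain \<alpha> S where \<alpha>: "\<alpha> \<le> n" and S: "\<And>i. i \<in> {1..m} \<Longrightarrow> S i \<subseteq> {..<\<alpha>}"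
    "\<And>i. i \<in> {1..m} \<Longrightarrow> card (S i) = card {k. k < n \<and> e i k = 0}"
    "\<And>k. k < \<alpha> \<Longrightarrow> card {i\<in>{1..m}. k \<notin> S i} \<le> l"
    using rank_condition_dealing[OF cond le l] by blast
  \<comment> \<open>Row \<open>k\<close> must vanish at those x_i with k outside \<open>S i\<close>;
    there are at most \<open>l\<close> of them, which bounds the degree. Rows from \<alpha> on
    belong to no \<open>S i\<close> and are zero.\<close>
  define q where "q k = (if k < \<alpha> then \<Prod>i\<in>{i\<in>{1..m}. k \<notin> S i}. [:- x i, 1:] else 0)" for k
  have "degree (q k) \<le> l" for k
  proof (cases "k < \<alpha>")
    case True
    have "degree (q k) \<le> (\<Sum>i\<in>{i\<in>{1..m}. k \<notin> S i}. degree [:- x i, 1:])"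
      using True degree_prod_sum_le[of "{i\<in>{1..m}. k \<notin> S i}" "\<lambda>i. [:- x i, 1:]"]
      by (simp add: q_def o_def)
    also have "\<dots> \<le> l" using S(3)[OF True] by simp
    finally show ?thesis .
  qed (simp add: q_def)
  then obtain P where P: "is_integral n l P"
    and ev: "\<And>a. mat_poly_eval n P a = mat n n (\<lambda>(i, j). if i = j then poly (q i) a else 0)"
    using diagonal_integral[of n q l] by blast
  have "module_isomorphic class_ring (cokernel (map_mat padic_red (mat_poly_eval n P (x i))))
      (mod_p (class_rep (exponent_class n (e i) :: 'p padic_module set)))" if i: "i \<in> {1..m}" for i
  proof -
    define c where "c k = padic_red (poly (q k) (x i))" for k
    have B: "map_mat padic_red (mat_poly_eval n P (x i)) = mat n n (\<lambda>(i, j). if i = j then c i else 0)"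
      unfolding ev by (rule eq_matI) (auto simp: c_def padic_red_0)
    \<comment> \<open>Since the points are distinct mod p, the product has a zero factor at x_i only
      if \<open>i\<close> itself is among its indices.\<close>
    have c: "c k \<noteq> 0 \<longleftrightarrow> k \<in> S i" for k
    proof (cases "k < \<alpha>")
      case True
      have "c k = (\<Prod>j\<in>{j\<in>{1..m}. k \<notin> S j}. padic_red (x i) - padic_red (x j))"
        using True by (simp add: c_def q_def poly_prod padic_red.hom_prod padic_red_minus)
      also have "\<dots> \<noteq> 0 \<longleftrightarrow> (\<forall>j\<in>{j\<in>{1..m}. k \<notin> S j}. padic_red (x i) \<noteq> padic_red (x j))"
        by (subst prod_zero_iff) auto
      also have "\<dots> \<longleftrightarrow> k \<in> S i"
      proof
        assume "\<forall>j\<in>{j\<in>{1..m}. k \<notin> S j}. padic_red (x i) \<noteq> padic_red (x j)"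
        then show "k \<in> S i" using i by blast
      next
        assume k: "k \<in> S i"
        show "\<forall>j\<in>{j\<in>{1..m}. k \<notin> S j}. padic_red (x i) \<noteq> padic_red (x j)"
        proof
          fix j assume "j \<in> {j\<in>{1..m}. k \<notin> S j}"
          then show "padic_red (x i) \<noteq> padic_red (x j)"
            using k i inj_onD[OF x, of i j] by blast
        qed
      qed
      finally show ?thesis .
    next
      case False
      then show ?thesis using S(1)[OF i] by (auto simp: c_def q_def padic_red_0)
    qed
    have sub: "S i \<subseteq> {..<n}" using S(1)[OF i] \<alpha> by auto
    have "{k. k < n \<and> c k = 0} = {..<n} - S i" unfolding c[symmetric] set_diff_eq by simp
    moreover have "finite (S i)" using sub by (rule finite_subset) simp
    ultimately have "card {k. k < n \<and> c k = 0} = n - card (S i)"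
      using card_Diff_subset[OF _ sub] by simp
    also have "\<dots> = card {k. k < n \<and> e i k \<noteq> 0}"
      using S(2)[OF i] card_zero_add_card_nonzero[of n "e i"] by simp
    finally show ?thesis
      unfolding B using cokernel_isomorphic_mod_p_iff[OF diagonal_cokernel_diag] by blast
  qed
  then show ?thesis
    using P exponent_class_in_B_monoid[where n = n and m = m and e = e] by (auto simp: C_set_def)
qed

section \<open>Monoid operation on exponent tables, and generators as single rows\<close>

lemma B_monoid_mult_exponent_class:
  "(n, \<lambda>i\<in>{1..m}. exponent_class n (e i)) \<otimes>\<^bsub>B_monoid m\<^esub> (n', \<lambda>i\<in>{1..m}. exponent_class n' (e' i))
    = (n + n', \<lambda>i\<in>{1..m}. exponent_class (n + n') (\<lambda>k. if k < n then e i k else e' i (k - n)))"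
  by (auto simp: B_monoid_def class_prod_exponent_class intro!: restrict_ext)

lemma B_monoid_one_exponent_class:
  "\<one>\<^bsub>B_monoid m\<^esub> = (0, \<lambda>i\<in>{1..m}. exponent_class 0 (e i))"
  by (auto simp: B_monoid_def intro!: restrict_ext class_zero_exponent_class)

lemma card_zero_append:
  fixes n n' :: nat
  shows "card {k. k < n + n' \<and> (if k < n then e k else e' (k - n)) = (0 :: enat)}
    = card {k. k < n \<and> e k = 0} + card {k. k < n' \<and> e' k = 0}"
proof -
  have "{k. k < n + n' \<and> (if k < n then e k else e' (k - n)) = 0}
      = {k. k < n \<and> e k = 0} \<union> (\<lambda>k. n + k) ` {k. k < n' \<and> e' k = 0}"
  proof (intro equalityI subsetI)
    fix k assume k: "k \<in> {k. k < n + n' \<and> (if k < n then e k else e' (k - n)) = 0}"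
    show "k \<in> {k. k < n \<and> e k = 0} \<union> (\<lambda>k. n + k) ` {k. k < n' \<and> e' k = 0}"
    proof (cases "k < n")
      case False
      then obtain j where "k = n + j" using le_Suc_ex[of n k] by auto
      then show ?thesis using k by auto
    qed (use k in simp)
  qed (auto split: if_splits)
  then show ?thesis
    by (simp only:) (subst card_Un_disjoint, auto simp: card_image)
qed

text \<open>Both requirements are linear in d and \<alpha>, so the witnesses add. This makes C
  closed under the monoid operation.\<close>

lemma rank_condition_add:
  assumes "rank_condition m l d" "rank_condition m l d'"
  shows "rank_condition m l (\<lambda>i. d i + d' i)"
proof -
  obtain \<alpha> \<beta> where "\<forall>i\<in>{1..m}. d i \<le> \<alpha>" "(m - l) * \<alpha> \<le> (\<Sum>i=1..m. d i)"
    "\<forall>i\<in>{1..m}. d' i \<le> \<beta>" "(m - l) * \<beta> \<le> (\<Sum>i=1..m. d' i)"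
    using assms by (auto simp: rank_condition_def)
  then show ?thesis
    unfolding rank_condition_def
    by (intro exI[of _ "\<alpha> + \<beta>"]) (auto simp: sum.distrib add_mono distrib_left)
qed

lemma A_set_eq_exponent_class:
  assumes "a \<in> A_set m r d"
  obtains \<sigma> e where "\<sigma> permutes {1..m}" "\<And>i. i \<in> {1..d} \<Longrightarrow> r \<le> e i"
    "a = (1, \<lambda>i\<in>{1..m}. exponent_class 1 (\<lambda>_. if \<sigma> i \<le> d then e (\<sigma> i) else r))"
proof -
  obtain \<sigma> e where \<sigma>: "\<sigma> permutes {1..m}" "\<And>i. i \<in> {1..d} \<Longrightarrow> r \<le> e i"
    and a: "a = permute_tuple m \<sigma> (1, \<lambda>i\<in>{1..m}. iso_class (cyclic_module (if i \<le> d then e i else r)))"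
    using assms unfolding A_set_def by blast
  have "\<sigma> i \<in> {1..m}" if "i \<in> {1..m}" for i using \<sigma>(1) that by (simp only: permutes_in_image)
  then have "a = (1, \<lambda>i\<in>{1..m}. exponent_class 1 (\<lambda>_. if \<sigma> i \<le> d then e (\<sigma> i) else r))"
    unfolding a permute_tuple_def by (auto simp: iso_class_cyclic_module intro!: restrict_ext)
  with \<sigma> show ?thesis using that by blast
qed

text \<open>\<open>permute_tuple\<close> reads entry \<sigma> i at position \<open>i\<close>, so the
  unpermuted exponents are \<open>e\<close> composed with the inverse of \<sigma>.\<close>

lemma exponent_class_in_A_set:
  assumes \<sigma>: "\<sigma> permutes {1..m}" and "\<And>i. i \<in> {1..m} \<Longrightarrow> r \<le> e i"
    and zero: "\<And>i. i \<in> {1..m} \<Longrightarrow> d < \<sigma> i \<Longrightarrow> e i = r" and d: "d \<le> m"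
  shows "(1, \<lambda>i\<in>{1..m}. exponent_class 1 (\<lambda>_. e i)) \<in> A_set m r d"
proof -
  define f where "f j = e (inv_into UNIV \<sigma> j)" for j
  have \<sigma>i: "\<sigma> i \<in> {1..m}" if "i \<in> {1..m}" for i using \<sigma> that by (simp only: permutes_in_image)
  have f\<sigma>: "f (\<sigma> i) = e i" for i using permutes_inverses[OF \<sigma>] by (simp add: f_def)
  have "r \<le> f j" if "j \<in> {1..d}" for j
  proof -
    have "inv_into UNIV \<sigma> j \<in> {1..m}"
      using permutes_inv[OF \<sigma>] that d by (subst permutes_in_image) auto
    then show ?thesis unfolding f_def by (rule assms(2))
  qed
  moreover have "exponent_class 1 (\<lambda>_. e i)
      = (\<lambda>i\<in>{1..m}. iso_class (cyclic_module (if i \<le> d then f i else r))) (\<sigma> i)" if i: "i \<in> {1..m}" for i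
  proof -
    have "(if \<sigma> i \<le> d then f (\<sigma> i) else r) = e i"
      using zero[OF i] f\<sigma>[of i] by auto
    then show ?thesis
      using \<sigma>i[OF i] by (simp only: restrict_apply iso_class_cyclic_module if_True)
  qed
  then have "(1, \<lambda>i\<in>{1..m}. exponent_class 1 (\<lambda>_. e i)) =
      permute_tuple m \<sigma> (1, \<lambda>i\<in>{1..m}. iso_class (cyclic_module (if i \<le> d then f i else r)))"
    unfolding permute_tuple_def prod.case by (intro arg_cong2[of _ _ _ _ Pair] refl restrict_ext)
  ultimately show ?thesis unfolding A_set_def using \<sigma> by blast
qed

text \<open>A bijection of \<open>Z\<close> with an initial segment is glued to one between the
  complements, which have equal size.\<close>

lemma ex_permutation_into_initial:
  assumes Z: "Z \<subseteq> {1..m}" "card Z \<le> l"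
  obtains \<sigma> where "\<sigma> permutes {1..m}" "\<And>i. i \<in> Z \<Longrightarrow> \<sigma> i \<le> (l::nat)"
proof -
  have fin: "finite Z" using Z(1) by (rule finite_subset) simp
  have le: "card Z \<le> m" using card_mono[OF _ Z(1)] by simp
  obtain f where f: "bij_betw f Z {1..card Z}"
    using finite_same_card_bij[OF fin, of "{1..card Z}"] by auto
  have "card ({1..m} - Z) = card {card Z + 1..m}"
    using Z(1) fin le by (simp add: card_Diff_subset)
  then obtain g where g: "bij_betw g ({1..m} - Z) {card Z + 1..m}"
    using finite_same_card_bij[of "{1..m} - Z" "{card Z + 1..m}"] by auto
  define \<sigma> where "\<sigma> i = (if i \<in> Z then f i else if i \<in> {1..m} then g i else i)" for i
  have 1: "bij_betw \<sigma> Z {1..card Z}"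
    using f by (rule bij_betw_cong[THEN iffD1, rotated]) (simp add: \<sigma>_def)
  have 2: "bij_betw \<sigma> ({1..m} - Z) {card Z + 1..m}"
    using g by (rule bij_betw_cong[THEN iffD1, rotated]) (simp add: \<sigma>_def)
  have "bij_betw \<sigma> (Z \<union> ({1..m} - Z)) ({1..card Z} \<union> {card Z + 1..m})"
    using 1 2 by (rule bij_betw_combine) auto
  moreover have "Z \<union> ({1..m} - Z) = {1..m}" "{1..card Z} \<union> {card Z + 1..m} = {1..m}"
    using Z(1) le by auto
  ultimately have "bij_betw \<sigma> {1..m} {1..m}" by simp
  then have "\<sigma> permutes {1..m}"
    by (rule bij_imp_permutes) (use Z(1) in \<open>auto simp: \<sigma>_def\<close>)
  moreover have "\<sigma> i \<le> l" if "i \<in> Z" for i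
    using bij_betwE[OF 1] that Z(2) by force
  ultimately show ?thesis by (rule that)
qed

text \<open>In the first case a permutation gathers the nonzero entries in the first
  \<open>l\<close> places and leaves zeros elsewhere. In the second, all exponents are at least 1,
  as \<open>A_set m 1 m\<close> demands.\<close>

lemma generator_row:
  assumes l: "l \<le> m" and row: "card {i\<in>{1..m}. e i \<noteq> 0} \<le> l \<or> (\<forall>i\<in>{1..m}. e i \<noteq> 0)"
  shows "(1, \<lambda>i\<in>{1..m}. exponent_class 1 (\<lambda>_. e i)) \<in> A_set m 0 l \<union> A_set m 1 m"
  using row
proof
  assume "card {i\<in>{1..m}. e i \<noteq> 0} \<le> l"
  moreover have "{i\<in>{1..m}. e i \<noteq> 0} \<subseteq> {1..m}" by auto
  ultimately obtain \<sigma> where "\<sigma> permutes {1..m}" "\<And>i. i \<in> {i\<in>{1..m}. e i \<noteq> 0} \<Longrightarrow> \<sigma> i \<le> l"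
    using ex_permutation_into_initial[of "{i\<in>{1..m}. e i \<noteq> 0}" m l] by blast
  then have "(1, \<lambda>i\<in>{1..m}. exponent_class 1 (\<lambda>_. e i)) \<in> A_set m 0 l"
    using l by (intro exponent_class_in_A_set) (auto simp: not_le[symmetric])
  then show ?thesis by blast
next
  assume "\<forall>i\<in>{1..m}. e i \<noteq> 0"
  then have "(1, \<lambda>i\<in>{1..m}. exponent_class 1 (\<lambda>_. e i)) \<in> A_set m 1 m"
    by (intro exponent_class_in_A_set[OF permutes_id]) (auto simp: one_le_enat_iff)
  then show ?thesis by blast
qed

text \<open>The table is the product of its rows in the monoid; the induction splits off the last
  row.\<close>

lemma generated_by_rows:
  assumes N: "submonoid N (B_monoid m)" "A_set m 0 l \<union> A_set m 1 m \<subseteq> N" and l: "l \<le> m"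
    and rows: "\<And>k. k < n \<Longrightarrow> card {i\<in>{1..m}. e i k \<noteq> 0} \<le> l \<or> (\<forall>i\<in>{1..m}. e i k \<noteq> 0)"
  shows "(n, \<lambda>i\<in>{1..m}. exponent_class n (e i)) \<in> N"
  using rows
proof (induction n)
  case 0
  show ?case using submonoid.one_closed[OF N(1)] unfolding B_monoid_one_exponent_class[of m e] .
next
  case (Suc n)
  let ?a = "(n, \<lambda>i\<in>{1..m}. exponent_class n (e i))"
  let ?b = "(1, \<lambda>i\<in>{1..m}. exponent_class 1 (\<lambda>_. e i n))"
  have "?a \<in> N" by (rule Suc.IH, rule Suc.prems, simp)
  moreover have "?b \<in> N" using generator_row[OF l Suc.prems[of n]] N(2) by blast
  ultimately have "?a \<otimes>\<^bsub>B_monoid m\<^esub> ?b \<in> N" by (rule submonoid.m_closed[OF N(1)])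
  also have "?a \<otimes>\<^bsub>B_monoid m\<^esub> ?b = (Suc n, \<lambda>i\<in>{1..m}. exponent_class (Suc n) (e i))"
    unfolding B_monoid_mult_exponent_class
    by (auto intro!: restrict_ext exponent_class_cong simp: less_Suc_eq)
  finally show ?case .
qed

text \<open>Reordering the exponents inside each column does not change the tuple, so the zeros of
  column \<open>i\<close> can be placed exactly on the dealt set \<open>S i\<close>; then every row
  is a generator.\<close>

lemma rank_condition_imp_generated:
  assumes N: "submonoid N (B_monoid m)" "A_set m 0 l \<union> A_set m 1 m \<subseteq> N" and l: "1 \<le> l" "l \<le> m"
    and cond: "rank_condition m l (\<lambda>i. card {k. k < n \<and> e i k = 0})"
  shows "(n, \<lambda>i\<in>{1..m}. exponent_class n (e i)) \<in> N"
proof -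
  have le: "card {k. k < n \<and> e i k = 0} \<le> n" for i
    using card_zero_add_card_nonzero[of n "e i"] by simp
  obtain \<alpha> S where \<alpha>: "\<alpha> \<le> n" and S: "\<And>i. i \<in> {1..m} \<Longrightarrow> S i \<subseteq> {..<\<alpha>}"
    "\<And>i. i \<in> {1..m} \<Longrightarrow> card (S i) = card {k. k < n \<and> e i k = 0}"
    "\<And>k. k < \<alpha> \<Longrightarrow> card {i\<in>{1..m}. k \<notin> S i} \<le> l"
    using rank_condition_dealing[OF cond le l] by blast
  have "\<forall>i\<in>{1..m}. \<exists>f. bij_betw f ({..<n} - S i) {k. k < n \<and> e i k \<noteq> 0}"
  proof
    fix i assume i: "i \<in> {1..m}"
    have "S i \<subseteq> {..<n}" using S(1)[OF i] \<alpha> by auto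
    then have "card ({..<n} - S i) = card {k. k < n \<and> e i k \<noteq> 0}"
      using S(2)[OF i] card_zero_add_card_nonzero[of n "e i"]
      by (simp add: card_Diff_subset finite_subset)
    then show "\<exists>f. bij_betw f ({..<n} - S i) {k. k < n \<and> e i k \<noteq> 0}"
      by (intro finite_same_card_bij) auto
  qed
  from bchoice[OF this] obtain f where
    f: "\<forall>i\<in>{1..m}. bij_betw (f i) ({..<n} - S i) {k. k < n \<and> e i k \<noteq> 0}" by (rule exE)
  \<comment> \<open>The nonzero exponents of column \<open>i\<close> are distributed bijectively
    over the rows outside \<open>S i\<close>.\<close>
  define E where "E i k = (if k \<in> S i then 0 else e i (f i k))" for i k
  have E0: "E i k = 0 \<longleftrightarrow> k \<in> S i" if "i \<in> {1..m}" "k < n" for i k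
    using bij_betwE[OF bspec[OF f that(1)]] that(2) by (auto simp: E_def)
  have "exponent_class n (E i) = (exponent_class n (e i) :: 'a padic_module set)" if i: "i \<in> {1..m}" for i
  proof (rule exponent_class_eqI)
    have "{k. k < n \<and> E i k \<noteq> 0} = {..<n} - S i" using E0[OF i] by auto
    then show "bij_betw (f i) {k. k < n \<and> E i k \<noteq> 0} {k. k < n \<and> e i k \<noteq> 0}"
      using f i by simp
    show "e i (f i k) = E i k" if "k < n" "E i k \<noteq> 0" for k using that by (auto simp: E_def)
  qed
  then have "(n, \<lambda>i\<in>{1..m}. exponent_class n (e i)) = (n, \<lambda>i\<in>{1..m}. exponent_class n (E i) :: 'a padic_module set)"
    by (auto intro!: restrict_ext)
  also have "\<dots> \<in> N"
  proof (rule generated_by_rows[OF N l(2)])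
    fix k assume k: "k < n"
    show "card {i\<in>{1..m}. E i k \<noteq> 0} \<le> l \<or> (\<forall>i\<in>{1..m}. E i k \<noteq> 0)"
    proof (cases "k < \<alpha>")
      case True
      have "{i\<in>{1..m}. E i k \<noteq> 0} = {i\<in>{1..m}. k \<notin> S i}" using E0 k by blast
      then show ?thesis using S(3)[OF True] by simp
    next
      \<comment> \<open>Rows from \<alpha> on lie in no \<open>S i\<close>, so they have no zeros
        and fall under \<open>A_set m 1 m\<close>.\<close>
      case False
      then show ?thesis using E0 k S(1) by blast
    qed
  qed
  finally show ?thesis .
qed

theorem theorem3p12:
  fixes x :: "nat \<Rightarrow> 'p::prime_card padic_int" and m l :: nat
  assumes "inj_on (\<lambda>i. padic_red (x i)) {1..m}"
    and "1 \<le> l" and "l \<le> m"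
  shows "C_set m x l = generated_submonoid (B_monoid m) (A_set m 0 l \<union> A_set m 1 m) \<and>
    (\<forall>n H. (n, H) \<in> carrier (B_monoid m) \<longrightarrow>
       ((n, H) \<in> C_set m x l \<longleftrightarrow>
       (\<exists>\<alpha>\<^sub>0 :: nat. Max ((\<lambda>i. d_zero n (H i)) ` {1..m}) \<le> int \<alpha>\<^sub>0 \<and>
          (\<Sum>i = 1..m. d_zero n (H i)) - (int m - int l) * int \<alpha>\<^sub>0 \<ge> 0)))"
proof
  let ?C = "C_set m x l"
  let ?d = "\<lambda>(n::nat) e i. card {k. k < n \<and> e i k = (0 :: enat)}"
  \<comment> \<open>Every element of the monoid can be written as such a table, so membership in C
    becomes a question about counts of zeros.\<close>
  have C_iff: "(n, \<lambda>i\<in>{1..m}. exponent_class n (e i)) \<in> ?C \<longleftrightarrow> rank_condition m l (?d n e)" for n e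
    using C_set_imp_rank_condition[OF assms] rank_condition_imp_C_set[OF assms] by blast
  have C_sub: "?C \<subseteq> carrier (B_monoid m)" by (auto simp: C_set_def)
  have submonoid: "submonoid ?C (B_monoid m)"
  proof (rule submonoid.intro)
    show "\<one>\<^bsub>B_monoid m\<^esub> \<in> ?C"
      unfolding B_monoid_one_exponent_class[of m "\<lambda>_ _. 0"] C_iff by (simp add: rank_condition_def)
    fix a b assume ab: "a \<in> ?C" "b \<in> ?C"
    obtain n H n' H' where eq: "a = (n, H)" "b = (n', H')" by (cases a; cases b) blast
    obtain e where H: "H = (\<lambda>i\<in>{1..m}. exponent_class n (e i))"
      using ab C_sub eq by (blast elim: B_monoid_imp_exponent_class)
    obtain e' where H': "H' = (\<lambda>i\<in>{1..m}. exponent_class n' (e' i))"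
      using ab C_sub eq by (blast elim: B_monoid_imp_exponent_class)
    have "rank_condition m l (\<lambda>i. ?d n e i + ?d n' e' i)"
      using ab unfolding eq H H' C_iff by (rule rank_condition_add)
    then show "a \<otimes>\<^bsub>B_monoid m\<^esub> b \<in> ?C"
      unfolding eq H H' B_monoid_mult_exponent_class C_iff card_zero_append .
  qed (rule C_sub)
  have A0: "A_set m 0 l \<subseteq> ?C"
  proof
    fix a :: "'p module_tuple" assume "a \<in> A_set m 0 l"
    then obtain \<sigma> e where \<sigma>: "\<sigma> permutes {1..m}"
      and a: "a = (1, \<lambda>i\<in>{1..m}. exponent_class 1 (\<lambda>_. if \<sigma> i \<le> l then e (\<sigma> i) else 0))"
      by (rule A_set_eq_exponent_class) blast
    let ?e = "\<lambda>i _. if \<sigma> i \<le> l then e (\<sigma> i) else 0"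
    \<comment> \<open>At least m - l positions have \<sigma> i > l, and each contributes one zero;
      hence \<alpha> = 1 is a witness.\<close>
    have "m - l = card {l + 1..m}" by simp
    also have "\<dots> \<le> card {i\<in>{1..m}. \<not> \<sigma> i \<le> l}"
    proof (rule surj_card_le)
      show "{l + 1..m} \<subseteq> \<sigma> ` {i\<in>{1..m}. \<not> \<sigma> i \<le> l}"
      proof
        fix j assume j: "j \<in> {l + 1..m}"
        then have "j \<in> \<sigma> ` {1..m}" using permutes_image[OF \<sigma>] by simp
        then show "j \<in> \<sigma> ` {i\<in>{1..m}. \<not> \<sigma> i \<le> l}" using j by auto
      qed
    qed simp
    also have "\<dots> = (\<Sum>i\<in>{i\<in>{1..m}. \<not> \<sigma> i \<le> l}. ?d 1 ?e i)"
      unfolding card_eq_sum by (rule sum.cong) auto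
    also have "\<dots> \<le> (\<Sum>i=1..m. ?d 1 ?e i)"
      by (rule sum_mono2) auto
    finally have "(m - l) * 1 \<le> (\<Sum>i=1..m. ?d 1 ?e i)" by simp
    moreover have "\<forall>i\<in>{1..m}. ?d 1 ?e i \<le> 1"
    proof
      fix i show "?d 1 ?e i \<le> 1" using card_zero_add_card_nonzero[of 1 "?e i"] by linarith
    qed
    ultimately have "rank_condition m l (?d 1 ?e)"
      unfolding rank_condition_def by blast
    then show "a \<in> ?C" unfolding a C_iff .
  qed
  have A1: "A_set m 1 m \<subseteq> ?C"
  proof
    fix a :: "'p module_tuple" assume "a \<in> A_set m 1 m"
    then obtain \<sigma> e where \<sigma>: "\<sigma> permutes {1..m}" and e: "\<And>i. i \<in> {1..m} \<Longrightarrow> 1 \<le> (e i :: enat)"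
      and a: "a = (1, \<lambda>i\<in>{1..m}. exponent_class 1 (\<lambda>_. if \<sigma> i \<le> m then e (\<sigma> i) else 1))"
      by (rule A_set_eq_exponent_class) blast
    have "\<sigma> i \<in> {1..m}" if "i \<in> {1..m}" for i using \<sigma> that by (simp only: permutes_in_image)
    then have "e (\<sigma> i) \<noteq> 0" if "i \<in> {1..m}" for i
      using e[of "\<sigma> i"] that by (simp add: one_le_enat_iff)
    \<comment> \<open>No exponent is 0, so all counts vanish and \<alpha> = 0 is a witness.\<close>
    then have "rank_condition m l (?d 1 (\<lambda>i _. if \<sigma> i \<le> m then e (\<sigma> i) else 1))"
      unfolding rank_condition_def by (intro exI[of _ 0]) auto
    then show "a \<in> ?C" unfolding a C_iff .
  qed
  show "?C = generated_submonoid (B_monoid m) (A_set m 0 l \<union> A_set m 1 m)"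
    unfolding generated_submonoid_def
  proof (intro equalityI Inter_greatest Inter_lower)
    show "?C \<in> {N. submonoid N (B_monoid m) \<and> A_set m 0 l \<union> A_set m 1 m \<subseteq> N}"
      using submonoid A0 A1 by blast
  next
    fix N :: "'p module_tuple set" assume N: "N \<in> {N. submonoid N (B_monoid m) \<and> A_set m 0 l \<union> A_set m 1 m \<subseteq> N}"
    show "?C \<subseteq> N"
    proof
      fix a assume a: "a \<in> ?C"
      obtain n H where eq: "a = (n, H)" by (cases a) blast
      obtain e where H: "H = (\<lambda>i\<in>{1..m}. exponent_class n (e i))"
        using a C_sub eq by (blast elim: B_monoid_imp_exponent_class)
      show "a \<in> N"
        using a N assms(2,3) unfolding eq H C_iff by (blast intro: rank_condition_imp_generated)
    qed
  qed
  show "\<forall>n H. (n, H) \<in> carrier (B_monoid m) \<longrightarrow>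
       ((n, H) \<in> ?C \<longleftrightarrow>
       (\<exists>\<alpha>\<^sub>0 :: nat. Max ((\<lambda>i. d_zero n (H i)) ` {1..m}) \<le> int \<alpha>\<^sub>0 \<and>
          (\<Sum>i = 1..m. d_zero n (H i)) - (int m - int l) * int \<alpha>\<^sub>0 \<ge> 0))"
  proof (intro allI impI)
    fix n :: nat and H :: "nat \<Rightarrow> 'p padic_module set"
    assume "(n, H) \<in> carrier (B_monoid m)"
    then obtain e where H: "H = (\<lambda>i\<in>{1..m}. exponent_class n (e i))"
      by (rule B_monoid_imp_exponent_class)
    have d: "d_zero n (H i) = int (?d n e i)" if "i \<in> {1..m}" for i
      using that by (simp add: H d_zero_exponent_class)
    \<comment> \<open>The bounds 1 \<le> l \<le> m make the index set nonempty, as the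
      characterization of \<open>Max\<close> requires.\<close>
    have "Max ((\<lambda>i. d_zero n (H i)) ` {1..m}) \<le> int \<alpha> \<longleftrightarrow> (\<forall>i\<in>{1..m}. ?d n e i \<le> \<alpha>)" for \<alpha>
      using assms(2,3) d by (subst Max_le_iff) auto
    moreover have "(\<Sum>i = 1..m. d_zero n (H i)) - (int m - int l) * int \<alpha> \<ge> 0
        \<longleftrightarrow> (m - l) * \<alpha> \<le> (\<Sum>i=1..m. ?d n e i)" for \<alpha>
    proof -
      have "(\<Sum>i = 1..m. d_zero n (H i)) = int (\<Sum>i=1..m. ?d n e i)"
        using d by (simp del: of_nat_sum add: of_nat_sum)
      moreover have "(int m - int l) * int \<alpha> = int ((m - l) * \<alpha>)"
        using assms(3) by (simp add: of_nat_diff)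
      ultimately show ?thesis by linarith
    qed
    ultimately show "(n, H) \<in> ?C \<longleftrightarrow>
       (\<exists>\<alpha>\<^sub>0 :: nat. Max ((\<lambda>i. d_zero n (H i)) ` {1..m}) \<le> int \<alpha>\<^sub>0 \<and>
          (\<Sum>i = 1..m. d_zero n (H i)) - (int m - int l) * int \<alpha>\<^sub>0 \<ge> 0)"
      unfolding H C_iff rank_condition_def by simp
  qed
qed

end
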